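(* Suppose $f:O\to\mathbb{R}^n$ is $C^k$ with $k\in\mathbb{N}$, and let $\varphi:\mathcal{D}^\varphi\to O$ be the maximal semiflow generated by the delay equation $\dot x(t)=f(x_t)$. Let $t>0$ be fixed. Then $\varphi_t$ is $C^k$ on $\mathcal{D}^\varphi_t$.
   Context: Fix $h>0$, $n\in\mathbb{N}$. $X=C([-h,0];\mathbb{R}^n)$ with the supremum norm; $O\subset X$ is open. For a function $x$ on $[-h,t^* )$, $x_t\in X$ is $x_t(\theta)=x(t+\theta)$. For locally Lipschitz $f$ and each $u\in O$, the delay equation $\dot x(t)=f(x_t)$, $x_0=u$, has a unique maximal solution (continuous on $[-h,t^* )$, continuously differentiable on $(0,t^* )$ and satisfying the equation there, with right derivative $f(u)$ at $0$); $\varphi_t(u):=x_t$ defines a maximal local semiflow $\varphi:\mathcal{D}^\varphi\to O$ on an open set $\mathcal{D}^\varphi\subset[0,\infty)\times O$, and $\mathcal{D}^\varphi_t=\{u\in O\mid(t,u)\in\mathcal{D}^\varphi\}$. $\varphi$ is jointly continuous. $C^k$ is meant in the Fréchet sense. *)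

theory Defs
  imports "HOL-Analysis.Analysis"
begin

section \<open>Maps of class C^k on open subsets of a linear subspace\<close>

text \<open>
  Iterated Frechet derivatives live in the spaces L(X, L(X, ..., Y)), whose types grow with the
  order.  They are represented in uncurried form: a \<open>j\<close>-linear map on a subspace \<open>X\<close> is a function on
  lists of length \<open>j\<close> with entries in \<open>X\<close>.  The condition \<open>multilinear_bound X j M c\<close> says that
  the operator norm of \<open>M\<close> is at most \<open>c\<close>.
\<close>

definition multilinear_bound ::
    "'a::real_normed_vector set \<Rightarrow> nat \<Rightarrow> ('a list \<Rightarrow> 'b::real_normed_vector) \<Rightarrow> real \<Rightarrow> bool" where
  "multilinear_bound X j M c \<longleftrightarrow>
     (\<forall>vs. length vs = j \<and> set vs \<subseteq> X \<longrightarrow> norm (M vs) \<le> c * (\<Prod>v\<leftarrow>vs. norm v))"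

definition bounded_multilinear_on ::
    "'a::real_normed_vector set \<Rightarrow> nat \<Rightarrow> ('a list \<Rightarrow> 'b::real_normed_vector) \<Rightarrow> bool" where
  "bounded_multilinear_on X j M \<longleftrightarrow>
     (\<forall>vs ws. Suc (length vs + length ws) = j \<and> set vs \<subseteq> X \<and> set ws \<subseteq> X \<longrightarrow>
        (\<forall>a\<in>X. \<forall>b\<in>X. M (vs @ (a + b) # ws) = M (vs @ a # ws) + M (vs @ b # ws)) \<and>
        (\<forall>a\<in>X. \<forall>c. M (vs @ (c *\<^sub>R a) # ws) = c *\<^sub>R M (vs @ a # ws))) \<and>
     (\<exists>c. multilinear_bound X j M c)"

text \<open>
  \<open>D u\<close> restricted to lists of length \<open>j\<close> is the \<open>j\<close>-th derivative of \<open>g\<close> at \<open>u\<close>: its Frechet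
  derivative, with respect to the operator norm, in the direction \<open>v\<close> is \<open>\<lambda>vs. D u (v # vs)\<close>.
  Openness of \<open>U\<close> in \<open>X\<close> is part of the notion (and makes the derivatives on \<open>X\<close> unique).
\<close>

definition Ck_on ::
    "'a::real_normed_vector set \<Rightarrow> nat \<Rightarrow> 'a set \<Rightarrow> ('a \<Rightarrow> 'b::real_normed_vector) \<Rightarrow> bool" where
  "Ck_on X k U g \<longleftrightarrow>
     openin (top_of_set X) U \<and>
     (\<exists>D :: 'a \<Rightarrow> 'a list \<Rightarrow> 'b.
        (\<forall>u\<in>U. D u [] = g u) \<and>
        (\<forall>u\<in>U. \<forall>j\<le>k. bounded_multilinear_on X j (D u)) \<and>
        (\<forall>u\<in>U. \<forall>j<k. \<forall>e>0. \<forall>\<^sub>F w in at u within U.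
           multilinear_bound X j (\<lambda>vs. D w vs - D u vs - D u ((w - u) # vs)) (e * norm (w - u))) \<and>
        (\<forall>u\<in>U. \<forall>e>0. \<forall>\<^sub>F w in at u within U.
           multilinear_bound X k (\<lambda>vs. D w vs - D u vs) e))"

text \<open>
  On a full space, this agrees with the usual recursive definition through
  \<open>has_derivative\<close> and the space of bounded linear maps.
\<close>

lemma Ck_on_UNIV_0:
  fixes g :: "'a::real_normed_vector \<Rightarrow> 'b::real_normed_vector"
  shows "Ck_on UNIV 0 U g \<longleftrightarrow> open U \<and> continuous_on U g"
proof
  assume "Ck_on UNIV 0 U g"
  then obtain D :: "'a \<Rightarrow> 'a list \<Rightarrow> 'b" where o: "open U" and D0: "\<forall>u\<in>U. D u [] = g u"
    and c: "\<forall>u\<in>U. \<forall>e>0. \<forall>\<^sub>F w in at u within U. multilinear_bound UNIV 0 (\<lambda>vs. D w vs - D u vs) e"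
    unfolding Ck_on_def by auto
  have "(g \<longlongrightarrow> g u) (at u within U)" if u: "u \<in> U" for u
  proof (rule tendstoI)
    fix e :: real assume "e > 0"
    then have "\<forall>\<^sub>F w in at u within U. multilinear_bound UNIV 0 (\<lambda>vs. D w vs - D u vs) (e/2)"
      using c u by (meson half_gt_zero)
    moreover have "\<forall>\<^sub>F w in at u within U. w \<in> U"
      by (simp add: eventually_at_filter)
    ultimately show "\<forall>\<^sub>F w in at u within U. dist (g w) (g u) < e"
    proof eventually_elim
      case (elim w)
      then have "norm (D w [] - D u []) \<le> e/2"
        by (force simp: multilinear_bound_def)
      then show ?case using elim u D0 \<open>e > 0\<close> by (simp add: dist_norm)
    qed
  qed
  with o show "open U \<and> continuous_on U g" by (simp add: continuous_on_def)
next
  assume A: "open U \<and> continuous_on U g"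
  define D where "D = (\<lambda>u (vs::'a list). g u)"
  have "\<forall>\<^sub>F w in at u within U. multilinear_bound UNIV 0 (\<lambda>vs. D w vs - D u vs) e"
    if u: "u \<in> U" and e: "e > 0" for u e
  proof -
    have "\<forall>\<^sub>F w in at u within U. dist (g w) (g u) < e"
      using A u e by (auto simp: continuous_on_def tendsto_iff)
    then show ?thesis
      by eventually_elim (simp add: multilinear_bound_def D_def dist_norm)
  qed
  moreover have "bounded_multilinear_on UNIV 0 (D u)" for u
    by (auto simp: bounded_multilinear_on_def multilinear_bound_def D_def)
  ultimately show "Ck_on UNIV 0 U g"
    using A unfolding Ck_on_def by (intro conjI exI[of _ D]) (auto simp: D_def)
qed

lemma multilinear_bound_uncurry:
  fixes M :: "'a::real_normed_vector list \<Rightarrow> 'a \<Rightarrow>\<^sub>L 'b::real_normed_vector"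
  assumes N: "\<And>vs v. length vs = j \<Longrightarrow> N (vs @ [v]) = blinfun_apply (M vs) v" and "c \<ge> 0"
  shows "multilinear_bound UNIV (Suc j) N c \<longleftrightarrow> multilinear_bound UNIV j M c"
proof
  assume L: "multilinear_bound UNIV j M c"
  show "multilinear_bound UNIV (Suc j) N c"
    unfolding multilinear_bound_def
  proof (intro allI impI)
    fix vs :: "'a list" assume "length vs = Suc j \<and> set vs \<subseteq> UNIV"
    then obtain ws v where vs: "vs = ws @ [v]" "length ws = j"
      by (metis length_Suc_conv_rev)
    have "norm (M ws v) \<le> norm (M ws) * norm v" by (rule norm_blinfun)
    also have "\<dots> \<le> (c * (\<Prod>v\<leftarrow>ws. norm v)) * norm v"
      using L vs by (intro mult_right_mono) (auto simp: multilinear_bound_def)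
    finally show "norm (N vs) \<le> c * (\<Prod>v\<leftarrow>vs. norm v)"
      using vs N by (simp add: mult.assoc)
  qed
next
  assume R: "multilinear_bound UNIV (Suc j) N c"
  show "multilinear_bound UNIV j M c"
    unfolding multilinear_bound_def
  proof (intro allI impI)
    fix ws :: "'a list" assume ws: "length ws = j \<and> set ws \<subseteq> UNIV"
    have "0 \<le> (\<Prod>v\<leftarrow>ws. norm v)" by (induction ws) auto
    moreover have "norm (M ws v) \<le> c * (\<Prod>v\<leftarrow>ws. norm v) * norm v" for v
      using R[unfolded multilinear_bound_def, rule_format, of "ws @ [v]"] ws N
      by (simp add: mult.assoc)
    ultimately show "norm (M ws) \<le> c * (\<Prod>v\<leftarrow>ws. norm v)"
      using assms by (intro norm_blinfun_bound) auto
  qed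
qed

lemma bounded_multilinear_on_curry:
  fixes M :: "'a::real_normed_vector list \<Rightarrow> 'a \<Rightarrow>\<^sub>L 'b::real_normed_vector"
  assumes N: "\<And>vs v. length vs = j \<Longrightarrow> N (vs @ [v]) = blinfun_apply (M vs) v"
    and b: "bounded_multilinear_on UNIV (Suc j) N"
  shows "bounded_multilinear_on UNIV j M"
proof -
  have lin: "M (vs @ (a + b) # ws) = M (vs @ a # ws) + M (vs @ b # ws) \<and>
        M (vs @ (c *\<^sub>R a) # ws) = c *\<^sub>R M (vs @ a # ws)"
    if "Suc (length vs + length ws) = j" for vs ws a b c
  proof -
    note q = b[unfolded bounded_multilinear_on_def, THEN conjunct1, rule_format,
        of vs "ws @ [_]", simplified]
    have "N (vs @ x # (ws @ [v])) = M (vs @ x # ws) v" for v x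
      using N[of "vs @ x # ws" v] that by simp
    moreover have "Suc (length vs + length (ws @ [v])) = Suc j" for v :: 'a
      using that by simp
    ultimately show ?thesis
      using q that by (auto intro!: blinfun_eqI simp: blinfun.bilinear_simps)
  qed
  obtain c where c: "multilinear_bound UNIV (Suc j) N c"
    using b by (auto simp: bounded_multilinear_on_def)
  have "multilinear_bound UNIV (Suc j) N \<bar>c\<bar>"
    unfolding multilinear_bound_def
  proof (intro allI impI)
    fix vs :: "'a list" assume vs: "length vs = Suc j \<and> set vs \<subseteq> UNIV"
    have "0 \<le> (\<Prod>v\<leftarrow>vs. norm v)" by (induction vs) auto
    then have "c * (\<Prod>v\<leftarrow>vs. norm v) \<le> \<bar>c\<bar> * (\<Prod>v\<leftarrow>vs. norm v)" by (intro mult_right_mono) auto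
    then show "norm (N vs) \<le> \<bar>c\<bar> * (\<Prod>v\<leftarrow>vs. norm v)"
      using c vs by (force simp: multilinear_bound_def)
  qed
  then have "multilinear_bound UNIV j M \<bar>c\<bar>"
    using multilinear_bound_uncurry[of j N M "\<bar>c\<bar>"] N by simp
  with lin show ?thesis by (auto simp: bounded_multilinear_on_def)
qed

lemma bounded_multilinear_on_uncurry:
  fixes M :: "'a::real_normed_vector list \<Rightarrow> 'a \<Rightarrow>\<^sub>L 'b::real_normed_vector"
  assumes N: "\<And>vs v. length vs = j \<Longrightarrow> N (vs @ [v]) = blinfun_apply (M vs) v"
    and b: "bounded_multilinear_on UNIV j M"
  shows "bounded_multilinear_on UNIV (Suc j) N"
proof -
  have lin: "N (vs @ (a + b) # ws) = N (vs @ a # ws) + N (vs @ b # ws) \<and>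
        N (vs @ (c *\<^sub>R a) # ws) = c *\<^sub>R N (vs @ a # ws)"
    if len: "Suc (length vs + length ws) = Suc j" for vs ws a b c
  proof (cases ws rule: rev_cases)
    case Nil
    then show ?thesis using N[of vs] len by (simp add: blinfun.bilinear_simps)
  next
    case (snoc ws' v)
    have "N (vs @ x # ws) = M (vs @ x # ws') v" for x
      using N[of "vs @ x # ws'" v] len snoc by simp
    moreover have "Suc (length vs + length ws') = j" using len snoc by simp
    ultimately show ?thesis
      using b by (simp add: bounded_multilinear_on_def blinfun.bilinear_simps)
  qed
  obtain c where c: "multilinear_bound UNIV j M c"
    using b by (auto simp: bounded_multilinear_on_def)
  have "multilinear_bound UNIV j M \<bar>c\<bar>"
    unfolding multilinear_bound_def
  proof (intro allI impI)
    fix vs :: "'a list" assume vs: "length vs = j \<and> set vs \<subseteq> UNIV"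
    have "0 \<le> (\<Prod>v\<leftarrow>vs. norm v)" by (induction vs) auto
    then have "c * (\<Prod>v\<leftarrow>vs. norm v) \<le> \<bar>c\<bar> * (\<Prod>v\<leftarrow>vs. norm v)" by (intro mult_right_mono) auto
    then show "norm (M vs) \<le> \<bar>c\<bar> * (\<Prod>v\<leftarrow>vs. norm v)"
      using c vs by (force simp: multilinear_bound_def)
  qed
  then have "multilinear_bound UNIV (Suc j) N \<bar>c\<bar>"
    using multilinear_bound_uncurry[of j N M "\<bar>c\<bar>"] N by simp
  with lin show ?thesis unfolding bounded_multilinear_on_def by blast
qed

lemma Ck_on_UNIV_Suc:
  fixes g :: "'a::real_normed_vector \<Rightarrow> 'b::real_normed_vector"
  shows "Ck_on UNIV (Suc k) U g \<longleftrightarrow> open U \<and>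
    (\<exists>g' :: 'a \<Rightarrow> ('a \<Rightarrow>\<^sub>L 'b). (\<forall>u\<in>U. (g has_derivative blinfun_apply (g' u)) (at u)) \<and> Ck_on UNIV k U g')"
proof
  assume "Ck_on UNIV (Suc k) U g"
  then obtain D :: "'a \<Rightarrow> 'a list \<Rightarrow> 'b" where op: "openin (top_of_set UNIV) U"
    and D_all:
        "\<forall>u\<in>U. D u [] = g u"
        "\<forall>u\<in>U. \<forall>j\<le>Suc k. bounded_multilinear_on UNIV j (D u)"
        "\<forall>u\<in>U. \<forall>j<Suc k. \<forall>e>0. \<forall>\<^sub>F w in at u within U.
           multilinear_bound UNIV j (\<lambda>vs. D w vs - D u vs - D u ((w - u) # vs)) (e * norm (w - u))"
        "\<forall>u\<in>U. \<forall>e>0. \<forall>\<^sub>F w in at u within U.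
           multilinear_bound UNIV (Suc k) (\<lambda>vs. D w vs - D u vs) e"
    unfolding Ck_on_def by (elim conjE exE) (rule that)
  note D0 = D_all(1)[rule_format] and ml = D_all(2)[rule_format]
    and der = D_all(3)[rule_format] and cont = D_all(4)[rule_format]
  from op have o: "open U" by simp
  define E where "E u vs = Blinfun (\<lambda>v. D u (vs @ [v]))" for u vs
  have E: "D u (vs @ [v]) = blinfun_apply (E u vs) v" if u: "u \<in> U" and len: "length vs \<le> k" for u vs v
  proof -
    have b: "bounded_multilinear_on UNIV (Suc (length vs)) (D u)" using ml u len by simp
    then obtain c where c: "multilinear_bound UNIV (Suc (length vs)) (D u) c"
      by (auto simp: bounded_multilinear_on_def)
    have "bounded_linear (\<lambda>v. D u (vs @ [v]))"
    proof
      show "D u (vs @ [a + b]) = D u (vs @ [a]) + D u (vs @ [b])" for a b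
        using b by (simp add: bounded_multilinear_on_def)
      show "D u (vs @ [c *\<^sub>R a]) = c *\<^sub>R D u (vs @ [a])" for a c
        using b by (simp add: bounded_multilinear_on_def)
      have "norm (D u (vs @ [v])) \<le> norm v * (c * (\<Prod>v\<leftarrow>vs. norm v))" for v
        using c[unfolded multilinear_bound_def, rule_format, of "vs @ [v]"] by (simp add: mult_ac)
      then show "\<exists>K. \<forall>v. norm (D u (vs @ [v])) \<le> norm v * K" by blast
    qed
    then show ?thesis by (simp add: E_def bounded_linear_Blinfun_apply)
  qed
  have inU: "\<forall>\<^sub>F w in at u within U. w \<in> U" for u by (simp add: eventually_at_filter)
  have "(g has_derivative blinfun_apply (E u [])) (at u)" if u: "u \<in> U" for u
  proof -
    have "\<forall>\<^sub>F w in at u within U. norm (g w - g u - E u [] (w - u)) \<le> e * norm (w - u)"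
      if e: "e > 0" for e
      using der[OF u zero_less_Suc e] inU
    proof eventually_elim
      case (elim w)
      have "norm (D w [] - D u [] - D u [w - u]) \<le> e * norm (w - u)"
        using elim(1)[unfolded multilinear_bound_def, rule_format, of "[]"] by simp
      then show ?case using D0[OF u] D0[OF elim(2)] E[OF u, of "[]" "w - u"] by simp
    qed
    then have "(g has_derivative blinfun_apply (E u [])) (at u within U)"
      by (simp add: has_derivative_within_alt2 blinfun.bounded_linear_right)
    then show ?thesis using o u by (simp add: at_within_open[of u U])
  qed
  moreover have "Ck_on UNIV k U (\<lambda>u. E u [])"
    unfolding Ck_on_def
  proof (intro conjI exI[of _ E] ballI allI impI)
    show "openin (top_of_set UNIV) U" using o by simp
    show "bounded_multilinear_on UNIV j (E u)" if "u \<in> U" "j \<le> k" for u j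
    proof (rule bounded_multilinear_on_curry)
      show "D u (vs @ [v]) = blinfun_apply (E u vs) v" if "length vs = j" for vs v
        using E \<open>u \<in> U\<close> \<open>j \<le> k\<close> that by simp
      show "bounded_multilinear_on UNIV (Suc j) (D u)"
        using ml \<open>u \<in> U\<close> \<open>j \<le> k\<close> by simp
    qed
    show "\<forall>\<^sub>F w in at u within U.
         multilinear_bound UNIV j (\<lambda>vs. E w vs - E u vs - E u ((w - u) # vs)) (e * norm (w - u))"
      if u: "u \<in> U" and j: "j < k" and e: "e > 0" for u j e
      using der[OF u Suc_mono[OF j] e] inU
    proof eventually_elim
      case (elim w)
      have "(D w (vs @ [v]) - D u (vs @ [v]) - D u ((w - u) # (vs @ [v]))) =
        blinfun_apply (E w vs - E u vs - E u ((w - u) # vs)) v" if "length vs = j" for vs v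
        using that j u elim E[of w vs v] E[of u vs v] E[of u "(w - u) # vs" v]
        by (simp add: blinfun.bilinear_simps)
      from multilinear_bound_uncurry[of j "\<lambda>vs. D w vs - D u vs - D u ((w - u) # vs)", OF this]
      show ?case using elim e by auto
    qed
    show "\<forall>\<^sub>F w in at u within U. multilinear_bound UNIV k (\<lambda>vs. E w vs - E u vs) e"
      if u: "u \<in> U" and e: "e > 0" for u e
      using cont[OF u e] inU
    proof eventually_elim
      case (elim w)
      have "(D w (vs @ [v]) - D u (vs @ [v])) =
        blinfun_apply (E w vs - E u vs) v" if "length vs = k" for vs v
        using that u elim E by (simp add: blinfun.bilinear_simps)
      from multilinear_bound_uncurry[of k "\<lambda>vs. D w vs - D u vs", OF this]
      show ?case using elim e by auto
    qed
  qed auto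
  ultimately show "open U \<and>
    (\<exists>g' :: 'a \<Rightarrow> ('a \<Rightarrow>\<^sub>L 'b). (\<forall>u\<in>U. (g has_derivative blinfun_apply (g' u)) (at u)) \<and> Ck_on UNIV k U g')"
    using o by (intro conjI exI[of _ "\<lambda>u. E u []"]) auto
next
  assume "open U \<and>
    (\<exists>g' :: 'a \<Rightarrow> ('a \<Rightarrow>\<^sub>L 'b). (\<forall>u\<in>U. (g has_derivative blinfun_apply (g' u)) (at u)) \<and> Ck_on UNIV k U g')"
  then obtain g' :: "'a \<Rightarrow> ('a \<Rightarrow>\<^sub>L 'b)" where o: "open U"
    and g': "\<And>u. u \<in> U \<Longrightarrow> (g has_derivative blinfun_apply (g' u)) (at u)" and ck: "Ck_on UNIV k U g'"
    by blast
  from ck obtain E :: "'a \<Rightarrow> 'a list \<Rightarrow> ('a \<Rightarrow>\<^sub>L 'b)" where op: "openin (top_of_set UNIV) U"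
    and E_all:
        "\<forall>u\<in>U. E u [] = g' u"
        "\<forall>u\<in>U. \<forall>j\<le>k. bounded_multilinear_on UNIV j (E u)"
        "\<forall>u\<in>U. \<forall>j<k. \<forall>e>0. \<forall>\<^sub>F w in at u within U.
           multilinear_bound UNIV j (\<lambda>vs. E w vs - E u vs - E u ((w - u) # vs)) (e * norm (w - u))"
        "\<forall>u\<in>U. \<forall>e>0. \<forall>\<^sub>F w in at u within U.
           multilinear_bound UNIV k (\<lambda>vs. E w vs - E u vs) e"
    unfolding Ck_on_def by (elim conjE exE) (rule that)
  note E0 = E_all(1)[rule_format] and ml = E_all(2)[rule_format]
    and der = E_all(3)[rule_format] and cont = E_all(4)[rule_format]
  define D where
    "D u vs = (if vs = [] then g u else blinfun_apply (E u (butlast vs)) (last vs))" for u vs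
  have D: "D u (vs @ [v]) = blinfun_apply (E u vs) v" for u vs v by (simp add: D_def)
  show "Ck_on UNIV (Suc k) U g"
    unfolding Ck_on_def
  proof (intro conjI exI[of _ D] ballI allI impI)
    show "openin (top_of_set UNIV) U" using o by simp
    show "D u [] = g u" for u by (simp add: D_def)
    show "bounded_multilinear_on UNIV j (D u)" if "u \<in> U" "j \<le> Suc k" for u j
    proof (cases j)
      case 0
      then show ?thesis by (auto simp: bounded_multilinear_on_def multilinear_bound_def)
    next
      case (Suc i)
      then have "bounded_multilinear_on UNIV i (E u)" using ml that by simp
      from bounded_multilinear_on_uncurry[OF D this] show ?thesis by (simp add: Suc)
    qed
    show "\<forall>\<^sub>F w in at u within U.
         multilinear_bound UNIV j (\<lambda>vs. D w vs - D u vs - D u ((w - u) # vs)) (e * norm (w - u))"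
      if u: "u \<in> U" and j: "j < Suc k" and e: "e > 0" for u j e
    proof (cases j)
      case 0
      have "(g has_derivative blinfun_apply (g' u)) (at u within U)"
        using g'[OF u] by (rule has_derivative_at_withinI)
      then have "\<forall>\<^sub>F w in at u within U. norm (g w - g u - g' u (w - u)) \<le> e * norm (w - u)"
        using e by (simp add: has_derivative_within_alt2)
      then show ?thesis
        by eventually_elim (simp add: 0 multilinear_bound_def D_def E0[OF u])
    next
      case (Suc i)
      then have "i < k" using j by simp
      from der[OF u this e] show ?thesis
      proof eventually_elim
        case (elim w)
        have "D w (vs @ [v]) - D u (vs @ [v]) - D u ((w - u) # (vs @ [v])) =
          blinfun_apply (E w vs - E u vs - E u ((w - u) # vs)) v" for vs v
          using D[of u "(w - u) # vs" v] by (simp add: D blinfun.bilinear_simps)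
        from multilinear_bound_uncurry[of i "\<lambda>vs. D w vs - D u vs - D u ((w - u) # vs)", OF this]
        show ?case using elim e Suc by auto
      qed
    qed
    show "\<forall>\<^sub>F w in at u within U. multilinear_bound UNIV (Suc k) (\<lambda>vs. D w vs - D u vs) e"
      if u: "u \<in> U" and e: "e > 0" for u e
      using cont[OF u e]
    proof eventually_elim
      case (elim w)
      have "D w (vs @ [v]) - D u (vs @ [v]) = blinfun_apply (E w vs - E u vs) v" for vs v
        by (simp add: D blinfun.bilinear_simps)
      from multilinear_bound_uncurry[of k "\<lambda>vs. D w vs - D u vs", OF this]
      show ?case using elim e by auto
    qed
  qed
qed

section \<open>The space C([-h,0], R^n)\<close>

text \<open>
  A continuous function on \<open>{-h..0}\<close> is represented by its unique extension to the real line that is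
  constant on either side of the interval; the norm of the ambient type of bounded continuous
  functions then is the supremum norm over \<open>{-h..0}\<close>.
\<close>

definition delay_space :: "real \<Rightarrow> (real \<Rightarrow>\<^sub>C 'b::metric_space) set" where
  "delay_space h = {u. ext_cont (apply_bcontfun u) (- h) 0 = apply_bcontfun u}"

lemma delay_space_iff: "u \<in> delay_space h \<longleftrightarrow> (\<forall>s. apply_bcontfun u (clamp (- h) 0 s) = apply_bcontfun u s)"
  by (simp add: delay_space_def ext_cont_def fun_eq_iff)

lemma delay_space_represents:
  assumes "h \<ge> 0" "continuous_on {-h..0} g"
  shows "\<exists>!u \<in> delay_space h. \<forall>s\<in>{-h..0}. apply_bcontfun u s = g s"
proof -
  have "continuous_on (cbox (-h) 0) g" using assms by simp
  then obtain u :: "real \<Rightarrow>\<^sub>C 'a" where u: "\<And>s. s \<in> cbox (-h) 0 \<Longrightarrow> u s = g s"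
    and c: "\<And>s. u s = g (clamp (-h) 0 s)"
    using continuous_on_cbox_bcontfunE by blast
  have cl: "clamp (-h) 0 s \<in> {-h..0}" for s
    using clamp_in_interval[of "-h" 0 s] assms by simp
  have "u \<in> delay_space h"
    unfolding delay_space_iff
  proof
    fix s
    have "u (clamp (-h) 0 s) = g (clamp (-h) 0 s)" using cl by (intro u) simp
    also have "\<dots> = u s" by (rule c[symmetric])
    finally show "u (clamp (-h) 0 s) = u s" .
  qed
  moreover have "v = u" if "v \<in> delay_space h" "\<forall>s\<in>{-h..0}. apply_bcontfun v s = g s" for v
  proof (rule bcontfun_eqI)
    fix s
    have "v s = v (clamp (-h) 0 s)"
      using that(1) by (simp add: delay_space_iff)
    also have "\<dots> = g (clamp (-h) 0 s)" using that(2) cl by blast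
    also have "\<dots> = u s" by (rule c[symmetric])
    finally show "v s = u s" .
  qed
  moreover have "\<forall>s\<in>{-h..0}. apply_bcontfun u s = g s" using u by simp
  ultimately show ?thesis by blast
qed

lemma norm_delay_space:
  assumes "h \<ge> 0" "u \<in> delay_space h"
  shows "norm u = (SUP s\<in>{-h..0}. norm (apply_bcontfun u s))"
proof (rule antisym)
  have cl: "clamp (-h) 0 s \<in> {-h..0}" for s
    using clamp_in_interval[of "-h" 0 s] assms by simp
  have bdd: "bdd_above ((\<lambda>s. norm (apply_bcontfun u s)) ` {-h..0})"
    by (rule bdd_aboveI2[of _ _ "norm u"]) (rule norm_bounded)
  show "norm u \<le> (SUP s\<in>{-h..0}. norm (apply_bcontfun u s))"
  proof (rule norm_bound)
    fix s
    have "u s = u (clamp (-h) 0 s)"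
      using assms(2) by (simp add: delay_space_iff)
    then show "norm (u s) \<le> (SUP s\<in>{-h..0}. norm (apply_bcontfun u s))"
      using cSUP_upper[OF cl bdd, of s] by metis
  qed
  show "(SUP s\<in>{-h..0}. norm (apply_bcontfun u s)) \<le> norm u"
    using assms(1) by (intro cSUP_least norm_bounded) auto
qed

section \<open>The delay equation and its semiflow\<close>

text \<open>
  The element \<open>x\<^sub>t\<close> of \<open>delay_space h\<close> given by \<open>x\<^sub>t(s) = x(t + s)\<close> for \<open>-h \<le> s \<le> 0\<close>;
  \<open>x\<close> is meant to be continuous on \<open>{t - h..t}\<close>.
\<close>

definition segment :: "real \<Rightarrow> (real \<Rightarrow> 'b::metric_space) \<Rightarrow> real \<Rightarrow> (real \<Rightarrow>\<^sub>C 'b)" where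
  "segment h x t = Bcontfun (ext_cont (\<lambda>s. x (t + s)) (- h) 0)"

lemma segment_apply:
  assumes "h \<ge> 0" "continuous_on {t - h..t} x"
  shows "segment h x t \<in> delay_space h"
    and "s \<in> {-h..0} \<Longrightarrow> apply_bcontfun (segment h x t) s = x (t + s)"
proof -
  have "continuous_on (cbox (-h) 0) (\<lambda>s. x (t + s))"
    by (rule continuous_on_compose2[OF assms(2)]) (auto intro!: continuous_intros)
  then obtain u :: "real \<Rightarrow>\<^sub>C 'a" where u: "\<And>s. s \<in> cbox (-h) 0 \<Longrightarrow> u s = x (t + s)"
    and c: "\<And>s. u s = x (t + clamp (-h) 0 s)"
    by (rule continuous_on_cbox_bcontfunE) blast
  have "ext_cont (\<lambda>s. x (t + s)) (- h) 0 = apply_bcontfun u"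
    by (rule ext) (simp only: ext_cont_def c)
  then have s: "segment h x t = u" by (simp add: segment_def apply_bcontfun_inverse)
  have cl: "clamp (-h) 0 s \<in> cbox (-h) 0" for s
    using clamp_in_interval[of "-h" 0 s] assms by simp
  show "segment h x t \<in> delay_space h"
    unfolding s delay_space_iff
  proof
    fix r
    have "u (clamp (-h) 0 r) = x (t + clamp (-h) 0 r)" by (rule u[OF cl])
    also have "\<dots> = u r" by (rule c[symmetric])
    finally show "u (clamp (-h) 0 r) = u r" .
  qed
  show "s \<in> {-h..0} \<Longrightarrow> apply_bcontfun (segment h x t) s = x (t + s)"
    using u[of s] s by simp
qed

text \<open>
  \<open>x\<close> solves the delay equation with initial value \<open>u\<close> on \<open>[-h, T)\<close>, where \<open>0 < T \<le> \<infinity>\<close>.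
  Values of \<open>x\<close> outside \<open>[-h, T)\<close> are irrelevant.
\<close>

definition delay_solution ::
    "real \<Rightarrow> (real \<Rightarrow>\<^sub>C 'b::real_normed_vector) set \<Rightarrow> ((real \<Rightarrow>\<^sub>C 'b) \<Rightarrow> 'b) \<Rightarrow>
     (real \<Rightarrow>\<^sub>C 'b) \<Rightarrow> ereal \<Rightarrow> (real \<Rightarrow> 'b) \<Rightarrow> bool" where
  "delay_solution h U f u T x \<longleftrightarrow>
     0 < T \<and>
     continuous_on {t. - h \<le> t \<and> ereal t < T} x \<and>
     segment h x 0 = u \<and>
     (\<forall>t. 0 \<le> t \<and> ereal t < T \<longrightarrow> segment h x t \<in> U) \<and>
     (x has_vector_derivative f u) (at_right 0) \<and>
     (\<forall>t. 0 < t \<and> ereal t < T \<longrightarrow> (x has_vector_derivative f (segment h x t)) (at t)) \<and>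
     continuous_on {t. 0 < t \<and> ereal t < T} (\<lambda>t. vector_derivative x (at t))"

definition maximal_delay_solution ::
    "real \<Rightarrow> (real \<Rightarrow>\<^sub>C 'b::real_normed_vector) set \<Rightarrow> ((real \<Rightarrow>\<^sub>C 'b) \<Rightarrow> 'b) \<Rightarrow>
     (real \<Rightarrow>\<^sub>C 'b) \<Rightarrow> ereal \<Rightarrow> (real \<Rightarrow> 'b) \<Rightarrow> bool" where
  "maximal_delay_solution h U f u T x \<longleftrightarrow>
     delay_solution h U f u T x \<and>
     (\<forall>S y. delay_solution h U f u S y \<longrightarrow>
        S \<le> T \<and> (\<forall>t. - h \<le> t \<and> ereal t < S \<longrightarrow> y t = x t))"

definition semiflow_domain ::
    "real \<Rightarrow> (real \<Rightarrow>\<^sub>C 'b::real_normed_vector) set \<Rightarrow> ((real \<Rightarrow>\<^sub>C 'b) \<Rightarrow> 'b) \<Rightarrow>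
     (real \<times> (real \<Rightarrow>\<^sub>C 'b)) set" where
  "semiflow_domain h U f =
     {(t, u). 0 \<le> t \<and> u \<in> U \<and> (\<exists>T x. maximal_delay_solution h U f u T x \<and> ereal t < T)}"

definition semiflow ::
    "real \<Rightarrow> (real \<Rightarrow>\<^sub>C 'b::real_normed_vector) set \<Rightarrow> ((real \<Rightarrow>\<^sub>C 'b) \<Rightarrow> 'b) \<Rightarrow>
     real \<Rightarrow> (real \<Rightarrow>\<^sub>C 'b) \<Rightarrow> (real \<Rightarrow>\<^sub>C 'b)" where
  "semiflow h U f t u =
     (THE w. \<exists>T x. maximal_delay_solution h U f u T x \<and> ereal t < T \<and> w = segment h x t)"

text \<open>The definite description is well posed, by uniqueness of the maximal solution.\<close>

lemma semiflow_eq_segment: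
  assumes h: "h \<ge> 0" and t: "0 \<le> t" "ereal t < T" and x: "maximal_delay_solution h U f u T x"
  shows "semiflow h U f t u = segment h x t"
  unfolding semiflow_def
proof (rule the_equality)
  show "\<exists>T x'. maximal_delay_solution h U f u T x' \<and> ereal t < T \<and> segment h x t = segment h x' t"
    using x t by blast
  fix w assume "\<exists>T x. maximal_delay_solution h U f u T x \<and> ereal t < T \<and> w = segment h x t"
  then obtain S y where y: "maximal_delay_solution h U f u S y" "ereal t < S" "w = segment h y t"
    by blast
  have eq: "y s = x s" if "- h \<le> s" "s \<le> t" for s
    using x y that unfolding maximal_delay_solution_def
    by (meson ereal_less_eq(3) le_less_trans)
  have "y (t + clamp (-h) 0 s) = x (t + clamp (-h) 0 s)" for s
    using clamp_in_interval[of "-h" 0 s] h t by (intro eq) auto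
  then have "ext_cont (\<lambda>s. y (t + s)) (- h) 0 = ext_cont (\<lambda>s. x (t + s)) (- h) 0"
    by (simp add: ext_cont_def)
  then show "w = segment h x t" by (simp add: y segment_def)
qed

end

theory Submission
  imports Defs
begin

text \<open>
  On a fixed interval \<open>[-h, a]\<close>, a function \<open>x\<close> solves the delay equation with initial value \<open>u\<close> iff
  \<open>G x = u\<close>, where \<open>G x (t) = x t - \<integral>\<^sub>0\<^sup>t f(x\<^sub>s) ds\<close> and \<open>u\<close> is extended by the constant \<open>u 0\<close>.  The map
  \<open>G\<close> inherits the smoothness of \<open>f\<close>, and its derivative is the identity minus a Volterra operator,
  hence invertible.  A Gronwall type argument shows that \<open>G\<close> is injective.  By the inverse function
  theorem, the image of \<open>G\<close> is open and the inverse of \<open>G\<close> is \<open>C\<^sup>k\<close>; for \<open>a > t\<close>, the time-\<open>t\<close> map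
  is this inverse followed by the bounded linear map \<open>x \<mapsto> x\<^sub>t\<close>.  So no step by step continuation in
  time is needed, and the openness of the domain comes for free.

  The space \<open>delay_space h\<close> is the range of the bounded linear projection \<open>u \<mapsto> bsegment h u 0\<close>.
  Composing with it turns all maps into maps between full Banach spaces.
\<close>

section \<open>Multilinear maps on lists\<close>

text \<open>The analytic obstacle is the differentiability of x \<mapsto> (s \<mapsto> f(x_s)) in
  the supremum norm. The derivatives of f are continuous only at each point of an open set in
  infinite dimensions, so uniformity in s has to come from the compactness of the set of segments
  x_s, 0 \<le> s \<le> a, of one fixed x. The Volterra operator need not have norm below 1 when a is
  large; an exponential weight makes its powers decay geometrically, and the same estimate serves
  the injectivity of G. The usual proof that an inverse is C^k is an induction on k through spaces
  of linear maps, whose types change with k. With derivatives as functions on lists, it is replaced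
  by an explicit formula for all derivatives of the inverse, a sum over trees, whose continuity and
  derivative are found by structural induction. The interval end a must lie between t and the
  existence time of the solution, so it depends on u. The resulting local statements are glued by
  the uniqueness of derivatives.\<close>

definition multilin :: "nat \<Rightarrow> ('a::real_vector list \<Rightarrow> 'b::real_vector) \<Rightarrow> bool" where
  "multilin j M \<longleftrightarrow> (\<forall>vs ws. Suc (length vs + length ws) = j \<longrightarrow>
     (\<forall>a b. M (vs @ (a + b) # ws) = M (vs @ a # ws) + M (vs @ b # ws)) \<and>
     (\<forall>a c. M (vs @ (c *\<^sub>R a) # ws) = c *\<^sub>R M (vs @ a # ws)))"

lemma bounded_multilinear_on_UNIV:
  "bounded_multilinear_on UNIV j M \<longleftrightarrow> multilin j M \<and> (\<exists>c. multilinear_bound UNIV j M c)"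
  by (auto simp: bounded_multilinear_on_def multilin_def)

lemma multilin_linear_Cons:
  assumes "multilin (Suc j) M" "length vs = j"
  shows "linear (\<lambda>v. M (v # vs))"
proof
  have *: "Suc (length [] + length vs) = Suc j" using assms by simp
  note q = assms(1)[unfolded multilin_def, rule_format, OF *]
  show "M ((a + b) # vs) = M (a # vs) + M (b # vs)" for a b
    using q by simp
  show "M ((c *\<^sub>R a) # vs) = c *\<^sub>R M (a # vs)" for c a
    using q by simp
qed

lemma multilin_Cons:
  assumes "multilin (Suc j) M"
  shows "multilin j (\<lambda>vs. M (b # vs))"
  unfolding multilin_def
proof (intro allI impI)
  fix vs ws :: "'a list" assume "Suc (length vs + length ws) = j"
  then have "Suc (length (b # vs) + length ws) = Suc j" by simp
  note q = assms[unfolded multilin_def, rule_format, OF this]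
  show "(\<forall>a c. M (b # vs @ (a + c) # ws) = M (b # vs @ a # ws) + M (b # vs @ c # ws)) \<and>
        (\<forall>a c. M (b # vs @ (c *\<^sub>R a) # ws) = c *\<^sub>R M (b # vs @ a # ws))"
    using q by simp
qed

lemma multilin_diff:
  assumes "multilin j M" "multilin j N"
  shows "multilin j (\<lambda>vs. M vs - N vs)"
  using assms unfolding multilin_def by (simp add: algebra_simps)

lemma prod_list_norm_nonneg: "0 \<le> (\<Prod>v\<leftarrow>vs. norm v)"
  by (induction vs) auto

lemma prod_list_norm_le:
  assumes "\<And>v. v \<in> set vs \<Longrightarrow> norm v \<le> R"
  shows "(\<Prod>v\<leftarrow>vs. norm v) \<le> R ^ length vs"
  using assms
proof (induction vs)
  case (Cons v vs)
  have "0 \<le> R" using Cons.prems[of v] norm_ge_zero[of v] by (meson list.set_intros(1) order_trans)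
  then show ?case using Cons by (auto intro!: mult_mono prod_list_norm_nonneg)
qed auto

lemma multilinear_bound_mono:
  assumes "multilinear_bound X j M c" "c \<le> d"
  shows "multilinear_bound X j M d"
  unfolding multilinear_bound_def
proof (intro allI impI)
  fix vs assume "length vs = j \<and> set vs \<subseteq> X"
  then have "norm (M vs) \<le> c * (\<Prod>v\<leftarrow>vs. norm v)"
    using assms(1) unfolding multilinear_bound_def by blast
  also have "\<dots> \<le> d * (\<Prod>v\<leftarrow>vs. norm v)"
    by (intro mult_right_mono assms(2) prod_list_norm_nonneg)
  finally show "norm (M vs) \<le> d * (\<Prod>v\<leftarrow>vs. norm v)" .
qed

lemma multilinear_bound_cong:
  assumes "\<And>vs. length vs = j \<Longrightarrow> M vs = N vs" "multilinear_bound X j M c"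
  shows "multilinear_bound X j N c"
  using assms unfolding multilinear_bound_def by auto

lemma multilinear_bound_add:
  assumes "multilinear_bound X j M c" "multilinear_bound X j N d"
  shows "multilinear_bound X j (\<lambda>vs. M vs + N vs) (c + d)"
  unfolding multilinear_bound_def
proof (intro allI impI)
  fix vs assume "length vs = j \<and> set vs \<subseteq> X"
  then have "norm (M vs) \<le> c * (\<Prod>v\<leftarrow>vs. norm v)" "norm (N vs) \<le> d * (\<Prod>v\<leftarrow>vs. norm v)"
    using assms unfolding multilinear_bound_def by blast+
  then show "norm (M vs + N vs) \<le> (c + d) * (\<Prod>v\<leftarrow>vs. norm v)"
    using norm_triangle_ineq[of "M vs" "N vs"] by (simp add: algebra_simps)
qed

lemma multilinear_bound_minus:
  assumes "multilinear_bound X j M c"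
  shows "multilinear_bound X j (\<lambda>vs. - M vs) c"
  using assms unfolding multilinear_bound_def by simp

lemma multilinear_bound_Cons:
  assumes "multilinear_bound UNIV (Suc j) M c"
  shows "multilinear_bound UNIV j (\<lambda>vs. M (b # vs)) (c * norm b)"
  unfolding multilinear_bound_def
proof (intro allI impI)
  fix vs :: "'a list" assume "length vs = j \<and> set vs \<subseteq> UNIV"
  then have "norm (M (b # vs)) \<le> c * (\<Prod>v\<leftarrow>b # vs. norm v)"
    using assms unfolding multilinear_bound_def by (metis length_Cons subset_UNIV)
  then show "norm (M (b # vs)) \<le> c * norm b * (\<Prod>v\<leftarrow>vs. norm v)" by (simp add: mult.assoc)
qed

lemma multilinear_boundD:
  assumes "multilinear_bound UNIV j M c" "length vs = j"
  shows "norm (M vs) \<le> c * (\<Prod>v\<leftarrow>vs. norm v)"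
  using assms unfolding multilinear_bound_def by blast

text \<open>Operator-norm convergence of multilinear maps is uniform convergence on these lists,
  which makes the calculus of \<open>uniform_limit\<close> available.\<close>

definition unit_lists :: "nat \<Rightarrow> 'a::real_normed_vector list set" where
  "unit_lists j = {vs. length vs = j \<and> (\<forall>v\<in>set vs. norm v \<le> 1)}"

text \<open>Each entry is its norm times its \<open>sgn\<close>, also when it is zero. The prefix
  \<open>ws\<close> collects the entries already normalised, so the induction generalises over it.
  This reduces operator bounds to bounds on \<open>unit_lists\<close>.\<close>

lemma multilin_sgn:
  assumes "multilin (length ws + length vs) M"
  shows "M (ws @ vs) = (\<Prod>v\<leftarrow>vs. norm v) *\<^sub>R M (ws @ map sgn vs)"
  using assms
proof (induction vs arbitrary: ws)
  case (Cons v vs)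
  have v: "v = norm v *\<^sub>R sgn v" by (cases "v = 0") (simp_all add: sgn_div_norm)
  have "M (ws @ v # vs) = norm v *\<^sub>R M (ws @ sgn v # vs)"
    using Cons.prems[unfolded multilin_def, rule_format, of ws vs] v by (metis add_Suc_right length_Cons)
  also have "M (ws @ sgn v # vs) = (\<Prod>v\<leftarrow>vs. norm v) *\<^sub>R M ((ws @ [sgn v]) @ map sgn vs)"
    using Cons.IH[of "ws @ [sgn v]"] Cons.prems by simp
  finally show ?case by simp
qed simp

lemma multilinear_bound_unitI:
  assumes "multilin j M" "\<And>vs. vs \<in> unit_lists j \<Longrightarrow> norm (M vs) \<le> c"
  shows "multilinear_bound UNIV j M c"
  unfolding multilinear_bound_def
proof (intro allI impI)
  fix vs :: "'a list" assume vs: "length vs = j \<and> set vs \<subseteq> UNIV"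
  have "map sgn vs \<in> unit_lists j" using vs by (auto simp: unit_lists_def norm_sgn)
  then have "norm (M (map sgn vs)) \<le> c" by (rule assms)
  then have "(\<Prod>v\<leftarrow>vs. norm v) * norm (M (map sgn vs)) \<le> (\<Prod>v\<leftarrow>vs. norm v) * c"
    by (intro mult_left_mono prod_list_norm_nonneg)
  then show "norm (M vs) \<le> c * (\<Prod>v\<leftarrow>vs. norm v)"
    using multilin_sgn[of "[]" vs M] assms(1) vs prod_list_norm_nonneg[of vs]
    by (simp add: mult.commute)
qed

text \<open>Telescoping: the entries of \<open>as\<close> are exchanged for those of
  \<open>bs\<close> one at a time, and each exchange costs one factor \<open>d\<close> and otherwise
  factors of size at most \<open>R\<close>. Since \<open>R \<ge> 1\<close>, all terms are bounded by
  the same power of \<open>R\<close>.\<close>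

lemma multilin_diff_le:
  assumes "multilin (length as) M" "multilinear_bound UNIV (length as) M c" "c \<ge> 0" "R \<ge> 1" "d \<ge> 0"
    and "list_all2 (\<lambda>a b. norm a \<le> R \<and> norm b \<le> R \<and> norm (a - b) \<le> d) as bs"
  shows "norm (M as - M bs) \<le> c * real (length as) * R ^ length as * d"
  using assms(6,1-5)
proof (induction arbitrary: M c rule: list_all2_induct)
  case (Cons a as b bs)
  let ?n = "length as"
  have lin: "linear (\<lambda>v. M (v # as))" using multilin_linear_Cons Cons.prems(1) by force
  have Rn: "1 \<le> R ^ ?n" using Cons.prems by (intro one_le_power)
  have "M (a # as) - M (b # bs) = M ((a - b) # as) + (M (b # as) - M (b # bs))"
    using linear_diff[OF lin, of a b] by simp
  moreover have "norm (M ((a - b) # as)) \<le> c * R ^ Suc ?n * d"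
  proof -
    have "norm (M ((a - b) # as)) \<le> c * (\<Prod>v\<leftarrow>(a - b) # as. norm v)"
      using Cons.prems(2) by (rule multilinear_boundD) simp
    also have "\<dots> \<le> c * (d * (R * R ^ ?n))"
    proof (rule mult_left_mono)
      have p: "(\<Prod>v\<leftarrow>as. norm v) \<le> R ^ ?n"
        using Cons.hyps(2) by (intro prod_list_norm_le) (auto simp: list_all2_conv_all_nth in_set_conv_nth)
      have "R ^ ?n \<le> R * R ^ ?n"
        using mult_right_mono[of 1 R "R ^ ?n"] Cons.prems Rn by simp
      with p have "(\<Prod>v\<leftarrow>as. norm v) \<le> R * R ^ ?n" by simp
      then have "norm (a - b) * (\<Prod>v\<leftarrow>as. norm v) \<le> d * (R * R ^ ?n)"
        using Cons.hyps(1) Cons.prems by (intro mult_mono prod_list_norm_nonneg) auto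
      then show "(\<Prod>v\<leftarrow>(a - b) # as. norm v) \<le> d * (R * R ^ ?n)" by simp
    qed (rule Cons.prems)
    finally show ?thesis by (simp add: mult_ac)
  qed
  moreover have "norm (M (b # as) - M (b # bs)) \<le> (c * R) * real ?n * R ^ ?n * d"
  proof (rule Cons.IH)
    show "multilin ?n (\<lambda>vs. M (b # vs))" using Cons.prems(1) by (intro multilin_Cons) simp
    have "multilinear_bound UNIV ?n (\<lambda>vs. M (b # vs)) (c * norm b)"
      using Cons.prems(2) by (intro multilinear_bound_Cons) simp
    then show "multilinear_bound UNIV ?n (\<lambda>vs. M (b # vs)) (c * R)"
      by (rule multilinear_bound_mono) (use Cons in \<open>auto intro!: mult_left_mono\<close>)
  qed (use Cons.prems in auto)
  ultimately have "norm (M (a # as) - M (b # bs)) \<le> c * R ^ Suc ?n * d + (c * R) * real ?n * R ^ ?n * d"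
    by (metis (no_types, lifting) add_mono norm_triangle_le)
  then show ?case by (simp add: algebra_simps)
qed simp

section \<open>Jets\<close>

text \<open>In contrast to \<open>Ck_on\<close>, the derivative is required for each fixed list
  \<open>vs\<close> and not in operator norm, so that ordinary calculus with
  \<open>has_derivative\<close> applies; in exchange, the derivatives of all orders up to
  \<open>k\<close> have to be continuous in operator norm. The filter \<open>nhds\<close>, rather
  than \<open>at\<close>, lets this continuity be composed with maps that may take the value
  \<open>u\<close> again.\<close>

definition jet :: "nat \<Rightarrow> 'a::real_normed_vector set \<Rightarrow> ('a \<Rightarrow> 'a list \<Rightarrow> 'b::real_normed_vector) \<Rightarrow> bool" where
  "jet k U D \<longleftrightarrow> open U \<and>
     (\<forall>u\<in>U. \<forall>j\<le>k. multilin j (D u) \<and> (\<exists>c. multilinear_bound UNIV j (D u) c)) \<and>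
     (\<forall>u\<in>U. \<forall>vs. length vs < k \<longrightarrow> ((\<lambda>w. D w vs) has_derivative (\<lambda>v. D u (v # vs))) (at u)) \<and>
     (\<forall>u\<in>U. \<forall>j\<le>k. \<forall>e>0. \<forall>\<^sub>F w in nhds u. w \<in> U \<and> multilinear_bound UNIV j (\<lambda>vs. D w vs - D u vs) e)"

lemma jetD:
  assumes "jet k U D"
  shows "open U"
    and "\<And>u j. u \<in> U \<Longrightarrow> j \<le> k \<Longrightarrow> multilin j (D u)"
    and "\<And>u j. u \<in> U \<Longrightarrow> j \<le> k \<Longrightarrow> \<exists>c>0. multilinear_bound UNIV j (D u) c"
    and "\<And>u vs. u \<in> U \<Longrightarrow> length vs < k \<Longrightarrow> ((\<lambda>w. D w vs) has_derivative (\<lambda>v. D u (v # vs))) (at u)"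
    and "\<And>u j e. u \<in> U \<Longrightarrow> j \<le> k \<Longrightarrow> e > 0 \<Longrightarrow>
          \<forall>\<^sub>F w in nhds u. w \<in> U \<and> multilinear_bound UNIV j (\<lambda>vs. D w vs - D u vs) e"
proof -
  fix u j assume "u \<in> U" "j \<le> k"
  then obtain c where "multilinear_bound UNIV j (D u) c" using assms unfolding jet_def by blast
  then have "multilinear_bound UNIV j (D u) (max c 1)" by (rule multilinear_bound_mono) simp
  then show "\<exists>c>0. multilinear_bound UNIV j (D u) c" by (intro exI[of _ "max c 1"]) auto
qed (use assms in \<open>auto simp: jet_def\<close>)

text \<open>The first slot of \<open>D u\<close> is linear because it is the direction of a
  derivative. In a later slot, linearity holds at the lower order on all of \<open>U\<close>, and it
  passes to the derivative because derivatives are unique.\<close>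

lemma jet_multilinI:
  assumes "open U"
    and der: "\<And>u vs. u \<in> U \<Longrightarrow> length vs < k \<Longrightarrow> ((\<lambda>w. D w vs) has_derivative (\<lambda>v. D u (v # vs))) (at u)"
  shows "u \<in> U \<Longrightarrow> j \<le> k \<Longrightarrow> multilin j (D u)"
proof (induction j arbitrary: u)
  case 0
  then show ?case by (simp add: multilin_def)
next
  case (Suc j)
  then have IH: "\<And>w. w \<in> U \<Longrightarrow> multilin j (D w)" by simp
  show ?case unfolding multilin_def
  proof (intro allI impI)
    fix vs ws :: "'a list" assume len: "Suc (length vs + length ws) = Suc j"
    show "(\<forall>a b. D u (vs @ (a + b) # ws) = D u (vs @ a # ws) + D u (vs @ b # ws)) \<and>
          (\<forall>a c. D u (vs @ (c *\<^sub>R a) # ws) = c *\<^sub>R D u (vs @ a # ws))"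
    proof (cases vs)
      case Nil
      then have "bounded_linear (\<lambda>v. D u (v # ws))"
        using der[OF Suc.prems(1), of ws] len Suc.prems has_derivative_bounded_linear by force
      then interpret bounded_linear "\<lambda>v. D u (v # ws)" .
      show ?thesis by (simp add: Nil add scaleR)
    next
      case (Cons v vs')
      have l: "Suc (length vs' + length ws) = j" using len Cons by simp
      have d: "((\<lambda>w. D w (vs' @ x # ws)) has_derivative (\<lambda>v. D u (v # vs' @ x # ws))) (at u)" for x
        using der[OF Suc.prems(1), of "vs' @ x # ws"] l Suc.prems by simp
      note lin = IH[unfolded multilin_def, rule_format, OF _ l]
      have "D u (v # vs' @ (a + b) # ws) = D u (v # vs' @ a # ws) + D u (v # vs' @ b # ws)" for a b
      proof -
        have "((\<lambda>w. D w (vs' @ (a + b) # ws)) has_derivative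
           (\<lambda>v. D u (v # vs' @ a # ws) + D u (v # vs' @ b # ws))) (at u)"
          by (rule has_derivative_transform_within_open[OF has_derivative_add[OF d d] assms(1) Suc.prems(1)])
            (use lin in auto)
        from has_derivative_unique[OF d this] show ?thesis by metis
      qed
      moreover have "D u (v # vs' @ (c *\<^sub>R a) # ws) = c *\<^sub>R D u (v # vs' @ a # ws)" for a c
      proof -
        have "((\<lambda>w. D w (vs' @ (c *\<^sub>R a) # ws)) has_derivative
           (\<lambda>v. c *\<^sub>R D u (v # vs' @ a # ws))) (at u)"
          by (rule has_derivative_transform_within_open[OF has_derivative_scaleR_right[OF d] assms(1) Suc.prems(1)])
            (use lin in auto)
        from has_derivative_unique[OF d this] show ?thesis by metis
      qed
      ultimately show ?thesis by (simp add: Cons)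
    qed
  qed
qed

text \<open>For the jets constructed below, multilinearity would be tedious to check directly. It
  comes from the derivatives here, so bounds and limits on unit lists suffice.\<close>

lemma jetI:
  assumes "open U"
    and der: "\<And>u vs. u \<in> U \<Longrightarrow> length vs < k \<Longrightarrow> ((\<lambda>w. D w vs) has_derivative (\<lambda>v. D u (v # vs))) (at u)"
    and bd: "\<And>u j. u \<in> U \<Longrightarrow> j \<le> k \<Longrightarrow> \<exists>c. \<forall>vs\<in>unit_lists j. norm (D u vs) \<le> c"
    and cont: "\<And>u j. u \<in> U \<Longrightarrow> j \<le> k \<Longrightarrow> uniform_limit (unit_lists j) D (D u) (at u)"
  shows "jet k U D"
  unfolding jet_def
proof (intro conjI ballI allI impI)
  fix u j assume uj: "u \<in> U" "j \<le> k"
  show ml: "multilin j (D u)" by (rule jet_multilinI[OF assms(1,2) uj])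
  show "\<exists>c. multilinear_bound UNIV j (D u) c"
    using bd[OF uj] multilinear_bound_unitI[OF ml] by blast
  fix e :: real assume e: "e > 0"
  have "\<forall>\<^sub>F w in at u. w \<in> U" using assms(1) uj(1) by (rule eventually_at_in_open')
  then have "\<forall>\<^sub>F w in at u. w \<in> U \<and> multilinear_bound UNIV j (\<lambda>vs. D w vs - D u vs) e"
    using uniform_limitD[OF cont[OF uj] e]
  proof eventually_elim
    case (elim w)
    have "multilin j (\<lambda>vs. D w vs - D u vs)"
      by (rule multilin_diff[OF jet_multilinI[OF assms(1,2) elim(1) uj(2)] ml])
    then have "multilinear_bound UNIV j (\<lambda>vs. D w vs - D u vs) e"
      by (rule multilinear_bound_unitI) (use elim in \<open>auto simp: dist_norm intro: less_imp_le\<close>)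
    with elim show ?case by simp
  qed
  moreover have "multilinear_bound UNIV j (\<lambda>vs. D u vs - D u vs) e"
    using e by (simp add: multilinear_bound_def prod_list_norm_nonneg)
  ultimately show "\<forall>\<^sub>F w in nhds u. w \<in> U \<and> multilinear_bound UNIV j (\<lambda>vs. D w vs - D u vs) e"
    using uj by (simp add: eventually_nhds_conv_at)
qed (use assms in auto)

text \<open>The mean value inequality for \<open>\<lambda>w. D w vs\<close> has the constant
  \<open>e\<close> times the product of the norms of \<open>vs\<close>. As the estimate is
  proportional to that product, it upgrades a derivative for each fixed \<open>vs\<close> to one in
  operator norm.\<close>

lemma mean_value_remainder:
  assumes "convex S" "u \<in> S" "w \<in> S" "length vs = j" "e \<ge> 0"
    and der: "\<And>z. z \<in> S \<Longrightarrow> ((\<lambda>w. D w vs) has_derivative (\<lambda>v. D z (v # vs))) (at z)"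
    and bd: "\<And>z. z \<in> S \<Longrightarrow> multilinear_bound UNIV (Suc j) (\<lambda>vs. D z vs - D u vs) e"
  shows "norm (D w vs - D u vs - D u ((w - u) # vs)) \<le> e * norm (w - u) * (\<Prod>v\<leftarrow>vs. norm v)"
proof -
  have "norm (D w vs - D u vs - D u ((w - u) # vs)) \<le> norm (w - u) * (e * (\<Prod>v\<leftarrow>vs. norm v))"
  proof (rule differentiable_bound_linearization[where S = S and f' = "\<lambda>z v. D z (v # vs)" and ?x0.0 = u])
    show "u + t *\<^sub>R (w - u) \<in> S" if "t \<in> {0..1}" for t
      using convexD_alt[OF assms(1-3), of t] that by (simp add: algebra_simps)
    show "((\<lambda>w. D w vs) has_derivative (\<lambda>v. D z (v # vs))) (at z within S)" if "z \<in> S" for z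
      using der[OF that] by (rule has_derivative_at_withinI)
    show "onorm ((\<lambda>v. D z (v # vs)) - (\<lambda>v. D u (v # vs))) \<le> e * (\<Prod>v\<leftarrow>vs. norm v)" if "z \<in> S" for z
    proof (rule onorm_bound)
      fix v
      have "norm (D z (v # vs) - D u (v # vs)) \<le> e * (\<Prod>v\<leftarrow>v # vs. norm v)"
        using multilinear_boundD[OF bd[OF that], of "v # vs"] assms(4) by simp
      then show "norm (((\<lambda>v. D z (v # vs)) - (\<lambda>v. D u (v # vs))) v) \<le> e * (\<Prod>v\<leftarrow>vs. norm v) * norm v"
        by (simp add: mult_ac)
    qed (use assms(5) in \<open>simp add: prod_list_norm_nonneg\<close>)
  qed (use assms in auto)
  then show ?thesis by (simp add: mult_ac)
qed

lemma jet_remainder: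
  assumes "jet k U D" "u \<in> U" "j < k" "e > 0"
  shows "\<forall>\<^sub>F w in nhds u. multilinear_bound UNIV j (\<lambda>vs. D w vs - D u vs - D u ((w - u) # vs)) (e * norm (w - u))"
proof -
  have "\<forall>\<^sub>F w in nhds u. w \<in> U \<and> multilinear_bound UNIV (Suc j) (\<lambda>vs. D w vs - D u vs) e"
    using jetD(5)[OF assms(1,2) _ assms(4)] assms(3) by simp
  then obtain d where d: "d > 0"
    "\<And>w. w \<in> ball u d \<Longrightarrow> w \<in> U \<and> multilinear_bound UNIV (Suc j) (\<lambda>vs. D w vs - D u vs) e"
    unfolding eventually_nhds_metric by (auto simp: dist_commute)
  have "\<forall>\<^sub>F w in nhds u. w \<in> ball u d" using d(1) by (intro eventually_nhds_in_open) auto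
  then show ?thesis
  proof eventually_elim
    case (elim w)
    show ?case unfolding multilinear_bound_def
    proof (intro allI impI)
      fix vs :: "'a list" assume "length vs = j \<and> set vs \<subseteq> UNIV"
      then show "norm (D w vs - D u vs - D u ((w - u) # vs)) \<le> e * norm (w - u) * (\<Prod>v\<leftarrow>vs. norm v)"
        using d elim assms jetD(4)[OF assms(1)] by (intro mean_value_remainder[where S = "ball u d"]) auto
    qed
  qed
qed

text \<open>\<open>Ck_on\<close> asks for continuity only at order \<open>k\<close>. Below
  \<open>k\<close>, it follows from the operator-norm derivative, whose remainder and linear part
  are both of order \<open>norm (w - u)\<close>.\<close>

lemma Ck_on_UNIV_imp_jet:
  assumes "Ck_on UNIV k U g"
  obtains D where "jet k U D" "\<And>u. u \<in> U \<Longrightarrow> D u [] = g u"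
proof -
  obtain D :: "'a \<Rightarrow> 'a list \<Rightarrow> 'b" where op: "openin (top_of_set UNIV) U"
    and D_all:
        "\<forall>u\<in>U. D u [] = g u"
        "\<forall>u\<in>U. \<forall>j\<le>k. bounded_multilinear_on UNIV j (D u)"
        "\<forall>u\<in>U. \<forall>j<k. \<forall>e>0. \<forall>\<^sub>F w in at u within U.
           multilinear_bound UNIV j (\<lambda>vs. D w vs - D u vs - D u ((w - u) # vs)) (e * norm (w - u))"
        "\<forall>u\<in>U. \<forall>e>0. \<forall>\<^sub>F w in at u within U. multilinear_bound UNIV k (\<lambda>vs. D w vs - D u vs) e"
    using assms unfolding Ck_on_def by (elim conjE exE) (rule that)
  from op have o: "open U" by simp
  have at: "at u within U = at u" if "u \<in> U" for u using at_within_open[OF that o] .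
  note D0 = D_all(1)[rule_format] and ml = D_all(2)[rule_format, unfolded bounded_multilinear_on_UNIV]
    and der = D_all(3)[rule_format] and cont = D_all(4)[rule_format]
  have hd: "((\<lambda>w. D w vs) has_derivative (\<lambda>v. D u (v # vs))) (at u)"
    if u: "u \<in> U" and len: "length vs < k" for u vs
    unfolding has_derivative_within_alt2
  proof (intro conjI allI impI)
    have ml': "multilin (Suc (length vs)) (D u)" using ml[OF u] len by simp
    obtain c where c: "multilinear_bound UNIV (Suc (length vs)) (D u) c" using ml[OF u, of "Suc (length vs)"] len by auto
    show "bounded_linear (\<lambda>v. D u (v # vs))"
      unfolding bounded_linear_def bounded_linear_axioms_def
    proof
      show "linear (\<lambda>v. D u (v # vs))" using ml' by (rule multilin_linear_Cons) simp
      have "norm (D u (v # vs)) \<le> norm v * (c * (\<Prod>v\<leftarrow>vs. norm v))" for v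
        using multilinear_boundD[OF c, of "v # vs"] by (simp add: mult_ac)
      then show "\<exists>K. \<forall>v. norm (D u (v # vs)) \<le> norm v * K" by blast
    qed
    fix e :: real assume e: "e > 0"
    define P where "P = (\<Prod>v\<leftarrow>vs. norm v)"
    have P: "P \<ge> 0" unfolding P_def by (rule prod_list_norm_nonneg)
    \<comment> \<open>The product \<open>P\<close> may vanish, hence the division by
      \<open>P + 1\<close>.\<close>
    have e': "e / (P + 1) > 0" using e P by simp
    show "\<forall>\<^sub>F w in at u. norm (D w vs - D u vs - D u ((w - u) # vs)) \<le> e * norm (w - u)"
      using der[OF u len e'] unfolding at[OF u]
    proof eventually_elim
      case (elim w)
      have "norm (D w vs - D u vs - D u ((w - u) # vs)) \<le> e / (P + 1) * norm (w - u) * P"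
        using multilinear_boundD[OF elim] by (simp add: P_def)
      also have "\<dots> = e * norm (w - u) * (P / (P + 1))" by simp
      also have "\<dots> \<le> e * norm (w - u) * 1" using e P by (intro mult_left_mono) auto
      finally show ?case by simp
    qed
  qed
  have "jet k U D"
    unfolding jet_def
  proof (intro conjI ballI allI impI)
    fix u j and e :: real assume u: "u \<in> U" and j: "j \<le> k" and e: "e > 0"
    have "\<forall>\<^sub>F w in at u. multilinear_bound UNIV j (\<lambda>vs. D w vs - D u vs) e"
    proof (cases "j = k")
      case True
      then show ?thesis using cont[OF u e] at[OF u] by simp
    next
      case False
      then have jk: "j < k" using j by simp
      obtain c where c: "multilinear_bound UNIV (Suc j) (D u) c" using ml[OF u] jk by (meson Suc_leI)
      have "((\<lambda>w. (1 + c) * norm (w - u)) \<longlongrightarrow> (1 + c) * norm (u - u)) (at u)"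
        by (rule tendsto_mult[OF tendsto_const tendsto_norm[OF tendsto_diff[OF tendsto_ident_at tendsto_const]]])
      then have "\<forall>\<^sub>F w in at u. (1 + c) * norm (w - u) < e" using e by (intro order_tendstoD) auto
      then show ?thesis using der[OF u jk zero_less_one] unfolding at[OF u]
      proof eventually_elim
        case (elim w)
        then have small: "(1 + c) * norm (w - u) < e" by simp
        have "multilinear_bound UNIV j (\<lambda>vs. (D w vs - D u vs - D u ((w - u) # vs)) + D u ((w - u) # vs))
          (1 * norm (w - u) + c * norm (w - u))"
          by (rule multilinear_bound_add[OF _ multilinear_bound_Cons[OF c]]) (use elim in simp)
        then have "multilinear_bound UNIV j (\<lambda>vs. D w vs - D u vs) (1 * norm (w - u) + c * norm (w - u))"
          by simp
        then show ?case by (rule multilinear_bound_mono) (use small in \<open>simp add: distrib_right\<close>)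
      qed
    qed
    moreover have "\<forall>\<^sub>F w in at u. w \<in> U" using o u by (rule eventually_at_in_open')
    moreover have "multilinear_bound UNIV j (\<lambda>vs. D u vs - D u vs) e"
      using e by (simp add: multilinear_bound_def prod_list_norm_nonneg)
    ultimately show "\<forall>\<^sub>F w in nhds u. w \<in> U \<and> multilinear_bound UNIV j (\<lambda>vs. D w vs - D u vs) e"
      using u by (simp add: eventually_nhds_conv_at eventually_conj_iff)
  qed (use o ml hd in auto)
  from that[OF this D0] show thesis .
qed

lemma jet_imp_Ck_on_UNIV:
  assumes "jet k U D" "\<And>u. u \<in> U \<Longrightarrow> D u [] = g u"
  shows "Ck_on UNIV k U g"
  unfolding Ck_on_def
proof (intro conjI exI[of _ D] ballI allI impI)
  have o: "open U" using assms(1) by (rule jetD)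
  then show "openin (top_of_set UNIV) U" by simp
  fix u assume u: "u \<in> U"
  then show "D u [] = g u" by (rule assms)
  have at: "at u within U = at u" using at_within_open[OF u o] .
  show "bounded_multilinear_on UNIV j (D u)" if "j \<le> k" for j
    using jetD(2,3)[OF assms(1) u that] by (auto simp: bounded_multilinear_on_UNIV)
  show "\<forall>\<^sub>F w in at u within U.
      multilinear_bound UNIV j (\<lambda>vs. D w vs - D u vs - D u ((w - u) # vs)) (e * norm (w - u))"
    if "j < k" "e > 0" for j e
    using jet_remainder[OF assms(1) u that] by (simp add: at eventually_nhds_conv_at)
  show "\<forall>\<^sub>F w in at u within U. multilinear_bound UNIV k (\<lambda>vs. D w vs - D u vs) e" if "e > 0" for e
    using jetD(5)[OF assms(1) u order_refl that] by (simp add: at eventually_nhds_conv_at eventually_conj_iff)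
qed

section \<open>Uniqueness of jets and gluing of local ones\<close>

lemma jet_unique:
  assumes "jet k U D" "jet k V E" "\<And>w. w \<in> U \<inter> V \<Longrightarrow> D w [] = E w []"
  shows "u \<in> U \<inter> V \<Longrightarrow> length vs \<le> k \<Longrightarrow> D u vs = E u vs"
proof (induction vs arbitrary: u)
  case (Cons v vs)
  have o: "open (U \<inter> V)" using assms jetD(1) by blast
  have "((\<lambda>w. E w vs) has_derivative (\<lambda>v. D u (v # vs))) (at u)"
    by (rule has_derivative_transform_within_open[OF jetD(4)[OF assms(1)] o Cons.prems(1)])
      (use Cons in auto)
  moreover have "((\<lambda>w. E w vs) has_derivative (\<lambda>v. E u (v # vs))) (at u)"
    using Cons.prems by (intro jetD(4)[OF assms(2)]) auto
  ultimately show ?case using has_derivative_unique by metis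
qed (use assms in auto)

text \<open>The chosen local jets agree on overlaps by \<open>jet_unique\<close>, so the diagonal
  family \<open>D u u\<close> coincides with the single jet \<open>D u\<close> near each
  \<open>u\<close> and inherits all local properties.\<close>

lemma Ck_on_UNIV_locally:
  assumes "\<And>u. u \<in> U \<Longrightarrow> \<exists>V. u \<in> V \<and> V \<subseteq> U \<and> Ck_on UNIV k V g"
  shows "Ck_on UNIV k U g"
proof -
  have "\<exists>V D. u \<in> V \<and> V \<subseteq> U \<and> jet k V D \<and> (\<forall>w\<in>V. D w [] = g w)" if u: "u \<in> U" for u
  proof -
    obtain V where V: "u \<in> V" "V \<subseteq> U" "Ck_on UNIV k V g" using assms[OF u] by blast
    obtain D where "jet k V D" "\<And>w. w \<in> V \<Longrightarrow> D w [] = g w" by (rule Ck_on_UNIV_imp_jet[OF V(3)]) blast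
    with V show ?thesis by blast
  qed
  then have "\<forall>u. \<exists>V D. u \<in> U \<longrightarrow> u \<in> V \<and> V \<subseteq> U \<and> jet k V D \<and> (\<forall>w\<in>V. D w [] = g w)" by meson
  from choice[OF this] obtain V where
    "\<forall>u. \<exists>D. u \<in> U \<longrightarrow> u \<in> V u \<and> V u \<subseteq> U \<and> jet k (V u) D \<and> (\<forall>w\<in>V u. D w [] = g w)" ..
  from choice[OF this] obtain D where "\<forall>u. u \<in> U \<longrightarrow> u \<in> V u \<and> V u \<subseteq> U \<and> jet k (V u) (D u) \<and> (\<forall>w\<in>V u. D u w [] = g w)" ..
  then have V: "\<And>u. u \<in> U \<Longrightarrow> u \<in> V u" "\<And>u. u \<in> U \<Longrightarrow> V u \<subseteq> U"
    and D: "\<And>u. u \<in> U \<Longrightarrow> jet k (V u) (D u)" "\<And>u w. u \<in> U \<Longrightarrow> w \<in> V u \<Longrightarrow> D u w [] = g w"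
    by auto
  have o: "open U"
    unfolding open_subopen[of U]
  proof
    show "\<exists>T. open T \<and> u \<in> T \<and> T \<subseteq> U" if u: "u \<in> U" for u
      using jetD(1)[OF D(1)[OF u]] V(1)[OF u] V(2)[OF u] by blast
  qed
  have eq: "D w w vs = D u w vs" if u: "u \<in> U" and w: "w \<in> V u" and "length vs \<le> k" for u w vs
  proof (rule jet_unique[of k "V w" "D w" "V u" "D u"])
    have wU: "w \<in> U" using V(2)[OF u] w by blast
    show "jet k (V w) (D w)" "jet k (V u) (D u)" using D(1) u wU by auto
    show "D w x [] = D u x []" if "x \<in> V w \<inter> V u" for x using D(2) u wU that by simp
    show "w \<in> V w \<inter> V u" using V(1)[OF wU] w by simp
  qed fact
  have near: "\<forall>\<^sub>F w in nhds u. w \<in> V u" if "u \<in> U" for u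
    by (rule eventually_nhds_in_open[OF jetD(1)[OF D(1)[OF that]] V(1)[OF that]])
  have "jet k U (\<lambda>u. D u u)"
    unfolding jet_def
  proof (intro conjI ballI allI impI)
    fix u assume u: "u \<in> U"
    then have j: "jet k (V u) (D u)" "u \<in> V u" by (rule D(1), rule V(1))
    show "((\<lambda>w. D w w vs) has_derivative (\<lambda>v. D u u (v # vs))) (at u)" if "length vs < k" for vs
    proof (rule has_derivative_transform_within_open[OF jetD(4)[OF j that] jetD(1)[OF j(1)] j(2)])
      show "D u w vs = D w w vs" if "w \<in> V u" for w
        using eq[OF u that, of vs] \<open>length vs < k\<close> by simp
    qed
    show "\<forall>\<^sub>F w in nhds u. w \<in> U \<and> multilinear_bound UNIV i (\<lambda>vs. D w w vs - D u u vs) e"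
      if "i \<le> k" "e > 0" for i e
      using jetD(5)[OF j that] near[OF u]
    proof eventually_elim
      case (elim w)
      have "multilinear_bound UNIV i (\<lambda>vs. D w w vs - D u u vs) e"
      proof (rule multilinear_bound_cong[where M = "\<lambda>vs. D u w vs - D u u vs"])
        show "D u w vs - D u u vs = D w w vs - D u u vs" if "length vs = i" for vs
        proof -
          have "D w w vs = D u w vs" by (rule eq[OF u elim(2)]) (simp add: that \<open>i \<le> k\<close>)
          then show ?thesis by simp
        qed
      qed (rule conjunct2[OF elim(1)])
      then show ?case using elim V(2)[OF u] by blast
    qed
    show "multilin i (D u u)" "\<exists>c. multilinear_bound UNIV i (D u u) c" if "i \<le> k" for i
      using jetD(2,3)[OF j that] by blast+
  qed (rule o)
  then show ?thesis by (rule jet_imp_Ck_on_UNIV) (rule D(2)[OF _ V(1)])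
qed

text \<open>With linear maps on both sides, the chain rule has a single term: the derivatives are
  \<open>L2 (D (L1 u) (map L1 vs))\<close>. When \<open>L1\<close> is a projection onto
  \<open>X\<close>, this transports a statement relative to the subspace to an open set of the full
  space.\<close>

lemma Ck_on_compose_bounded_linear:
  fixes L1 :: "'c::real_normed_vector \<Rightarrow> 'a::real_normed_vector" and g :: "'a \<Rightarrow> 'b::real_normed_vector"
    and L2 :: "'b \<Rightarrow> 'd::real_normed_vector"
  assumes "Ck_on X k U g" "bounded_linear L1" "range L1 \<subseteq> X" "bounded_linear L2"
  shows "Ck_on UNIV k (L1 -` U) (\<lambda>u. L2 (g (L1 u)))"
proof -
  obtain D :: "'a \<Rightarrow> 'a list \<Rightarrow> 'b" where op: "openin (top_of_set X) U"
    and D_all: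
        "\<forall>u\<in>U. D u [] = g u"
        "\<forall>u\<in>U. \<forall>j\<le>k. bounded_multilinear_on X j (D u)"
        "\<forall>u\<in>U. \<forall>j<k. \<forall>e>0. \<forall>\<^sub>F w in at u within U.
           multilinear_bound X j (\<lambda>vs. D w vs - D u vs - D u ((w - u) # vs)) (e * norm (w - u))"
        "\<forall>u\<in>U. \<forall>e>0. \<forall>\<^sub>F w in at u within U. multilinear_bound X k (\<lambda>vs. D w vs - D u vs) e"
    using assms unfolding Ck_on_def by (elim conjE exE) (rule that)
  note D0 = D_all(1)[rule_format] and ml = D_all(2)[rule_format, unfolded bounded_multilinear_on_def]
    and der = D_all(3)[rule_format, unfolded eventually_at] and cont = D_all(4)[rule_format, unfolded eventually_at]
  interpret L1: bounded_linear L1 by fact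
  interpret L2: bounded_linear L2 by fact
  obtain B1 where B1: "B1 > 0" "\<And>x. norm (L1 x) \<le> norm x * B1" using L1.pos_bounded by blast
  obtain B2 where B2: "B2 > 0" "\<And>x. norm (L2 x) \<le> norm x * B2" using L2.pos_bounded by blast
  have L1X: "L1 x \<in> X" for x using assms(3) by auto
  have prodL1: "(\<Prod>v\<leftarrow>map L1 vs. norm v) \<le> B1 ^ length vs * (\<Prod>v\<leftarrow>vs. norm v)" for vs
  proof (induction vs)
    case (Cons v vs)
    have "norm (L1 v) * (\<Prod>v\<leftarrow>map L1 vs. norm v) \<le> (norm v * B1) * (B1 ^ length vs * (\<Prod>v\<leftarrow>vs. norm v))"
      by (rule mult_mono[OF B1(2) Cons.IH]) (use B1 prod_list_norm_nonneg[of "map L1 vs"] in auto)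
    then show ?case by (simp add: mult_ac)
  qed simp
  have lift: "multilinear_bound UNIV j (\<lambda>vs. L2 (M (map L1 vs))) (B2 * c * B1 ^ j)"
    if M: "multilinear_bound X j M c" and c: "c \<ge> 0" for M c j
    unfolding multilinear_bound_def
  proof (intro allI impI)
    fix vs :: "'c list" assume vs: "length vs = j \<and> set vs \<subseteq> UNIV"
    have "norm (M (map L1 vs)) \<le> c * (\<Prod>v\<leftarrow>map L1 vs. norm v)"
      using M[unfolded multilinear_bound_def, rule_format, of "map L1 vs"] vs L1X by auto
    also have "\<dots> \<le> c * (B1 ^ j * (\<Prod>v\<leftarrow>vs. norm v))"
      using prodL1[of vs] vs c by (intro mult_left_mono) auto
    finally have "B2 * norm (M (map L1 vs)) \<le> B2 * (c * (B1 ^ j * (\<Prod>v\<leftarrow>vs. norm v)))"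
      using B2 by (intro mult_left_mono) auto
    then show "norm (L2 (M (map L1 vs))) \<le> B2 * c * B1 ^ j * (\<Prod>v\<leftarrow>vs. norm v)"
      using B2(2)[of "M (map L1 vs)"] by (simp add: mult_ac)
  qed
  define E where "E u vs = L2 (D (L1 u) (map L1 vs))" for u vs
  have near: "\<forall>\<^sub>F w in at u within L1 -` U. w \<in> L1 -` U \<and> norm (L1 w - L1 u) < d"
    if "u \<in> L1 -` U" "d > 0" for u d
  proof -
    have "((\<lambda>w. norm (L1 w - L1 u)) \<longlongrightarrow> norm (L1 u - L1 u)) (at u within L1 -` U)"
      by (rule tendsto_norm[OF tendsto_diff[OF L1.tendsto[OF tendsto_ident_at] tendsto_const]])
    then have "\<forall>\<^sub>F w in at u within L1 -` U. norm (L1 w - L1 u) < d"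
      using that by (intro order_tendstoD) auto
    moreover have "\<forall>\<^sub>F w in at u within L1 -` U. w \<in> L1 -` U" by (simp add: eventually_at_filter)
    ultimately show ?thesis by eventually_elim simp
  qed
  show ?thesis unfolding Ck_on_def
  proof (intro conjI exI[of _ E] ballI allI impI)
    obtain O' where O': "open O'" "U = X \<inter> O'" using op by (auto simp: openin_open)
    then have "L1 -` U = L1 -` O'" using L1X by auto
    moreover have "open (L1 -` O')" by (rule open_vimage[OF O'(1) linear_continuous_on[OF assms(2)]])
    ultimately show "openin (top_of_set UNIV) (L1 -` U)" by simp
    fix u assume "u \<in> L1 -` U"
    then have u: "u \<in> L1 -` U" "L1 u \<in> U" by auto
    show "E u [] = L2 (g (L1 u))" using D0[OF u(2)] by (simp add: E_def)
    show "bounded_multilinear_on UNIV j (E u)" if "j \<le> k" for j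
      unfolding bounded_multilinear_on_UNIV
    proof
      note m = ml[OF u(2) that]
      show "multilin j (E u)" unfolding multilin_def
      proof (intro allI impI)
        fix vs ws :: "'c list" assume len: "Suc (length vs + length ws) = j"
        then have "Suc (length (map L1 vs) + length (map L1 ws)) = j \<and> set (map L1 vs) \<subseteq> X \<and> set (map L1 ws) \<subseteq> X"
          using L1X by auto
        note q = m[THEN conjunct1, rule_format, OF this]
        show "(\<forall>a b. E u (vs @ (a + b) # ws) = E u (vs @ a # ws) + E u (vs @ b # ws)) \<and>
              (\<forall>a c. E u (vs @ (c *\<^sub>R a) # ws) = c *\<^sub>R E u (vs @ a # ws))"
          using q L1X by (simp add: E_def L1.add L1.scaleR L2.add[symmetric] L2.scaleR[symmetric])
      qed
      obtain c where "multilinear_bound X j (D (L1 u)) c" using m by blast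
      then have "multilinear_bound X j (D (L1 u)) (max c 0)" by (rule multilinear_bound_mono) simp
      from lift[OF this] show "\<exists>c. multilinear_bound UNIV j (E u) c" unfolding E_def by auto
    qed
    show "\<forall>\<^sub>F w in at u within L1 -` U.
        multilinear_bound UNIV j (\<lambda>vs. E w vs - E u vs - E u ((w - u) # vs)) (e * norm (w - u))"
      if j: "j < k" and e: "e > 0" for j e
    proof -
      \<comment> \<open>One factor \<open>B1\<close> for each of the \<open>j\<close> arguments, one
        more for \<open>w - u\<close>, and \<open>B2\<close> for the outer map.\<close>
      define e' where "e' = e / (B2 * B1 ^ Suc j)"
      have e': "e' > 0" using e B1 B2 by (simp add: e'_def)
      obtain d where d: "d > 0" "\<And>x. x \<in> U \<Longrightarrow> x \<noteq> L1 u \<Longrightarrow> dist x (L1 u) < d \<Longrightarrow>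
        multilinear_bound X j (\<lambda>vs. D x vs - D (L1 u) vs - D (L1 u) ((x - L1 u) # vs)) (e' * norm (x - L1 u))"
        using der[OF u(2) j e'] by blast
      show ?thesis using near[OF u(1) d(1)]
      proof eventually_elim
        case (elim w)
        have "multilinear_bound X j (\<lambda>vs. D (L1 w) vs - D (L1 u) vs - D (L1 u) ((L1 w - L1 u) # vs)) (e' * norm (L1 w - L1 u))"
        \<comment> \<open>A map \<open>L1\<close> with a kernel may send different points
          \<open>w\<close> and \<open>u\<close> to the same point, which the filter in the
          assumption excludes. There the remainder is zero by linearity in the first slot.\<close>
        proof (cases "L1 w = L1 u")
          case False
          from elim have "L1 w \<in> U" "dist (L1 w) (L1 u) < d" by (auto simp: dist_norm)
          then show ?thesis using d(2) False by blast
        next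
          case True
          have "D (L1 u) (0 # vs) = 0" if "length vs = j" "set vs \<subseteq> X" for vs
          proof -
            have "Suc (length [] + length vs) = Suc j \<and> set [] \<subseteq> X \<and> set vs \<subseteq> X" using that by simp
            note q = ml[OF u(2) Suc_leI[OF j], THEN conjunct1, rule_format, OF this]
            have "D (L1 u) ((0 *\<^sub>R L1 u) # vs) = 0 *\<^sub>R D (L1 u) (L1 u # vs)"
              using q[THEN conjunct2, rule_format, OF L1X[of u], of 0] by simp
            then show ?thesis by simp
          qed
          then show ?thesis by (simp add: True multilinear_bound_def)
        qed
        from lift[OF this] have "multilinear_bound UNIV j (\<lambda>vs. E w vs - E u vs - E u ((w - u) # vs))
            (B2 * (e' * norm (L1 w - L1 u)) * B1 ^ j)"
          unfolding E_def using e' by (simp add: L2.diff L1.diff)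
        then show ?case
        proof (rule multilinear_bound_mono)
          have "norm (L1 w - L1 u) \<le> norm (w - u) * B1" using B1(2)[of "w - u"] by (simp add: L1.diff)
          then have "(e' * B2 * B1 ^ j) * norm (L1 w - L1 u) \<le> (e' * B2 * B1 ^ j) * (norm (w - u) * B1)"
            by (rule mult_left_mono) (use B1(1) B2(1) e' in simp)
          also have "\<dots> = (e' * (B2 * B1 ^ Suc j)) * norm (w - u)" by (simp only: power_Suc mult_ac)
          also have "e' * (B2 * B1 ^ Suc j) = e" unfolding e'_def using B1(1) B2(1) by simp
          finally have "(e' * B2 * B1 ^ j) * norm (L1 w - L1 u) \<le> e * norm (w - u)" .
          then show "B2 * (e' * norm (L1 w - L1 u)) * B1 ^ j \<le> e * norm (w - u)" by (simp only: mult_ac)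
        qed
      qed
    qed
    show "\<forall>\<^sub>F w in at u within L1 -` U. multilinear_bound UNIV k (\<lambda>vs. E w vs - E u vs) e" if e: "e > 0" for e
    proof -
      define e' where "e' = e / (B2 * B1 ^ k)"
      have e': "e' > 0" using e B1 B2 by (simp add: e'_def)
      obtain d where d: "d > 0" "\<And>x. x \<in> U \<Longrightarrow> x \<noteq> L1 u \<Longrightarrow> dist x (L1 u) < d \<Longrightarrow>
        multilinear_bound X k (\<lambda>vs. D x vs - D (L1 u) vs) e'"
        using cont[OF u(2) e'] by blast
      show ?thesis using near[OF u(1) d(1)]
      proof eventually_elim
        case (elim w)
        have "multilinear_bound X k (\<lambda>vs. D (L1 w) vs - D (L1 u) vs) e'"
        proof (cases "L1 w = L1 u")
          case False
          from elim have "L1 w \<in> U" "dist (L1 w) (L1 u) < d" by (auto simp: dist_norm)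
          then show ?thesis using d(2) False by blast
        next
          case True
          then show ?thesis using e' by (simp add: multilinear_bound_def prod_list_norm_nonneg)
        qed
        from lift[OF this] show ?case
          unfolding E_def e'_def using e B1(1) B2(1) by (simp add: L2.diff)
      qed
    qed
  qed
qed

lemma Ck_on_restrict:
  fixes g :: "'a::real_normed_vector \<Rightarrow> 'b::real_normed_vector"
  assumes "Ck_on UNIV k V g"
  shows "Ck_on X k (V \<inter> X) g"
proof -
  obtain D :: "'a \<Rightarrow> 'a list \<Rightarrow> 'b" where op: "openin (top_of_set UNIV) V"
    and D_all:
        "\<forall>u\<in>V. D u [] = g u"
        "\<forall>u\<in>V. \<forall>j\<le>k. bounded_multilinear_on UNIV j (D u)"
        "\<forall>u\<in>V. \<forall>j<k. \<forall>e>0. \<forall>\<^sub>F w in at u within V.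
           multilinear_bound UNIV j (\<lambda>vs. D w vs - D u vs - D u ((w - u) # vs)) (e * norm (w - u))"
        "\<forall>u\<in>V. \<forall>e>0. \<forall>\<^sub>F w in at u within V. multilinear_bound UNIV k (\<lambda>vs. D w vs - D u vs) e"
    using assms unfolding Ck_on_def by (elim conjE exE) (rule that)
  have mb: "multilinear_bound X j M c" if "multilinear_bound UNIV j M c" for j c and M :: "'a list \<Rightarrow> 'b"
    using that by (auto simp: multilinear_bound_def)
  have ev: "\<forall>\<^sub>F w in at u within V \<inter> X. P w" if "\<forall>\<^sub>F w in at u within V. P w" for u P
    using that unfolding eventually_at_filter by (rule eventually_mono) simp
  show ?thesis unfolding Ck_on_def
  proof (intro conjI exI[of _ D] ballI allI impI)
    show "openin (top_of_set X) (V \<inter> X)" using op by (auto simp: openin_open)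
    show "bounded_multilinear_on X j (D u)" if "u \<in> V \<inter> X" "j \<le> k" for u j
    proof -
      have b: "bounded_multilinear_on UNIV j (D u)" using D_all(2) that by simp
      then obtain c where "multilinear_bound UNIV j (D u) c" unfolding bounded_multilinear_on_UNIV by blast
      then have "\<exists>c. multilinear_bound X j (D u) c" by (intro exI mb)
      with b show ?thesis unfolding bounded_multilinear_on_def by simp
    qed
    show "\<forall>\<^sub>F w in at u within V \<inter> X.
        multilinear_bound X j (\<lambda>vs. D w vs - D u vs - D u ((w - u) # vs)) (e * norm (w - u))"
      if "u \<in> V \<inter> X" "j < k" "e > 0" for u j e
    proof -
      have "\<forall>\<^sub>F w in at u within V.
        multilinear_bound UNIV j (\<lambda>vs. D w vs - D u vs - D u ((w - u) # vs)) (e * norm (w - u))"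
        using D_all(3) that by blast
      from ev[OF this] show ?thesis by eventually_elim (rule mb)
    qed
    show "\<forall>\<^sub>F w in at u within V \<inter> X. multilinear_bound X k (\<lambda>vs. D w vs - D u vs) e"
      if "u \<in> V \<inter> X" "e > 0" for u e
    proof -
      have "\<forall>\<^sub>F w in at u within V. multilinear_bound UNIV k (\<lambda>vs. D w vs - D u vs) e"
        using D_all(4) that by blast
      from ev[OF this] show ?thesis by eventually_elim (rule mb)
    qed
  qed (use D_all(1) in blast)
qed

section \<open>Differentiation of multilinear expressions\<close>

lemma has_derivative_zeroI:
  assumes "f y = 0" "\<And>e. e > 0 \<Longrightarrow> \<forall>\<^sub>F z in at y. norm (f z) \<le> e * norm (z - y)"
  shows "(f has_derivative (\<lambda>v. 0)) (at y)"
  unfolding has_derivative_within_alt2 using assms by simp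

lemma has_derivative_eventually_le:
  assumes "(r has_derivative r') (at y)"
  obtains C where "C > 0" "\<forall>\<^sub>F z in at y. norm (r z - r y) \<le> C * norm (z - y)"
proof -
  have bl: "bounded_linear r'" and ev: "\<forall>\<^sub>F z in at y. norm (r z - r y - r' (z - y)) \<le> 1 * norm (z - y)"
    using assms zero_less_one unfolding has_derivative_within_alt2 by blast+
  obtain C where C: "C > 0" "\<And>v. norm (r' v) \<le> norm v * C"
    using bounded_linear.pos_bounded[OF bl] by blast
  have "\<forall>\<^sub>F z in at y. norm (r z - r y) \<le> (C + 1) * norm (z - y)"
    using ev
  proof eventually_elim
    case (elim z)
    have "norm (r z - r y) \<le> norm (r z - r y - r' (z - y)) + norm (r' (z - y))"
      by (metis diff_add_cancel norm_triangle_ineq)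
    also have "\<dots> \<le> 1 * norm (z - y) + norm (z - y) * C" by (intro add_mono elim C(2))
    finally show ?case by (simp add: algebra_simps)
  qed
  with C show thesis by (intro that[of "C + 1"]) auto
qed

text \<open>Differentiability of \<^term>\<open>r\<close> at its zero \<^term>\<open>y\<close> makes up for mere continuity of \<^term>\<open>L\<close>.\<close>

lemma has_derivative_apply_at_zero:
  assumes r: "(r has_derivative r') (at y)" "r y = 0" and lin: "bounded_linear (L y)"
    and L: "\<And>e. e > 0 \<Longrightarrow> \<forall>\<^sub>F z in at y. \<forall>x. norm (L z x - L y x) \<le> e * norm x"
  shows "((\<lambda>z. L z (r z)) has_derivative (\<lambda>v. L y (r' v))) (at y)"
proof -
  have 1: "((\<lambda>z. L y (r z)) has_derivative (\<lambda>v. L y (r' v))) (at y)"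
    by (rule bounded_linear.has_derivative[OF lin r(1)])
  obtain C where C: "C > 0" "\<forall>\<^sub>F z in at y. norm (r z - r y) \<le> C * norm (z - y)"
    using has_derivative_eventually_le[OF r(1)] .
  have 2: "((\<lambda>z. L z (r z) - L y (r z)) has_derivative (\<lambda>v. 0)) (at y)"
  proof (rule has_derivative_zeroI)
    fix e :: real assume "e > 0"
    then have "e / C > 0" using C by simp
    from L[OF this] C(2) show "\<forall>\<^sub>F z in at y. norm (L z (r z) - L y (r z)) \<le> e * norm (z - y)"
    proof eventually_elim
      case (elim z)
      have "norm (L z (r z) - L y (r z)) \<le> e / C * norm (r z)" using elim by blast
      also have "\<dots> \<le> e / C * (C * norm (z - y))"
        using elim(2) r(2) \<open>e / C > 0\<close> by (intro mult_left_mono) auto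
      finally show ?case using C(1) by simp
    qed
  qed simp
  show ?thesis using has_derivative_add[OF 1 2] by simp
qed

lemma multilinear_diff_le:
  assumes "multilin n N" "multilinear_bound UNIV n N c" "c \<ge> 0"
    and "multilinear_bound UNIV n (\<lambda>vs. M vs - N vs) e" "e \<ge> 0" "R \<ge> 1" "d \<ge> 0" "length as = n"
    and "list_all2 (\<lambda>a b. norm a \<le> R \<and> norm b \<le> R \<and> norm (a - b) \<le> d) as bs"
  shows "norm (M as - N bs) \<le> e * R ^ n + c * real n * R ^ n * d"
proof -
  have "norm (M as - N as) \<le> e * (\<Prod>v\<leftarrow>as. norm v)"
    using multilinear_boundD[OF assms(4,8)] .
  also have "\<dots> \<le> e * R ^ n"
  proof (rule mult_left_mono)
    show "(\<Prod>v\<leftarrow>as. norm v) \<le> R ^ n"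
      unfolding assms(8)[symmetric]
      using assms(9) by (intro prod_list_norm_le) (auto simp: list_all2_conv_all_nth in_set_conv_nth)
  qed (rule assms(5))
  finally have "norm (M as - N as) \<le> e * R ^ n" .
  moreover have "norm (N as - N bs) \<le> c * real n * R ^ n * d"
    using multilin_diff_le[of as N c R d bs] assms by simp
  ultimately show ?thesis
    using norm_triangle_ineq[of "M as - N as" "N as - N bs"] by simp
qed

text \<open>The Leibniz sum: over all positions, \<open>M\<close> is applied to \<open>as\<close>
  with the entry there replaced by that of \<open>ds\<close>.\<close>

primrec multilin_deriv :: "('a list \<Rightarrow> 'b::comm_monoid_add) \<Rightarrow> 'a list \<Rightarrow> 'a list \<Rightarrow> 'b" where
  "multilin_deriv M [] ds = 0"
| "multilin_deriv M (a # as) ds =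
     (case ds of [] \<Rightarrow> 0 | d # ds' \<Rightarrow> M (d # as) + multilin_deriv (\<lambda>zs. M (a # zs)) as ds')"

lemma eventually_all_close:
  assumes "\<forall>p\<in>set ps. (p \<longlongrightarrow> p y) (at y)" "d > 0"
  shows "\<forall>\<^sub>F z in at y. \<forall>p\<in>set ps. norm (p z - p y) < d"
proof -
  have "\<forall>\<^sub>F z in at y. norm (p z - p y) < d" if "p \<in> set ps" for p
    using tendstoD[of p "p y" "at y" d] assms that by (simp add: dist_norm)
  then show ?thesis by (simp add: eventually_ball_finite)
qed

text \<open>Both terms carry the same \<open>M z\<close>, so only the arguments are differentiated
  and continuity of \<open>M\<close> at \<open>y\<close> suffices. Splitting off the first argument
  leaves a term with first entry \<open>p z - p y\<close>, which vanishes at \<open>y\<close> as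
  \<open>has_derivative_apply_at_zero\<close> requires, and a difference of the same form with one
  argument fewer.\<close>

lemma has_derivative_multilin:
  fixes M :: "'c::real_normed_vector \<Rightarrow> 'a::real_normed_vector list \<Rightarrow> 'b::real_normed_vector"
  assumes "list_all2 (\<lambda>p p'. (p has_derivative p') (at y)) ps ps'"
    and "open S" "y \<in> S" "\<And>z. z \<in> S \<Longrightarrow> multilin (length ps) (M z)"
    and "multilinear_bound UNIV (length ps) (M y) c" "c \<ge> 0"
    and "\<And>e. e > 0 \<Longrightarrow> \<forall>\<^sub>F z in at y. multilinear_bound UNIV (length ps) (\<lambda>vs. M z vs - M y vs) e"
  shows "((\<lambda>z. M z (map (\<lambda>p. p z) ps) - M z (map (\<lambda>p. p y) ps)) has_derivative
     (\<lambda>v. multilin_deriv (M y) (map (\<lambda>p. p y) ps) (map (\<lambda>p'. p' v) ps'))) (at y)"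
  using assms
proof (induction arbitrary: M c rule: list_all2_induct)
  case Nil
  then show ?case by simp
next
  case (Cons p ps p' ps')
  let ?n = "length ps"
  let ?P = "\<lambda>z. map (\<lambda>p. p z) ps"
  have ml: "multilin (Suc ?n) (M z)" if "z \<in> S" for z using Cons.prems(3)[OF that] by simp
  have bd: "multilinear_bound UNIV (Suc ?n) (M y) c" using Cons.prems(4) by simp
  have op: "\<forall>\<^sub>F z in at y. multilinear_bound UNIV (Suc ?n) (\<lambda>vs. M z vs - M y vs) e" if "e > 0" for e
    using Cons.prems(6)[OF that] by simp
  have rest: "((\<lambda>z. M z (p y # ?P z) - M z (p y # ?P y)) has_derivative
     (\<lambda>v. multilin_deriv (\<lambda>vs. M y (p y # vs)) (?P y) (map (\<lambda>p'. p' v) ps'))) (at y)"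
  proof (rule Cons.IH[OF Cons.prems(1,2)])
    show "multilin ?n (\<lambda>vs. M z (p y # vs))" if "z \<in> S" for z using ml[OF that] by (rule multilin_Cons)
    show "multilinear_bound UNIV ?n (\<lambda>vs. M y (p y # vs)) (c * norm (p y))" using bd by (rule multilinear_bound_Cons)
    show "0 \<le> c * norm (p y)" using Cons.prems(5) by simp
    fix e :: real assume e: "e > 0"
    then have "e / (norm (p y) + 1) > 0" by (intro divide_pos_pos add_nonneg_pos) auto
    from op[OF this] show "\<forall>\<^sub>F z in at y. multilinear_bound UNIV ?n (\<lambda>vs. M z (p y # vs) - M y (p y # vs)) e"
    proof eventually_elim
      case (elim z)
      have "e / (norm (p y) + 1) * norm (p y) = e * (norm (p y) / (norm (p y) + 1))" by simp
      also have "\<dots> \<le> e * 1"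
        using e by (intro mult_left_mono) (auto simp: divide_le_eq_1 add_nonneg_pos)
      finally have le: "e / (norm (p y) + 1) * norm (p y) \<le> e" by simp
      show ?case using multilinear_bound_mono[OF multilinear_bound_Cons[OF elim] le] .
    qed
  qed
  have hd: "((\<lambda>z. M z ((p z - p y) # ?P z)) has_derivative (\<lambda>v. M y (p' v # ?P y))) (at y)"
  proof (rule has_derivative_apply_at_zero[where L = "\<lambda>z x. M z (x # ?P z)" and r = "\<lambda>z. p z - p y"])
    show "((\<lambda>z. p z - p y) has_derivative p') (at y)"
      using Cons.hyps(1) by (auto intro!: derivative_eq_intros)
    show "bounded_linear (\<lambda>x. M y (x # ?P y))"
      unfolding bounded_linear_def bounded_linear_axioms_def
    proof
      show "linear (\<lambda>x. M y (x # ?P y))" by (rule multilin_linear_Cons[OF ml[OF Cons.prems(2)]]) simp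
      have "norm (M y (x # ?P y)) \<le> norm x * (c * (\<Prod>v\<leftarrow>?P y. norm v))" for x
        using multilinear_boundD[OF bd, of "x # ?P y"] by (simp add: mult_ac)
      then show "\<exists>K. \<forall>x. norm (M y (x # ?P y)) \<le> norm x * K" by blast
    qed
    fix e :: real assume e: "e > 0"
    define R where "R = 2 + (\<Sum>p\<leftarrow>ps. norm (p y))"
    have R0: "norm (p y) \<le> R - 2" if "p \<in> set ps" for p
    proof -
      have "norm (p y) \<in> set (map (\<lambda>p. norm (p y)) ps)" using that by simp
      then show ?thesis unfolding R_def using member_le_sum_list by fastforce
    qed
    have R: "R \<ge> 1" 
    proof -
      have "0 \<le> (\<Sum>p\<leftarrow>ps. norm (p y))" by (rule sum_list_nonneg) auto
      then show ?thesis by (simp add: R_def)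
    qed
    \<comment> \<open>Half of \<open>e\<close> pays for the change of \<open>M\<close>, the other
      half for the moved arguments: relative to \<open>norm x\<close>, their effect is at most
      \<open>K * d\<close>.\<close>
    define K where "K = c * real ?n * R ^ ?n"
    have K: "K \<ge> 0" using R Cons.prems(5) by (simp add: K_def)
    define d where "d = min 1 (e / (2 * (K + 1)))"
    have d: "d > 0" "d \<le> 1" using e K by (auto simp: d_def)
    have e1: "e / (2 * R ^ ?n) > 0" using e R by simp
    have "\<forall>p\<in>set ps. (p \<longlongrightarrow> p y) (at y)"
    proof
      fix q assume "q \<in> set ps"
      then obtain i where "i < length ps" "q = ps ! i" by (auto simp: in_set_conv_nth)
      then have "(q has_derivative ps' ! i) (at y)" using Cons.hyps(2) by (simp add: list_all2_conv_all_nth)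
      then show "(q \<longlongrightarrow> q y) (at y)" using has_derivative_continuous continuous_within by blast
    qed
    from eventually_all_close[OF this d(1)] op[OF e1]
    show "\<forall>\<^sub>F z in at y. \<forall>x. norm (M z (x # ?P z) - M y (x # ?P y)) \<le> e * norm x"
    proof eventually_elim
      case (elim z)
      show ?case
      proof
        fix x
        have "norm (M z (x # ?P z) - M y (x # ?P y)) \<le>
          (e / (2 * R ^ ?n) * norm x) * R ^ ?n + (c * norm x) * real ?n * R ^ ?n * d"
        proof (rule multilinear_diff_le[where M = "\<lambda>vs. M z (x # vs)" and N = "\<lambda>vs. M y (x # vs)" and as = "?P z" and bs = "?P y"])
          show "multilin ?n (\<lambda>vs. M y (x # vs))" using ml[OF Cons.prems(2)] by (rule multilin_Cons)
          show "multilinear_bound UNIV ?n (\<lambda>vs. M y (x # vs)) (c * norm x)" using bd by (rule multilinear_bound_Cons)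
          show "multilinear_bound UNIV ?n (\<lambda>vs. M z (x # vs) - M y (x # vs)) (e / (2 * R ^ ?n) * norm x)"
            using elim(2) by (rule multilinear_bound_Cons[where M = "\<lambda>vs. M z vs - M y vs"])
          show "list_all2 (\<lambda>a b. norm a \<le> R \<and> norm b \<le> R \<and> norm (a - b) \<le> d) (?P z) (?P y)"
          proof -
            have "norm (q z) \<le> R \<and> norm (q y) \<le> R \<and> norm (q z - q y) \<le> d" if "q \<in> set ps" for q
              using elim(1)[rule_format, OF that] R0[OF that] d norm_triangle_ineq2[of "q z" "q y"] by simp
            then show ?thesis by (simp add: list_all2_conv_all_nth)
          qed
        qed (use Cons.prems(5) less_imp_le[OF e] R d in auto)
        also have "\<dots> = norm x * (e / 2 + K * d)"
          using R by (simp add: K_def algebra_simps)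
        also have "\<dots> \<le> norm x * e"
        proof (rule mult_left_mono)
          have "K * d \<le> (K + 1) * (e / (2 * (K + 1)))"
            using K d by (intro mult_mono) (auto simp: d_def)
          also have "\<dots> = e / 2" using K by (simp add: field_simps)
          finally show "e / 2 + K * d \<le> e" by simp
        qed simp
        finally show "norm (M z (x # ?P z) - M y (x # ?P y)) \<le> e * norm x"
          by (simp add: mult.commute)
      qed
    qed
  qed simp
  have "((\<lambda>z. M z ((p z - p y) # ?P z) + (M z (p y # ?P z) - M z (p y # ?P y))) has_derivative
     (\<lambda>v. M y (p' v # ?P y) + multilin_deriv (\<lambda>vs. M y (p y # vs)) (?P y) (map (\<lambda>p'. p' v) ps'))) (at y)"
    by (rule has_derivative_add[OF hd rest])
  then have "((\<lambda>z. M z (p z # ?P z) - M z (p y # ?P y)) has_derivative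
     (\<lambda>v. M y (p' v # ?P y) + multilin_deriv (\<lambda>vs. M y (p y # vs)) (?P y) (map (\<lambda>p'. p' v) ps'))) (at y)"
  proof (rule has_derivative_transform_within_open[OF _ Cons.prems(1,2)])
    fix z assume "z \<in> S"
    then have "linear (\<lambda>v. M z (v # ?P z))" by (intro multilin_linear_Cons[OF ml]) auto
    from linear_diff[OF this, of "p z" "p y"]
    show "M z ((p z - p y) # ?P z) + (M z (p y # ?P z) - M z (p y # ?P y)) = M z (p z # ?P z) - M z (p y # ?P y)"
      by simp
  qed
  then show ?case by simp
qed

section \<open>The inverse function theorem in Banach spaces\<close>

text \<open>Newton's iteration with the derivative frozen at \<open>x0\<close>:
  \<open>\<lambda>x. x - A (G x - y)\<close> halves distances on a small closed ball, and its fixed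
  point satisfies \<open>A (G x - y) = 0\<close>, hence \<open>G x = y\<close> because
  \<open>G' x0\<close> undoes \<open>A\<close>. The radius \<open>r0\<close> is arbitrary, so that
  the lemma also yields continuity of an inverse.\<close>

lemma local_surjectivity:
  fixes G :: "'a::banach \<Rightarrow> 'b::real_normed_vector"
  assumes o: "open W" and x0: "x0 \<in> W"
    and der: "\<And>x. x \<in> W \<Longrightarrow> (G has_derivative G' x) (at x)"
    and cont: "\<And>e. e > 0 \<Longrightarrow> \<forall>\<^sub>F x in nhds x0. \<forall>v. norm (G' x v - G' x0 v) \<le> e * norm v"
    and A: "bounded_linear A" "\<And>v. A (G' x0 v) = v" "\<And>v. G' x0 (A v) = v"
    and r0: "r0 > 0"
  shows "\<exists>\<delta>>0. \<forall>y. dist y (G x0) < \<delta> \<longrightarrow> (\<exists>x\<in>W. dist x x0 \<le> r0 \<and> G x = y)"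
proof -
  interpret A: bounded_linear A by fact
  obtain K where K: "K > 0" "\<And>v. norm (A v) \<le> norm v * K" using A.pos_bounded by blast
  \<comment> \<open>Turns \<open>K * e\<close>, the Lipschitz constant of the iteration, into
    1/2.\<close>
  define e where "e = 1 / (2 * K)"
  have e: "e > 0" "K * e = 1 / 2" using K by (auto simp: e_def)
  have "\<forall>\<^sub>F x in nhds x0. x \<in> W" using o x0 by (rule eventually_nhds_in_open)
  with cont[OF e(1)] have "\<forall>\<^sub>F x in nhds x0. x \<in> W \<and> (\<forall>v. norm (G' x v - G' x0 v) \<le> e * norm v)"
    by eventually_elim simp
  then obtain \<rho> where \<rho>: "\<rho> > 0" "\<And>x. dist x x0 < \<rho> \<Longrightarrow> x \<in> W \<and> (\<forall>v. norm (G' x v - G' x0 v) \<le> e * norm v)"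
    unfolding eventually_nhds_metric by blast
  define r where "r = min r0 (\<rho> / 2)"
  have r: "r > 0" "r \<le> r0" "r < \<rho>" using r0 \<rho> by (auto simp: r_def)
  define B where "B = cball x0 r"
  have BW: "x \<in> W" "norm (G' x v - G' x0 v) \<le> e * norm v" if "x \<in> B" for x v
    using \<rho>(2)[of x] that r by (auto simp: B_def dist_commute)
  have x0B: "x0 \<in> B" using r by (simp add: B_def)
  have G'0: "linear (G' x0)" using der[OF x0] has_derivative_linear by blast
  have lip: "dist (x - A (G x - y)) (x' - A (G x' - y)) \<le> 1 / 2 * dist x x'" if "x \<in> B" "x' \<in> B" for x x' y
  proof -
    have "norm (G x - G x' - G' x0 (x - x')) \<le> norm (x - x') * e"
    proof (rule differentiable_bound_linearization[where S = B])
      show "x' + t *\<^sub>R (x - x') \<in> B" if "t \<in> {0..1}" for t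
        using convexD_alt[of B x' x t] \<open>x \<in> B\<close> \<open>x' \<in> B\<close> that by (simp add: algebra_simps B_def)
      show "(G has_derivative G' z) (at z within B)" if "z \<in> B" for z
        using der[OF BW(1)[OF that]] by (rule has_derivative_at_withinI)
      show "onorm (G' z - G' x0) \<le> e" if "z \<in> B" for z
        by (rule onorm_bound) (use BW(2)[OF that] e in auto)
    qed (rule x0B)
    moreover have "(x - A (G x - y)) - (x' - A (G x' - y)) = - A (G x - G x' - G' x0 (x - x'))"
      unfolding A.diff A(2) by simp
    ultimately have "dist (x - A (G x - y)) (x' - A (G x' - y)) \<le> (norm (x - x') * e) * K"
      unfolding dist_norm using K(2)[of "G x - G x' - G' x0 (x - x')"] K(1)
      by (simp only: norm_minus_cancel) (meson less_imp_le mult_right_mono order_trans)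
    also have "\<dots> = 1 / 2 * dist x x'" using e(2) by (simp add: dist_norm mult_ac)
    finally show ?thesis .
  qed
  \<comment> \<open>For such \<open>y\<close> the iteration moves the centre by at most
    \<open>r / 2\<close>; with the Lipschitz constant 1/2 it therefore maps the ball into
    itself.\<close>
  define \<delta> where "\<delta> = r / (2 * K)"
  have "\<exists>x\<in>W. dist x x0 \<le> r0 \<and> G x = y" if y: "dist y (G x0) < \<delta>" for y
  proof -
    define \<Phi> where "\<Phi> = (\<lambda>x. x - A (G x - y))"
    have small: "dist (\<Phi> x0) x0 \<le> r / 2"
    proof -
      have "dist (\<Phi> x0) x0 = norm (A (G x0 - y))" by (simp add: \<Phi>_def dist_norm)
      also have "\<dots> \<le> norm (G x0 - y) * K" by (rule K(2))
      also have "\<dots> \<le> \<delta> * K" using y K(1) by (intro mult_right_mono) (auto simp: dist_norm norm_minus_commute)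
      also have "\<dots> = r / 2" using K(1) by (simp add: \<delta>_def)
      finally show ?thesis .
    qed
    have "\<exists>!x\<in>B. \<Phi> x = x"
    proof (rule Banach_fix[of B "1/2"])
      show "complete B" unfolding B_def by (simp add: complete_eq_closed)
      show "B \<noteq> {}" using x0B by blast
      show "dist (\<Phi> x) (\<Phi> x') \<le> 1 / 2 * dist x x'" if "x \<in> B" "x' \<in> B" for x x'
        unfolding \<Phi>_def by (rule lip[OF that])
      show "\<Phi> ` B \<subseteq> B"
      proof (rule image_subsetI)
        fix x assume x: "x \<in> B"
        have "dist (\<Phi> x) x0 \<le> dist (\<Phi> x) (\<Phi> x0) + dist (\<Phi> x0) x0" by (rule dist_triangle)
        also have "dist (\<Phi> x) (\<Phi> x0) \<le> 1 / 2 * dist x x0" unfolding \<Phi>_def by (rule lip[OF x x0B])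
        also have "dist x x0 \<le> r" using x by (simp add: B_def dist_commute)
        finally have "dist (\<Phi> x) x0 \<le> r" using small by simp
        then show "\<Phi> x \<in> B" by (simp add: B_def dist_commute)
      qed
    qed auto
    then obtain x where x: "x \<in> B" "\<Phi> x = x" by blast
    then have "A (G x - y) = 0" by (simp add: \<Phi>_def)
    then have "G x - y = G' x0 0" using A(3)[of "G x - y"] by simp
    then have "G x = y" using linear_0[OF G'0] by simp
    moreover have "dist x x0 \<le> r0" using x(1) r by (simp add: B_def dist_commute)
    ultimately show ?thesis using BW(1)[OF x(1)] by blast
  qed
  moreover have "\<delta> > 0" using r K by (simp add: \<delta>_def)
  ultimately show ?thesis by blast
qed

text \<open>What is known of an inverse \<open>H\<close> before it is shown to be differentiable: it
  is continuous, and \<open>A y\<close> inverts the derivative of the map at \<open>H y\<close>. The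
  values of \<open>A\<close> belong to the space of bounded linear maps, so that convergence of
  \<open>A\<close> means convergence in operator norm.\<close>

locale jet_inverse =
  fixes k :: nat and W V :: "'a::real_normed_vector set" and D :: "'a \<Rightarrow> 'a list \<Rightarrow> 'a"
    and H :: "'a \<Rightarrow> 'a" and A :: "'a \<Rightarrow> 'a \<Rightarrow>\<^sub>L 'a"
  assumes jet: "jet k W D" and k: "1 \<le> k" and openV: "open V"
    and HW: "y \<in> V \<Longrightarrow> H y \<in> W" and GH: "y \<in> V \<Longrightarrow> D (H y) [] = y"
    and H_tendsto: "y \<in> V \<Longrightarrow> (H \<longlongrightarrow> H y) (at y)"
    and AD: "y \<in> V \<Longrightarrow> A y (D (H y) [v]) = v" and DA: "y \<in> V \<Longrightarrow> D (H y) [A y v] = v"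
begin

lemma H_has_derivative:
  assumes y: "y \<in> V"
  shows "(H has_derivative A y) (at y)"
proof (rule has_derivative_inverse_basic[where f = "\<lambda>x. D x []" and f' = "\<lambda>v. D (H y) [v]" and T = V])
  show "((\<lambda>x. D x []) has_derivative (\<lambda>v. D (H y) [v])) (at (H y))"
    using jetD(4)[OF jet HW[OF y], of "[]"] k by simp
  show "blinfun_apply (A y) \<circ> (\<lambda>v. D (H y) [v]) = id" using AD[OF y] by auto
  show "continuous (at y) H" using H_tendsto[OF y] by (simp add: continuous_within)
qed (use openV y GH in \<open>auto intro: blinfun.bounded_linear_right\<close>)

lemma DH_continuous:
  assumes y: "y \<in> V" and "j \<le> k" "e > 0"
  shows "\<forall>\<^sub>F z in at y. multilinear_bound UNIV j (\<lambda>vs. D (H z) vs - D (H y) vs) e"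
  using eventually_compose_filterlim[OF jetD(5)[OF jet HW[OF y] assms(2,3)] H_tendsto[OF y]]
  by eventually_elim simp

text \<open>With first derivatives understood, \<open>A z - A y\<close> is minus the composition of
  \<open>A z\<close>, \<open>D (H z) - D (H y)\<close> and \<open>A y\<close>. The norm of
  \<open>A z\<close> on the right is not known beforehand; it is absorbed into the left-hand side,
  which gives \<open>norm (A z) \<le> 2 * C\<close> near \<open>y\<close>.\<close>

lemma A_tendsto:
  assumes y: "y \<in> V"
  shows "(A \<longlongrightarrow> A y) (at y)"
proof (rule tendstoI)
  fix e :: real assume e: "e > 0"
  define C where "C = norm (A y) + 1"
  have C: "C > 0" "norm (A y) \<le> C" by (auto simp: C_def add_nonneg_pos)
  \<comment> \<open>The first entry allows the absorption, the second makes the final estimate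
    \<open>e / 2\<close>.\<close>
  define e1 where "e1 = min (1 / (2 * C)) (e / (4 * C * C))"
  have e1: "e1 > 0" using e C by (simp add: e1_def)
  have e1C: "e1 * C \<le> 1 / 2"
  proof -
    have "e1 * C \<le> 1 / (2 * C) * C" using C by (intro mult_right_mono) (auto simp: e1_def)
    then show ?thesis using C by simp
  qed
  have e1CC: "2 * C * (e1 * C) < e"
  proof -
    have "2 * C * (e1 * C) \<le> 2 * C * (e / (4 * C * C) * C)"
      using C by (intro mult_left_mono mult_right_mono) (auto simp: e1_def)
    also have "\<dots> = e / 2" using C by simp
    also have "\<dots> < e" using e by simp
    finally show ?thesis .
  qed
  have "\<forall>\<^sub>F z in at y. z \<in> V" using openV y by (rule eventually_at_in_open')
  with DH_continuous[OF y k e1] show "\<forall>\<^sub>F z in at y. dist (A z) (A y) < e"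
  proof eventually_elim
    case (elim z)
    have le: "norm (A z - A y) \<le> norm (A z) * (e1 * C)"
    proof (rule norm_blinfun_bound)
      show "0 \<le> norm (A z) * (e1 * C)" using e1 C by simp
      fix w
      have lin: "linear (\<lambda>v. D (H z) [v])"
        using jetD(2)[OF jet HW[OF elim(2)] k] by (intro multilin_linear_Cons) auto
      have "(A z - A y) w = - A z (D (H z) [A y w] - D (H y) [A y w])"
        by (simp add: blinfun.bilinear_simps AD[OF elim(2)] DA[OF y])
      then have "norm ((A z - A y) w) \<le> norm (A z) * norm (D (H z) [A y w] - D (H y) [A y w])"
        by (simp add: norm_blinfun)
      also have "\<dots> \<le> norm (A z) * (e1 * norm (A y w))"
        using multilinear_boundD[OF elim(1), of "[A y w]"] by (intro mult_left_mono) auto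
      also have "\<dots> \<le> norm (A z) * (e1 * (C * norm w))"
      proof -
        have "norm (A y w) \<le> C * norm w"
          using norm_blinfun[of "A y" w] mult_right_mono[OF C(2), of "norm w"] by simp
        then show ?thesis using e1 by (intro mult_left_mono) auto
      qed
      finally show "norm ((A z - A y) w) \<le> norm (A z) * (e1 * C) * norm w" by (simp add: mult_ac)
    qed
    have "norm (A z) \<le> norm (A y) + norm (A z - A y)" by (metis add.commute diff_add_cancel norm_triangle_ineq)
    also have "norm (A z - A y) \<le> norm (A z) * (1 / 2)"
      using le mult_left_mono[OF e1C, of "norm (A z)"] by simp
    finally have "norm (A z) \<le> 2 * C" using C by simp
    then have "norm (A z) * (e1 * C) \<le> 2 * C * (e1 * C)" using e1 C by (intro mult_right_mono) auto
    then show ?case using le e1CC by (simp add: dist_norm)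
  qed
qed

text \<open>No derivative of \<open>A\<close> is taken. With \<open>p = A y (q y)\<close> held
  fixed, \<open>A z (q z) = p + A z (q z - D (H z) [p])\<close>, and the argument on the right
  vanishes at \<open>y\<close>, so continuity of \<open>A\<close> is enough. The second derivative
  of the map enters through \<open>D (H z) [p]\<close>.\<close>

lemma A_apply_has_derivative:
  assumes y: "y \<in> V" and "1 < k" and q: "(q has_derivative q') (at y)"
  shows "((\<lambda>z. A z (q z)) has_derivative (\<lambda>v. A y (q' v - D (H y) [A y v, A y (q y)]))) (at y)"
proof -
  define p where "p = A y (q y)"
  have "((\<lambda>z. D (H z) [p]) has_derivative (\<lambda>v. D (H y) [A y v, p])) (at y)"
    using has_derivative_compose[OF H_has_derivative[OF y] jetD(4)[OF jet HW[OF y], of "[p]"]] assms(2) by simp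
  then have r: "((\<lambda>z. q z - D (H z) [p]) has_derivative (\<lambda>v. q' v - D (H y) [A y v, p])) (at y)"
    by (rule has_derivative_diff[OF q])
  have "((\<lambda>z. A z (q z - D (H z) [p])) has_derivative (\<lambda>v. A y (q' v - D (H y) [A y v, p]))) (at y)"
  proof (rule has_derivative_apply_at_zero[OF r])
    show "q y - D (H y) [p] = 0" by (simp add: p_def DA[OF y])
    show "bounded_linear (blinfun_apply (A y))" by (rule blinfun.bounded_linear_right)
    fix e :: real assume "e > 0"
    from tendstoD[OF A_tendsto[OF y] this]
    show "\<forall>\<^sub>F z in at y. \<forall>x. norm (A z x - A y x) \<le> e * norm x"
    proof eventually_elim
      case (elim z)
      show ?case
      proof
        fix x
        have "norm ((A z - A y) x) \<le> norm (A z - A y) * norm x" by (rule norm_blinfun)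
        also have "\<dots> \<le> e * norm x" using elim by (intro mult_right_mono) (auto simp: dist_norm)
        finally show "norm (A z x - A y x) \<le> e * norm x" by (simp add: blinfun.diff_left)
      qed
    qed
  qed
  from has_derivative_add[OF has_derivative_const[of p] this]
  have "((\<lambda>z. p + A z (q z - D (H z) [p])) has_derivative (\<lambda>v. A y (q' v - D (H y) [A y v, p]))) (at y)"
    by simp
  then show ?thesis unfolding p_def[symmetric]
  proof (rule has_derivative_transform_within_open[OF _ openV y])
    show "p + A z (q z - D (H z) [p]) = A z (q z)" if "z \<in> V" for z
      by (simp add: blinfun.diff_right AD[OF that])
  qed
qed

end

section \<open>Higher derivatives of the inverse\<close>

datatype tree = Leaf nat | Node "tree list"

text \<open>
  A tree stands for a term of a higher derivative of the inverse \<^term>\<open>H\<close> of a map \<^term>\<open>G\<close>: a leaf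
  is \<open>H'\<close> applied to one of the directions, and a node is \<open>- H'\<close> applied to the derivative of \<open>G\<close>
  whose order is the number of children.  The instances of \<open>H'\<close> and of the derivatives of \<open>G\<close> (at
  the image under \<open>H\<close>) are given by \<open>A\<close> and \<open>B\<close>.
\<close>

primrec tree_eval :: "('a \<Rightarrow> 'a) \<Rightarrow> ('a list \<Rightarrow> 'a) \<Rightarrow> (nat \<Rightarrow> 'a) \<Rightarrow> tree \<Rightarrow> 'a::real_vector" where
  "tree_eval A B s (Leaf i) = A (s i)"
| "tree_eval A B s (Node ts) = - A (B (map (tree_eval A B s) ts))"

text \<open>
  The terms of the derivative of a tree in the new direction number \<open>n\<close>.  For a node \<open>- A b\<close>, the
  derivative of \<open>A\<close> contributes the first term, and those of the factors of \<open>b\<close> all others.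
\<close>

fun grow :: "nat \<Rightarrow> tree \<Rightarrow> tree list" and grow_list :: "nat \<Rightarrow> tree list \<Rightarrow> tree list list" where
  "grow n (Leaf i) = [Node [Leaf n, Leaf i]]"
| "grow n (Node ts) = Node [Leaf n, Node ts] # Node (Leaf n # ts) # map Node (grow_list n ts)"
| "grow_list n [] = []"
| "grow_list n (t # ts) = map (\<lambda>t'. t' # ts) (grow n t) @ map (\<lambda>ts'. t # ts') (grow_list n ts)"

text \<open>The terms of the derivative of order \<open>j\<close> of the inverse, with directions
  numbered in the order of differentiation. The list for order 0 is empty because \<open>H\<close>
  itself is no such term.\<close>

fun trees :: "nat \<Rightarrow> tree list" where
  "trees 0 = []"
| "trees (Suc 0) = [Leaf 0]"
| "trees (Suc (Suc j)) = concat (map (grow (Suc j)) (trees (Suc j)))"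

text \<open>Leaf numbers below \<open>j\<close> make the term independent of later directions; at
  most \<open>j\<close> children per node keep the derivatives of \<open>G\<close> within order
  \<open>j\<close>.\<close>

fun tree_ok :: "nat \<Rightarrow> tree \<Rightarrow> bool" where
  "tree_ok j (Leaf i) \<longleftrightarrow> i < j"
| "tree_ok j (Node ts) \<longleftrightarrow> length ts \<le> j \<and> (\<forall>t\<in>set ts. tree_ok j t)"

lemma tree_ok_Suc: "tree_ok j t \<Longrightarrow> tree_ok (Suc j) t"
  by (induction j t rule: tree_ok.induct) auto

text \<open>An existing node gains at most one child. A newly created node above a subtree has two
  children, which \<open>1 \<le> n\<close> makes admissible at \<open>Suc n\<close>.\<close>

lemma tree_ok_grow:
  "tree_ok n t \<Longrightarrow> 1 \<le> n \<Longrightarrow> t' \<in> set (grow n t) \<Longrightarrow> tree_ok (Suc n) t'"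
  "\<forall>t\<in>set ts. tree_ok n t \<Longrightarrow> 1 \<le> n \<Longrightarrow> ts' \<in> set (grow_list n ts) \<Longrightarrow>
     length ts' = length ts \<and> (\<forall>t'\<in>set ts'. tree_ok (Suc n) t')"
proof (induction n t and n ts arbitrary: t' and ts' rule: grow_grow_list.induct)
  case (1 n i)
  then show ?case by auto
next
  case (2 n ts)
  have ok: "tree_ok (Suc n) t" if "t \<in> set ts" for t using 2 that by (auto intro: tree_ok_Suc)
  from 2(4) consider "t' = Node [Leaf n, Node ts]" | "t' = Node (Leaf n # ts)"
    | ts' where "t' = Node ts'" "ts' \<in> set (grow_list n ts)" by auto
  then show ?case
  proof cases
    case 3
    then show ?thesis using 2(1)[of ts'] 2(2,3) by auto
  qed (use ok 2 in auto)
next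
  case (3 n)
  then show ?case by simp
next
  case (4 n t ts)
  from 4(5) consider t1 where "ts' = t1 # ts" "t1 \<in> set (grow n t)"
    | ts1 where "ts' = t # ts1" "ts1 \<in> set (grow_list n ts)" by auto
  then show ?case
  proof cases
    case 1
    then show ?thesis using 4(1)[of t1] 4(3,4) by (auto intro: tree_ok_Suc)
  next
    case 2
    then show ?thesis using 4(2)[of ts1] 4(3,4) by (auto intro: tree_ok_Suc)
  qed
qed

lemma tree_ok_trees: "t \<in> set (trees j) \<Longrightarrow> tree_ok j t"
proof (induction j arbitrary: t rule: trees.induct)
  case (3 j)
  then obtain t0 where "t0 \<in> set (trees (Suc j))" "t \<in> set (grow (Suc j) t0)" by auto
  then show ?case using tree_ok_grow(1) 3(1) by fastforce
qed auto

lemma tree_eval_cong: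
  "tree_ok j t \<Longrightarrow> (\<And>i. i < j \<Longrightarrow> s i = s' i) \<Longrightarrow> tree_eval A B s t = tree_eval A B s' t"
proof (induction t)
  case (Node ts)
  then have "map (tree_eval A B s) ts = map (tree_eval A B s') ts" by auto
  then show ?case by (simp only: tree_eval.simps)
qed auto

lemma linear_sum_list:
  assumes "linear f"
  shows "f (\<Sum>x\<leftarrow>xs. g x) = (\<Sum>x\<leftarrow>xs. f (g x))"
  by (induction xs) (simp_all add: linear_0[OF assms] linear_add[OF assms])

text \<open>\<open>grow_list\<close> changes one position at a time; linearity there pulls the sum
  over the grown trees into that slot.\<close>

lemma sum_list_grow_list:
  assumes "multilin (length ts) M"
  shows "(\<Sum>ts'\<leftarrow>grow_list n ts. M (map g ts')) =
    multilin_deriv M (map g ts) (map (\<lambda>t. \<Sum>t'\<leftarrow>grow n t. g t') ts)"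
  using assms
proof (induction ts arbitrary: M)
  case (Cons t ts)
  have lin: "linear (\<lambda>v. M (v # map g ts))" using Cons.prems by (intro multilin_linear_Cons) auto
  have "multilin (length ts) (\<lambda>zs. M (g t # zs))" using Cons.prems by (intro multilin_Cons) simp
  from Cons.IH[OF this] show ?case
    by (simp add: linear_sum_list[OF lin] o_def)
qed simp

lemma sum_list_map_concat: "(\<Sum>x\<leftarrow>concat (map g xs). f x) = (\<Sum>y\<leftarrow>xs. \<Sum>x\<leftarrow>g y. f x)"
  by (induction xs) auto

lemma sum_list_uminus: "(\<Sum>x\<leftarrow>xs. - f x) = - (\<Sum>x\<leftarrow>xs. f x :: 'b::ab_group_add)"
  by (induction xs) auto

context jet_inverse
begin

section \<open>Derivatives and continuity of the tree terms\<close>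

definition tree_term :: "(nat \<Rightarrow> 'a) \<Rightarrow> tree \<Rightarrow> 'a \<Rightarrow> 'a" where
  "tree_term s t y = tree_eval (A y) (D (H y)) s t"

lemma tree_term_Leaf: "tree_term s (Leaf i) y = A y (s i)"
  by (simp add: tree_term_def)

lemma tree_term_Node:
  "tree_term s (Node ts) y = A y (- D (H y) (map (\<lambda>t. tree_term s t y) ts))"
  by (simp add: tree_term_def blinfun.minus_right)

text \<open>The new direction gets the number \<open>j\<close>, on which \<open>t\<close> itself
  does not depend. For a node, differentiating \<open>A\<close> gives
  \<open>Node [Leaf j, Node ts]\<close>, differentiating the base point of \<open>D (H y)\<close>
  gives \<open>Node (Leaf j # ts)\<close>, and differentiating the arguments gives the trees from
  \<open>grow_list\<close>. As a node may have \<open>j\<close> children, the second kind may use a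
  derivative of order \<open>Suc j\<close>, available by \<open>j < k\<close>.\<close>

lemma tree_term_has_derivative:
  assumes y: "y \<in> V" and j: "1 \<le> j" "j < k"
  shows "tree_ok j t \<Longrightarrow>
    (tree_term s t has_derivative (\<lambda>v. \<Sum>t'\<leftarrow>grow j t. tree_term (s(j := v)) t' y)) (at y)"
proof (induction t)
  case (Leaf i)
  have "((\<lambda>z. A z (s i)) has_derivative (\<lambda>v. A y (0 - D (H y) [A y v, A y (s i)]))) (at y)"
    using j by (intro A_apply_has_derivative[OF y] has_derivative_const) auto
  moreover have "(\<Sum>t'\<leftarrow>grow j (Leaf i). tree_term (s(j := v)) t' y) = A y (0 - D (H y) [A y v, A y (s i)])" for v
    using Leaf by (simp add: tree_term_Node tree_term_Leaf)
  ultimately show ?case by (simp only: tree_term_Leaf[abs_def])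
next
  case (Node ts)
  let ?n = "length ts"
  let ?P = "\<lambda>z. map (\<lambda>t. tree_term s t z) ts"
  let ?d = "\<lambda>v. map (\<lambda>t. \<Sum>t'\<leftarrow>grow j t. tree_term (s(j := v)) t' y) ts"
  have n: "?n \<le> j" and ok: "\<And>t. t \<in> set ts \<Longrightarrow> tree_ok j t" using Node.prems by auto
  have same: "tree_term (s(j := v)) t z = tree_term s t z" if "tree_ok j t" for t v z
    unfolding tree_term_def by (rule tree_eval_cong[OF that]) simp
  have ml: "multilin ?n (D (H z))" if "z \<in> V" for z
    using jetD(2)[OF jet HW[OF that]] n j by simp
  obtain c where c: "c > 0" "multilinear_bound UNIV ?n (D (H y)) c"
    using jetD(3)[OF jet HW[OF y], of ?n] n j by auto
  have "((\<lambda>z. D (H z) (map (\<lambda>p. p z) (map (tree_term s) ts)) - D (H z) (map (\<lambda>p. p y) (map (tree_term s) ts)))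
     has_derivative (\<lambda>v. multilin_deriv (D (H y)) (map (\<lambda>p. p y) (map (tree_term s) ts))
       (map (\<lambda>p'. p' v) (map (\<lambda>t v. \<Sum>t'\<leftarrow>grow j t. tree_term (s(j := v)) t' y) ts)))) (at y)"
  proof (rule has_derivative_multilin[where S = V and c = c])
    show "list_all2 (\<lambda>p p'. (p has_derivative p') (at y)) (map (tree_term s) ts)
        (map (\<lambda>t v. \<Sum>t'\<leftarrow>grow j t. tree_term (s(j := v)) t' y) ts)"
      unfolding list.rel_map list_all2_same using Node.IH ok by blast
    show "\<forall>\<^sub>F z in at y. multilinear_bound UNIV (length (map (tree_term s) ts)) (\<lambda>vs. D (H z) vs - D (H y) vs) e"
      if "e > 0" for e
      using DH_continuous[OF y _ that, of ?n] n j by simp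
  qed (use openV y ml c in auto)
  then have 1: "((\<lambda>z. D (H z) (?P z) - D (H z) (?P y)) has_derivative
      (\<lambda>v. multilin_deriv (D (H y)) (?P y) (?d v))) (at y)"
    by (simp add: o_def)
  \<comment> \<open>The complement of the preceding derivative: here the arguments are frozen and
    the base point moves.\<close>
  have 2: "((\<lambda>z. D (H z) (?P y)) has_derivative (\<lambda>v. D (H y) (A y v # ?P y))) (at y)"
    using has_derivative_compose[OF H_has_derivative[OF y] jetD(4)[OF jet HW[OF y], of "?P y"]] n j by simp
  have "((\<lambda>z. - D (H z) (?P z)) has_derivative
      (\<lambda>v. - (multilin_deriv (D (H y)) (?P y) (?d v) + D (H y) (A y v # ?P y)))) (at y)"
    using has_derivative_minus[OF has_derivative_add[OF 1 2]] by simp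
  from A_apply_has_derivative[OF y _ this]
  have "((\<lambda>z. A z (- D (H z) (?P z))) has_derivative
      (\<lambda>v. A y (- (multilin_deriv (D (H y)) (?P y) (?d v) + D (H y) (A y v # ?P y)) -
         D (H y) [A y v, A y (- D (H y) (?P y))]))) (at y)"
    using j by simp
  moreover have "A y (- (multilin_deriv (D (H y)) (?P y) (?d v) + D (H y) (A y v # ?P y)) -
         D (H y) [A y v, A y (- D (H y) (?P y))]) = (\<Sum>t'\<leftarrow>grow j (Node ts). tree_term (s(j := v)) t' y)" for v
  proof -
    have P: "map (\<lambda>t. tree_term (s(j := v)) t y) ts = ?P y" using same ok by simp
    have "(\<Sum>ts'\<leftarrow>grow_list j ts. tree_term (s(j := v)) (Node ts') y) =
        (\<Sum>ts'\<leftarrow>grow_list j ts. A y (- D (H y) (map (\<lambda>t. tree_term (s(j := v)) t y) ts')))"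
      by (simp add: tree_term_Node)
    also have "\<dots> = A y (\<Sum>ts'\<leftarrow>grow_list j ts. - D (H y) (map (\<lambda>t. tree_term (s(j := v)) t y) ts'))"
      by (rule linear_sum_list[symmetric]) (rule bounded_linear.linear[OF blinfun.bounded_linear_right])
    also have "\<dots> = A y (- multilin_deriv (D (H y)) (?P y) (?d v))"
      by (simp only: sum_list_uminus sum_list_grow_list[OF ml[OF y]] P)
    finally have "(\<Sum>ts'\<leftarrow>grow_list j ts. tree_term (s(j := v)) (Node ts') y) =
        A y (- multilin_deriv (D (H y)) (?P y) (?d v))" .
    moreover have "tree_term (s(j := v)) (Node [Leaf j, Node ts]) y =
        A y (- D (H y) [A y v, A y (- D (H y) (?P y))])"
      by (simp add: tree_term_Node tree_term_Leaf P)
    moreover have "tree_term (s(j := v)) (Node (Leaf j # ts)) y = A y (- D (H y) (A y v # ?P y))"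
      by (simp add: tree_term_Node tree_term_Leaf P)
    ultimately show ?thesis
      by (simp add: o_def blinfun.bilinear_simps)
  qed
  ultimately show ?case
    by (simp only: tree_term_Node[abs_def])
qed

text \<open>\<open>S\<close> is a set of assignments of directions from the unit ball, so this
  amounts to boundedness and continuity in operator norm. Both are proved in one induction, since
  the uniform convergence at a node uses bounds for the limits of its children.\<close>

lemma tree_term_uniform:
  assumes y: "y \<in> V" and j: "j \<le> k" and S: "\<And>s i. s \<in> S \<Longrightarrow> i < j \<Longrightarrow> norm (s i) \<le> 1"
  shows "tree_ok j t \<Longrightarrow> (\<exists>c. \<forall>s\<in>S. norm (tree_term s t y) \<le> c) \<and>
     uniform_limit S (\<lambda>z s. tree_term s t z) (\<lambda>s. tree_term s t y) (at y)"
proof (induction t)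
  case (Leaf i)
  have 1: "norm (s i) \<le> 1" if "s \<in> S" for s using S that Leaf by simp
  have "norm (tree_term s (Leaf i) y) \<le> norm (A y)" if "s \<in> S" for s
    using norm_blinfun[of "A y" "s i"] mult_left_mono[OF 1[OF that], of "norm (A y)"]
    by (simp add: tree_term_Leaf)
  moreover have "uniform_limit S (\<lambda>z s. A z (s i)) (\<lambda>s. A y (s i)) (at y)"
  proof (rule uniform_limitI)
    fix e :: real assume "e > 0"
    from tendstoD[OF A_tendsto[OF y] this]
    show "\<forall>\<^sub>F z in at y. \<forall>s\<in>S. dist (A z (s i)) (A y (s i)) < e"
    proof eventually_elim
      case (elim z)
      have "dist (A z (s i)) (A y (s i)) \<le> norm (A z - A y) * 1" if "s \<in> S" for s
        using norm_blinfun[of "A z - A y" "s i"] mult_left_mono[OF 1[OF that], of "norm (A z - A y)"]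
        by (simp add: dist_norm blinfun.diff_left)
      then show ?case using elim by (fastforce simp: dist_norm)
    qed
  qed
  ultimately show ?case by (auto simp: tree_term_Leaf)
next
  case (Node ts)
  let ?n = "length ts"
  let ?P = "\<lambda>s z. map (\<lambda>t. tree_term s t z) ts"
  have n: "?n \<le> k" and ok: "\<And>t. t \<in> set ts \<Longrightarrow> tree_ok j t" using Node.prems j by auto
  have "\<forall>t\<in>set ts. \<exists>c. \<forall>s\<in>S. norm (tree_term s t y) \<le> c" using Node.IH ok by blast
  from bchoice[OF this] obtain c where c: "\<And>t s. t \<in> set ts \<Longrightarrow> s \<in> S \<Longrightarrow> norm (tree_term s t y) \<le> c t" by blast
  define R where "R = 1 + (\<Sum>t\<leftarrow>ts. \<bar>c t\<bar>)"
  have sn: "0 \<le> (\<Sum>t\<leftarrow>ts. \<bar>c t\<bar>)" by (rule sum_list_nonneg) auto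
  have R: "R \<ge> 1" using sn by (simp add: R_def)
  have cR: "norm (tree_term s t y) \<le> R - 1" if "t \<in> set ts" "s \<in> S" for t s
  proof -
    have "\<bar>c t\<bar> \<le> (\<Sum>t\<leftarrow>ts. \<bar>c t\<bar>)" using that by (intro member_le_sum_list) auto
    then show ?thesis using c[OF that] by (simp add: R_def)
  qed
  obtain C where C: "C > 0" "multilinear_bound UNIV ?n (D (H y)) C"
    using jetD(3)[OF jet HW[OF y] n] by blast
  have ml: "multilin ?n (D (H y))" using jetD(2)[OF jet HW[OF y] n] .
  have bq: "norm (D (H y) (?P s y)) \<le> C * R ^ ?n" if "s \<in> S" for s
  proof -
    have "norm (D (H y) (?P s y)) \<le> C * (\<Prod>v\<leftarrow>?P s y. norm v)"
      using C(2) by (rule multilinear_boundD) simp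
    also have "\<dots> \<le> C * R ^ length (?P s y)"
    proof (rule mult_left_mono[OF prod_list_norm_le])
      show "norm v \<le> R" if "v \<in> set (?P s y)" for v
        using that cR \<open>s \<in> S\<close> by fastforce
    qed (use C in simp)
    finally show ?thesis by simp
  qed
  have lim: "uniform_limit S (\<lambda>z s. D (H z) (?P s z)) (\<lambda>s. D (H y) (?P s y)) (at y)"
  proof (rule uniform_limitI)
    fix e :: real assume e: "e > 0"
    define K where "K = C * real ?n * R ^ ?n"
    have K: "K \<ge> 0" using R C by (simp add: K_def)
    define d where "d = min 1 (e / (4 * (K + 1)))"
    have d: "d > 0" "d \<le> 1" using e K by (auto simp: d_def)
    have e1: "e / (2 * R ^ ?n) > 0" using e R by simp
    have Kd: "K * d \<le> e / 4"
    proof -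
      have "K * d \<le> (K + 1) * (e / (4 * (K + 1)))"
        using K d by (intro mult_mono) (auto simp: d_def)
      also have "\<dots> = e / 4" using K by (simp add: field_simps)
      finally show ?thesis .
    qed
    have "\<forall>\<^sub>F z in at y. \<forall>s\<in>S. dist (tree_term s t z) (tree_term s t y) < d" if "t \<in> set ts" for t
      using uniform_limitD[OF conjunct2[OF Node.IH[OF that ok[OF that]]] d(1)] .
    then have "\<forall>\<^sub>F z in at y. \<forall>t\<in>set ts. \<forall>s\<in>S. dist (tree_term s t z) (tree_term s t y) < d"
      by (simp add: eventually_ball_finite)
    with DH_continuous[OF y n e1]
    show "\<forall>\<^sub>F z in at y. \<forall>s\<in>S. dist (D (H z) (?P s z)) (D (H y) (?P s y)) < e"
    proof eventually_elim
      case (elim z)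
      show ?case
      proof
        fix s assume s: "s \<in> S"
        have "norm (D (H z) (?P s z) - D (H y) (?P s y)) \<le>
            e / (2 * R ^ ?n) * R ^ ?n + C * real ?n * R ^ ?n * d"
        proof (rule multilinear_diff_le[OF ml C(2) _ elim(1)])
          have "norm (tree_term s t z) \<le> R \<and> norm (tree_term s t y) \<le> R \<and>
              norm (tree_term s t z - tree_term s t y) \<le> d" if "t \<in> set ts" for t
          proof -
            have "norm (tree_term s t z - tree_term s t y) < d"
              using elim(2) that s by (simp add: dist_norm)
            then show ?thesis
              using cR[OF that s] d norm_triangle_ineq2[of "tree_term s t z" "tree_term s t y"] by simp
          qed
          then show "list_all2 (\<lambda>a b. norm a \<le> R \<and> norm b \<le> R \<and> norm (a - b) \<le> d) (?P s z) (?P s y)"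
            by (simp add: list_all2_conv_all_nth)
        qed (use C R d less_imp_le[OF e] in auto)
        also have "\<dots> = e / 2 + K * d" using R by (simp add: K_def)
        also have "\<dots> < e" using Kd e by simp
        finally show "dist (D (H z) (?P s z)) (D (H y) (?P s y)) < e" by (simp add: dist_norm)
      qed
    qed
  qed
  have "norm (tree_term s (Node ts) y) \<le> norm (A y) * (C * R ^ ?n)" if "s \<in> S" for s
  proof -
    have "norm (tree_term s (Node ts) y) \<le> norm (A y) * norm (D (H y) (?P s y))"
      unfolding tree_term_Node using norm_blinfun[of "A y" "- D (H y) (?P s y)"] by simp
    also have "\<dots> \<le> norm (A y) * (C * R ^ ?n)" by (intro mult_left_mono bq that norm_ge_zero)
    finally show ?thesis .
  qed
  moreover have "uniform_limit S (\<lambda>z s. A z (- D (H z) (?P s z))) (\<lambda>s. A y (- D (H y) (?P s y))) (at y)"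
  proof (rule bounded_bilinear.bounded_uniform_limit[OF bounded_bilinear_blinfun_apply])
    show "uniform_limit S (\<lambda>z s. A z) (\<lambda>s. A y) (at y)"
      using A_tendsto[OF y] by (auto simp: uniform_limit_iff tendsto_iff)
    show "uniform_limit S (\<lambda>z s. - D (H z) (?P s z)) (\<lambda>s. - D (H y) (?P s y)) (at y)"
      using lim by (rule uniform_limit_uminus)
    show "bounded ((\<lambda>s. - D (H y) (?P s y)) ` S)"
      unfolding bounded_iff using bq by auto
    show "bounded ((\<lambda>s. A y) ` S)" by (rule bounded_subset[of "{A y}"]) auto
  qed
  ultimately show ?case unfolding tree_term_Node by blast
qed

text \<open>A new direction is put at the front of the list, while leaves number the directions in
  the order of differentiation; hence \<open>rev\<close>.\<close>

definition inverse_jet :: "'a \<Rightarrow> 'a list \<Rightarrow> 'a" where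
  "inverse_jet y vs = (if vs = [] then H y else \<Sum>t\<leftarrow>trees (length vs). tree_term (\<lambda>i. rev vs ! i) t y)"

lemma has_derivative_sum_list:
  assumes "\<And>t. t \<in> set ts \<Longrightarrow> (f t has_derivative f' t) F"
  shows "((\<lambda>z. \<Sum>t\<leftarrow>ts. f t z) has_derivative (\<lambda>v. \<Sum>t\<leftarrow>ts. f' t v)) F"
  using assms by (induction ts) (auto intro!: has_derivative_add)

lemma uniform_limit_sum_list:
  fixes f :: "'t \<Rightarrow> 'z \<Rightarrow> 's \<Rightarrow> 'c::real_normed_vector"
  assumes "\<And>t. t \<in> set ts \<Longrightarrow> uniform_limit S (f t) (l t) F"
  shows "uniform_limit S (\<lambda>z s. \<Sum>t\<leftarrow>ts. f t z s) (\<lambda>s. \<Sum>t\<leftarrow>ts. l t s) F"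
  using assms
proof (induction ts)
  case (Cons t ts)
  have "uniform_limit S (\<lambda>z s. f t z s + (\<Sum>t\<leftarrow>ts. f t z s)) (\<lambda>s. l t s + (\<Sum>t\<leftarrow>ts. l t s)) F"
    by (intro uniform_limit_add Cons) auto
  then show ?case by simp
qed (simp add: uniform_limit_const)

lemma jet_inverse_jet: "jet k V inverse_jet"
proof (rule jetI[OF openV])
  fix y and vs :: "'a list" assume y: "y \<in> V" and len: "length vs < k"
  show "((\<lambda>w. inverse_jet w vs) has_derivative (\<lambda>v. inverse_jet y (v # vs))) (at y)"
  proof (cases vs)
    case Nil
    then show ?thesis using H_has_derivative[OF y] by (simp add: inverse_jet_def tree_term_Leaf)
  next
    case (Cons a vs')
    define j where "j = length vs"
    then obtain i where i: "j = Suc i" using Cons by simp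
    let ?s = "\<lambda>i. rev vs ! i"
    have ok: "tree_ok j t" if "t \<in> set (trees j)" for t using tree_ok_trees[OF that] .
    have "((\<lambda>w. \<Sum>t\<leftarrow>trees j. tree_term ?s t w) has_derivative
        (\<lambda>v. \<Sum>t\<leftarrow>trees j. \<Sum>t'\<leftarrow>grow j t. tree_term (?s(j := v)) t' y)) (at y)"
    proof (rule has_derivative_sum_list)
      show "(tree_term ?s t has_derivative (\<lambda>v. \<Sum>t'\<leftarrow>grow j t. tree_term (?s(j := v)) t' y)) (at y)"
        if "t \<in> set (trees j)" for t
        using tree_term_has_derivative[OF y _ _ ok[OF that]] len i by (simp add: j_def)
    qed
    moreover have "(\<Sum>t\<leftarrow>trees j. \<Sum>t'\<leftarrow>grow j t. tree_term (?s(j := v)) t' y) = inverse_jet y (v # vs)" for v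
    proof -
      \<comment> \<open>The two assignments may differ beyond index \<open>j\<close>, but a tree for
        order \<open>Suc j\<close> reads no such index.\<close>
      have eq: "tree_term (?s(j := v)) t' y = tree_term (\<lambda>i. rev (v # vs) ! i) t' y"
        if "t' \<in> set (trees (Suc j))" for t'
        unfolding tree_term_def
        by (rule tree_eval_cong[OF tree_ok_trees[OF that]]) (auto simp: j_def nth_append less_Suc_eq)
      have "inverse_jet y (v # vs) = (\<Sum>t'\<leftarrow>trees (Suc j). tree_term (?s(j := v)) t' y)"
        unfolding inverse_jet_def using eq by (auto simp: j_def cong: map_cong)
      also have "\<dots> = (\<Sum>t\<leftarrow>trees j. \<Sum>t'\<leftarrow>grow j t. tree_term (?s(j := v)) t' y)"
        by (simp add: i sum_list_map_concat)
      finally show ?thesis by simp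
    qed
    moreover have "inverse_jet w vs = (\<Sum>t\<leftarrow>trees j. tree_term ?s t w)" for w
      using Cons by (simp add: inverse_jet_def j_def)
    ultimately show ?thesis by simp
  qed
next
  fix y j assume y: "y \<in> V" and j: "j \<le> k"
  define S where "S = (\<lambda>vs i. rev vs ! i) ` (unit_lists j :: 'a list set)"
  have S: "norm (s i) \<le> 1" if "s \<in> S" "i < j" for s i
  proof -
    obtain vs where vs: "vs \<in> unit_lists j" "s = (\<lambda>i. rev vs ! i)" using \<open>s \<in> S\<close> by (auto simp: S_def)
    then have "s i \<in> set vs" using \<open>i < j\<close> by (metis (mono_tags, lifting) length_rev mem_Collect_eq nth_mem set_rev unit_lists_def)
    then show ?thesis using vs by (simp add: unit_lists_def)
  qed
  have U: "(\<exists>c. \<forall>s\<in>S. norm (tree_term s t y) \<le> c) \<and>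
      uniform_limit S (\<lambda>z s. tree_term s t z) (\<lambda>s. tree_term s t y) (at y)" if "t \<in> set (trees j)" for t
    by (rule tree_term_uniform[OF y j _ tree_ok_trees[OF that]]) (rule S)
  show "\<exists>c. \<forall>vs\<in>unit_lists j. norm (inverse_jet y vs) \<le> c"
  proof (cases j)
    case 0
    then show ?thesis by (auto simp: unit_lists_def)
  next
    case (Suc i)
    have "\<forall>t\<in>set (trees j). \<exists>c. \<forall>s\<in>S. norm (tree_term s t y) \<le> c" using U by blast
    from bchoice[OF this] obtain c where c: "\<And>t s. t \<in> set (trees j) \<Longrightarrow> s \<in> S \<Longrightarrow> norm (tree_term s t y) \<le> c t" by blast
    have "norm (inverse_jet y vs) \<le> (\<Sum>t\<leftarrow>trees j. c t)" if vs: "vs \<in> unit_lists j" for vs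
    proof -
      have "norm (\<Sum>t\<leftarrow>ts. tree_term (\<lambda>i. rev vs ! i) t y) \<le> (\<Sum>t\<leftarrow>ts. c t)" if "set ts \<subseteq> set (trees j)" for ts
        using that
      proof (induction ts)
        case (Cons t ts)
        have "norm (tree_term (\<lambda>i. rev vs ! i) t y) \<le> c t" using Cons.prems vs by (intro c) (auto simp: S_def)
        then show ?case using Cons by (auto intro!: order_trans[OF norm_triangle_ineq] add_mono)
      qed simp
      then show ?thesis using vs Suc by (auto simp: inverse_jet_def unit_lists_def)
    qed
    then show ?thesis by blast
  qed
  show "uniform_limit (unit_lists j) inverse_jet (inverse_jet y) (at y)"
  proof (cases j)
    case 0
    then show ?thesis using H_tendsto[OF y]
      by (auto simp: unit_lists_def inverse_jet_def uniform_limit_iff tendsto_iff)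
  next
    case (Suc i)
    have "uniform_limit S (\<lambda>z s. \<Sum>t\<leftarrow>trees j. tree_term s t z) (\<lambda>s. \<Sum>t\<leftarrow>trees j. tree_term s t y) (at y)"
      using U by (intro uniform_limit_sum_list) blast
    then have "uniform_limit (unit_lists j) (\<lambda>z vs. \<Sum>t\<leftarrow>trees j. tree_term (\<lambda>i. rev vs ! i) t z)
       (\<lambda>vs. \<Sum>t\<leftarrow>trees j. tree_term (\<lambda>i. rev vs ! i) t y) (at y)"
      by (simp add: uniform_limit_iff S_def)
    moreover have "inverse_jet z vs = (\<Sum>t\<leftarrow>trees j. tree_term (\<lambda>i. rev vs ! i) t z)" if "vs \<in> unit_lists j" for z vs
      using that Suc by (auto simp: inverse_jet_def unit_lists_def)
    ultimately show ?thesis by (simp add: uniform_limit_iff)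
  qed
qed

end

text \<open>Injectivity on all of \<open>W\<close> gives one inverse on the whole image. Local
  surjectivity does the rest: a ball around \<open>G x\<close> is covered by the images of points of
  \<open>W\<close> as close to \<open>x\<close> as desired, so the image is open and the inverse is
  continuous.\<close>

theorem Ck_on_inverse:
  fixes G :: "'a::banach \<Rightarrow> 'a"
  assumes jet: "jet k W D" and k: "1 \<le> k" and DG: "\<And>x. x \<in> W \<Longrightarrow> D x [] = G x"
    and inj: "inj_on G W"
    and inv: "\<And>x. x \<in> W \<Longrightarrow> \<exists>A. bounded_linear A \<and> (\<forall>v. A (D x [v]) = v) \<and> (\<forall>v. D x [A v] = v)"
  shows "Ck_on UNIV k (G ` W) (inv_into W G)"
proof -
  define H where "H = inv_into W G"
  have HG: "H (G x) = x" if "x \<in> W" for x using inj that by (simp add: H_def)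
  have W: "open W" using jet by (rule jetD(1))
  have der: "(G has_derivative (\<lambda>v. D x [v])) (at x)" if x: "x \<in> W" for x
  proof (rule has_derivative_transform_within_open[OF _ W x])
    show "((\<lambda>w. D w []) has_derivative (\<lambda>v. D x [v])) (at x)"
      using jetD(4)[OF jet x, of "[]"] k by simp
  qed (rule DG)
  have cont: "\<forall>\<^sub>F w in nhds x. \<forall>v. norm (D w [v] - D x [v]) \<le> e * norm v" if x: "x \<in> W" and "e > 0" for x e
    using jetD(5)[OF jet x k \<open>e > 0\<close>]
  proof eventually_elim
    case (elim w)
    show ?case
      using multilinear_boundD[OF conjunct2[OF elim], of "[v]" for v] by simp
  qed
  have surj: "\<exists>\<delta>>0. \<forall>y. dist y (G x) < \<delta> \<longrightarrow> (\<exists>x'\<in>W. dist x' x \<le> r \<and> G x' = y)" if x: "x \<in> W" and r: "r > 0" for x r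
  proof -
    obtain A where "bounded_linear A" "\<And>v. A (D x [v]) = v" "\<And>v. D x [A v] = v" using inv[OF x] by blast
    from local_surjectivity[OF W x der cont[OF x] this r] show ?thesis by simp
  qed
  have o: "open (G ` W)"
    unfolding open_dist
  proof (clarify)
    fix x assume "x \<in> W"
    from surj[OF this zero_less_one] show "\<exists>e>0. \<forall>y. dist y (G x) < e \<longrightarrow> y \<in> G ` W" by blast
  qed
  have "\<forall>x. \<exists>A. x \<in> W \<longrightarrow> bounded_linear A \<and> (\<forall>v. A (D x [v]) = v) \<and> (\<forall>v. D x [A v] = v)" using inv by blast
  from choice[OF this] obtain A where
    A: "\<And>x. x \<in> W \<Longrightarrow> bounded_linear (A x) \<and> (\<forall>v. A x (D x [v]) = v) \<and> (\<forall>v. D x [A x v] = v)" by blast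
  have HW: "H y \<in> W" "G (H y) = y" if "y \<in> G ` W" for y
    using that by (auto simp: H_def inv_into_into f_inv_into_f)
  interpret jet_inverse k W "G ` W" D H "\<lambda>y. Blinfun (A (H y))"
  proof
    fix y assume y: "y \<in> G ` W"
    show "H y \<in> W" by (rule HW(1)[OF y])
    show "D (H y) [] = y" using DG[OF HW(1)[OF y]] HW(2)[OF y] by simp
    show "(H \<longlongrightarrow> H y) (at y)"
    proof (rule tendstoI)
      fix e :: real assume e: "e > 0"
      obtain \<delta> where \<delta>: "\<delta> > 0" "\<And>z. dist z y < \<delta> \<Longrightarrow> \<exists>x'\<in>W. dist x' (H y) \<le> e / 2 \<and> G x' = z"
        using surj[OF HW(1)[OF y], of "e / 2"] e HW(2)[OF y] by auto
      have "dist (H z) (H y) < e" if "dist z y < \<delta>" for z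
      proof -
        obtain x' where "x' \<in> W" "dist x' (H y) \<le> e / 2" "G x' = z" using \<delta>(2)[OF \<open>dist z y < \<delta>\<close>] by blast
        then show ?thesis using HG[of x'] e by auto
      qed
      then show "\<forall>\<^sub>F z in at y. dist (H z) (H y) < e" unfolding eventually_at using \<delta>(1) by blast
    qed
    note AH = A[OF HW(1)[OF y]]
    show "Blinfun (A (H y)) (D (H y) [v]) = v" "D (H y) [Blinfun (A (H y)) v] = v" for v
      using AH by (simp_all add: bounded_linear_Blinfun_apply)
  qed (use jet k o in auto)
  have "Ck_on UNIV k (G ` W) H"
    using jet_inverse_jet by (rule jet_imp_Ck_on_UNIV) (simp add: inverse_jet_def)
  then show ?thesis by (simp add: H_def)
qed

section \<open>Volterra operators\<close>

instance bcontfun :: (metric_space, banach) banach ..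

text \<open>The inverse is the sum of the powers of \<open>K\<close>. Only the powers have to decay,
  with an arbitrary constant \<open>C\<close>, so \<open>K\<close> itself may have a large
  norm.\<close>

lemma neumann_series_inverse:
  fixes K :: "'a::banach \<Rightarrow> 'a"
  assumes "bounded_linear K" and C: "\<And>n v. norm ((K ^^ n) v) \<le> C * (1 / 2) ^ n * norm v"
  shows "\<exists>A. bounded_linear A \<and> (\<forall>v. A (v - K v) = v) \<and> (\<forall>v. A v - K (A v) = v)"
proof -
  interpret K: bounded_linear K by fact
  have half: "summable (\<lambda>n. (1 / 2 :: real) ^ n)" "(\<Sum>n. (1 / 2 :: real) ^ n) = 2"
    using geometric_sums[of "1 / 2 :: real"] by (auto simp: sums_iff)
  have major: "summable (\<lambda>n. C * (1 / 2) ^ n * norm v)" for v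
    by (intro summable_mult summable_mult2 half)
  have sn: "summable (\<lambda>n. norm ((K ^^ n) v))" for v
    by (rule summable_comparison_test[OF _ major[of v]]) (use C in auto)
  then have s: "summable (\<lambda>n. (K ^^ n) v)" for v by (rule summable_norm_cancel)
  define A where "A v = (\<Sum>n. (K ^^ n) v)" for v
  have Kn: "linear (K ^^ n)" for n
  proof (induction n)
    case (Suc n)
    from linear_compose[OF this K.linear] show ?case by (simp only: funpow.simps)
  qed (simp only: funpow.simps linear_id)
  have A_lin: "linear A"
  proof
    show "A (v + w) = A v + A w" for v w
      unfolding A_def by (simp add: linear_add[OF Kn] suminf_add[OF s s])
    show "A (c *\<^sub>R v) = c *\<^sub>R A v" for c v
      unfolding A_def by (simp add: linear_scale[OF Kn] suminf_scaleR_right[OF s])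
  qed
  have "norm (A v) \<le> norm v * (C * 2)" for v
  proof -
    have "norm (A v) \<le> (\<Sum>n. norm ((K ^^ n) v))" unfolding A_def by (rule summable_norm[OF sn])
    also have "\<dots> \<le> (\<Sum>n. C * (1 / 2) ^ n * norm v)" by (intro suminf_le C sn major)
    also have "\<dots> = C * 2 * norm v"
      using half by (simp add: suminf_mult suminf_mult2[symmetric] summable_mult)
    finally show ?thesis by (simp add: mult_ac)
  qed
  with A_lin have bl: "bounded_linear A"
    unfolding bounded_linear_def bounded_linear_axioms_def by blast
  have head: "A v = v + (\<Sum>n. (K ^^ Suc n) v)" for v
    unfolding A_def using suminf_split_head[OF s[of v]] by simp
  have "A (K v) = (\<Sum>n. (K ^^ Suc n) v)" for v
    unfolding A_def by (simp add: funpow_swap1)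
  then have "A (v - K v) = v" for v using head[of v] linear_diff[OF A_lin, of v "K v"] by simp
  moreover have KA: "K (A v) = (\<Sum>n. (K ^^ Suc n) v)" for v
    unfolding A_def using K.suminf[OF s[of v]] by simp
  have "A v - K (A v) = v" for v unfolding KA by (subst head) simp
  ultimately show ?thesis using bl by blast
qed

lemma clamp_real: "a \<le> b \<Longrightarrow> clamp a b (x :: real) = max a (min b x)"
  unfolding clamp_def Basis_real_def inner_real_def by auto

lemma apply_Bcontfun_ext_cont:
  fixes g :: "real \<Rightarrow> 'b::metric_space"
  assumes "continuous_on {a..b} g"
  shows "apply_bcontfun (Bcontfun (ext_cont g a b)) t = g (clamp a b t)"
proof -
  have "continuous_on (cbox a b) g" using assms by simp
  then obtain u :: "real \<Rightarrow>\<^sub>C 'b" where "\<And>s. apply_bcontfun u s = g (clamp a b s)"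
    using continuous_on_cbox_bcontfunE by blast
  then have "ext_cont g a b = apply_bcontfun u" by (simp add: ext_cont_def fun_eq_iff)
  then show ?thesis by (metis apply_bcontfun_inverse ext_cont_def)
qed

text \<open>For \<open>a \<ge> 0\<close>, a primitive that vanishes before 0 and is constant after
  \<open>a\<close>: it is bounded, and adding it does not change initial values.\<close>

definition volterra :: "real \<Rightarrow> (real \<Rightarrow>\<^sub>C 'b) \<Rightarrow> real \<Rightarrow>\<^sub>C 'b::euclidean_space" where
  "volterra a q = Bcontfun (ext_cont (\<lambda>t. integral {0..t} (apply_bcontfun q)) 0 a)"

lemma integrable_bcontfun: "apply_bcontfun q integrable_on {s..t::real}"
  for q :: "real \<Rightarrow>\<^sub>C 'b::euclidean_space"
  by (intro integrable_continuous_interval continuous_on_apply_bcontfun)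

lemma apply_volterra: "apply_bcontfun (volterra a q) t = integral {0..clamp 0 a t} (apply_bcontfun q)"
  unfolding volterra_def
  by (intro apply_Bcontfun_ext_cont indefinite_integral_continuous_1 integrable_bcontfun)

lemma clamp_0_le: "0 \<le> a \<Longrightarrow> 0 \<le> clamp 0 a (t::real)" "0 \<le> a \<Longrightarrow> clamp 0 a (t::real) \<le> a"
  by (auto simp: clamp_real)

lemma bounded_linear_volterra:
  assumes "0 \<le> a"
  shows "bounded_linear (volterra a :: (real \<Rightarrow>\<^sub>C 'b::euclidean_space) \<Rightarrow> _)"
proof
  fix q r :: "real \<Rightarrow>\<^sub>C 'b" and c :: real
  show "volterra a (q + r) = volterra a q + volterra a r"
    by (rule bcontfun_eqI) (simp add: apply_volterra integral_add integrable_bcontfun)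
  show "volterra a (c *\<^sub>R q) = c *\<^sub>R volterra a q"
    by (rule bcontfun_eqI) (simp add: apply_volterra)
  show "\<exists>K. \<forall>q :: real \<Rightarrow>\<^sub>C 'b. norm (volterra a q) \<le> norm q * K"
  proof (intro exI allI norm_bound)
    fix q :: "real \<Rightarrow>\<^sub>C 'b" and t
    have "norm (volterra a q t) \<le> norm q * (clamp 0 a t - 0)"
      unfolding apply_volterra
      by (rule integral_bound) (use clamp_0_le[OF assms] norm_bounded in auto)
    also have "\<dots> \<le> norm q * a" using clamp_0_le[OF assms] by (intro mult_left_mono) auto
    finally show "norm (volterra a q t) \<le> norm q * a" .
  qed
qed

text \<open>The weight \<^term>\<open>exp (2 * c * s)\<close> makes the Volterra operator a contraction with factor \<open>1/2\<close>.\<close>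

lemma norm_volterra_weighted:
  fixes q :: "real \<Rightarrow>\<^sub>C 'b::euclidean_space"
  assumes a: "0 \<le> a" and c: "0 < c" and m: "0 \<le> m"
    and q: "\<And>s. s \<in> {0..a} \<Longrightarrow> norm (q s) \<le> c * (m * exp (2 * c * s))"
  shows "norm (volterra a q t) \<le> m / 2 * exp (2 * c * clamp 0 a t)"
proof -
  define \<tau> where "\<tau> = clamp 0 a t"
  have \<tau>: "0 \<le> \<tau>" "\<tau> \<le> a" using clamp_0_le[OF a] by (auto simp: \<tau>_def)
  \<comment> \<open>The rate \<open>2 * c\<close> in the exponent against the factor
    \<open>c\<close> produces the 1/2.\<close>
  have "((\<lambda>s. c * (m * exp (2 * c * s))) has_integral (m / 2 * exp (2 * c * \<tau>) - m / 2 * exp (2 * c * 0))) {0..\<tau>}"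
    by (rule fundamental_theorem_of_calculus[OF \<tau>(1)])
      (auto intro!: derivative_eq_intros simp: has_real_derivative_iff_has_vector_derivative[symmetric])
  then have i: "(\<lambda>s. c * (m * exp (2 * c * s))) integrable_on {0..\<tau>}"
      "integral {0..\<tau>} (\<lambda>s. c * (m * exp (2 * c * s))) = m / 2 * exp (2 * c * \<tau>) - m / 2"
    by (auto simp: has_integral_iff)
  have "norm (volterra a q t) \<le> integral {0..\<tau>} (\<lambda>s. c * (m * exp (2 * c * s)))"
    unfolding apply_volterra \<tau>_def[symmetric]
    by (rule integral_norm_bound_integral[OF integrable_bcontfun i(1)]) (use q \<tau> in auto)
  then show ?thesis using i(2) m by (simp add: \<tau>_def)
qed

section \<open>Segments\<close>

lemma apply_segment:
  assumes "continuous_on {s - h..s} x"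
  shows "apply_bcontfun (segment h x s) r = x (s + clamp (- h) 0 r)"
proof -
  have "continuous_on {-h..0} (\<lambda>r. x (s + r))"
    by (rule continuous_on_compose2[OF assms]) (auto intro!: continuous_intros)
  from apply_Bcontfun_ext_cont[OF this] show ?thesis by (simp add: segment_def)
qed

text \<open>
  Kept opaque, since the simplifier would otherwise distribute \<^const>\<open>apply_bcontfun\<close> over sums below
  \<^const>\<open>segment\<close>.
\<close>

definition bsegment :: "real \<Rightarrow> (real \<Rightarrow>\<^sub>C 'b::metric_space) \<Rightarrow> real \<Rightarrow> (real \<Rightarrow>\<^sub>C 'b)" where
  "bsegment h x s = segment h (apply_bcontfun x) s"

lemma apply_bsegment [simp]: "apply_bcontfun (bsegment h x s) r = x (s + clamp (- h) 0 r)"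
  unfolding bsegment_def by (intro apply_segment continuous_on_apply_bcontfun)

lemma norm_bsegment_le: "norm (bsegment h x s) \<le> norm x"
  for x :: "real \<Rightarrow>\<^sub>C 'b::real_normed_vector"
  by (rule norm_bound) (simp add: norm_bounded)

lemma bounded_linear_bsegment: "bounded_linear (\<lambda>x :: real \<Rightarrow>\<^sub>C 'b::real_normed_vector. bsegment h x s)"
proof
  show "bsegment h (x + y) s = bsegment h x s + bsegment h y s"
    for x y :: "real \<Rightarrow>\<^sub>C 'b" by (rule bcontfun_eqI) simp
  show "bsegment h (c *\<^sub>R x) s = c *\<^sub>R bsegment h x s"
    for c and x :: "real \<Rightarrow>\<^sub>C 'b" by (rule bcontfun_eqI) simp
  show "\<exists>K. \<forall>x :: real \<Rightarrow>\<^sub>C 'b. norm (bsegment h x s) \<le> norm x * K"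
    by (rule exI[of _ 1]) (simp add: norm_bsegment_le)
qed

lemmas linear_bsegment = bounded_linear.linear[OF bounded_linear_bsegment]
lemmas bsegment_add = linear_add[OF linear_bsegment]
  and bsegment_scaleR = linear_scale[OF linear_bsegment]
  and bsegment_diff = linear_diff[OF linear_bsegment]

text \<open>Uniform continuity of \<open>x\<close> on the compact interval turns a small shift in
  time into a small change in the supremum norm.\<close>

lemma continuous_on_segment:
  fixes x :: "real \<Rightarrow> 'b::metric_space"
  assumes h: "0 \<le> h" and x: "continuous_on {-h..a} x"
  shows "continuous_on {0..a} (segment h x)"
  unfolding continuous_on_iff
proof (intro ballI allI impI)
  fix s and e :: real assume s: "s \<in> {0..a}" and e: "e > 0"
  have "uniformly_continuous_on {-h..a} x" using x by (intro compact_uniformly_continuous) auto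
  then obtain d where d: "d > 0"
    "\<And>p q. p \<in> {-h..a} \<Longrightarrow> q \<in> {-h..a} \<Longrightarrow> dist p q < d \<Longrightarrow> dist (x p) (x q) < e / 2"
    unfolding uniformly_continuous_on_def using e by (metis half_gt_zero dist_commute)
  have app: "segment h x t r = x (t + clamp (-h) 0 r)" if "t \<in> {0..a}" for t r
    by (rule apply_segment) (rule continuous_on_subset[OF x], use that in auto)
  have "dist (segment h x s') (segment h x s) < e" if s': "s' \<in> {0..a}" "dist s' s < d" for s'
  proof -
    have "dist (segment h x s') (segment h x s) \<le> e / 2"
    proof (rule dist_bound)
      fix r
      show "dist (segment h x s' r) (segment h x s r) \<le> e / 2"
        unfolding app[OF s] app[OF s'(1)]
        by (rule less_imp_le, rule d(2)) (use s s' h in \<open>auto simp: clamp_real dist_real_def\<close>)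
    qed
    then show ?thesis using e by simp
  qed
  then show "\<exists>d>0. \<forall>s'\<in>{0..a}. dist s' s < d \<longrightarrow> dist (segment h x s') (segment h x s) < e"
    using d(1) by blast
qed

lemma continuous_on_bsegment: "0 \<le> h \<Longrightarrow> continuous_on {0..a} (bsegment h x)"
  using continuous_on_segment[of h a "apply_bcontfun x"]
  by (simp add: bsegment_def[abs_def])

section \<open>The fixed point equation\<close>

lemma le_sum_list_map:
  fixes f :: "'a \<Rightarrow> real"
  assumes "x \<in> set xs" "\<And>y. 0 \<le> f y"
  shows "f x \<le> (\<Sum>y\<leftarrow>xs. f y)"
  using assms(1)
proof (induction xs)
  case (Cons y ys)
  have "0 \<le> (\<Sum>y\<leftarrow>ys. f y)" by (rule sum_list_nonneg) (use assms(2) in auto)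
  then show ?case using Cons assms(2)[of y] by auto
qed simp

lemma tendsto_multilin:
  fixes M :: "'c \<Rightarrow> 'a::real_normed_vector list \<Rightarrow> 'b::real_normed_vector"
  assumes ml: "multilin (length ps) N" and bd: "multilinear_bound UNIV (length ps) N c" and c: "c \<ge> 0"
    and op: "\<And>e. e > 0 \<Longrightarrow> \<forall>\<^sub>F z in F. multilinear_bound UNIV (length ps) (\<lambda>vs. M z vs - N vs) e"
    and ps: "\<And>p. p \<in> set ps \<Longrightarrow> ((\<lambda>z. g z p) \<longlongrightarrow> l p) F"
  shows "((\<lambda>z. M z (map (g z) ps)) \<longlongrightarrow> N (map l ps)) F"
proof (rule tendstoI)
  fix e :: real assume e: "e > 0"
  let ?n = "length ps"
  define R where "R = 1 + (\<Sum>p\<leftarrow>ps. norm (l p))"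
  have "0 \<le> (\<Sum>p\<leftarrow>ps. norm (l p))" by (rule sum_list_nonneg) auto
  then have R: "R \<ge> 1" by (simp add: R_def)
  have lR: "norm (l p) \<le> R - 1" if "p \<in> set ps" for p
    using le_sum_list_map[OF that, of "\<lambda>p. norm (l p)"] by (simp add: R_def)
  define K where "K = c * real ?n * R ^ ?n"
  have K: "K \<ge> 0" using R c by (simp add: K_def)
  define d where "d = min 1 (e / (4 * (K + 1)))"
  have d: "d > 0" "d \<le> 1" using e K by (auto simp: d_def)
  have e1: "e / (2 * R ^ ?n) > 0" using e R by simp
  have Kd: "K * d \<le> e / 4"
  proof -
    have "K * d \<le> (K + 1) * (e / (4 * (K + 1)))"
      using K d by (intro mult_mono) (auto simp: d_def)
    also have "\<dots> = e / 4" using K by (simp add: field_simps)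
    finally show ?thesis .
  qed
  have "\<forall>\<^sub>F z in F. dist (g z p) (l p) < d" if "p \<in> set ps" for p using tendstoD[OF ps[OF that] d(1)] .
  then have "\<forall>\<^sub>F z in F. \<forall>p\<in>set ps. dist (g z p) (l p) < d" by (simp add: eventually_ball_finite)
  with op[OF e1] show "\<forall>\<^sub>F z in F. dist (M z (map (g z) ps)) (N (map l ps)) < e"
  proof eventually_elim
    case (elim z)
    have "norm (M z (map (g z) ps) - N (map l ps)) \<le>
        e / (2 * R ^ ?n) * R ^ ?n + c * real ?n * R ^ ?n * d"
    proof (rule multilinear_diff_le[OF ml bd c elim(1)])
      have "norm (g z p) \<le> R \<and> norm (l p) \<le> R \<and> norm (g z p - l p) \<le> d" if "p \<in> set ps" for p
      proof -
        have "norm (g z p - l p) < d" using elim(2) that by (simp add: dist_norm)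
        then show ?thesis using lR[OF that] d norm_triangle_ineq2[of "g z p" "l p"] by simp
      qed
      then show "list_all2 (\<lambda>a b. norm a \<le> R \<and> norm b \<le> R \<and> norm (a - b) \<le> d) (map (g z) ps) (map l ps)"
        by (simp add: list_all2_conv_all_nth)
    qed (use R d less_imp_le[OF e] in auto)
    also have "\<dots> = e / 2 + K * d" using R by (simp add: K_def)
    also have "\<dots> < e" using Kd e by simp
    finally show ?case by (simp add: dist_norm)
  qed
qed

text \<open>\<open>U\<close> is open in the full space, and \<open>D\<close> is meant to be the jet
  of \<open>f\<close> composed with the projection onto \<open>delay_space h\<close>.\<close>

locale delay_jet =
  fixes h a :: real and k :: nat and U :: "(real \<Rightarrow>\<^sub>C 'b::euclidean_space) set"
    and D :: "(real \<Rightarrow>\<^sub>C 'b) \<Rightarrow> (real \<Rightarrow>\<^sub>C 'b) list \<Rightarrow> 'b"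
  assumes h: "0 < h" and a: "0 < a" and k: "1 \<le> k" and jet: "jet k U D"
begin

abbreviation seg :: "(real \<Rightarrow>\<^sub>C 'b) \<Rightarrow> real \<Rightarrow> real \<Rightarrow>\<^sub>C 'b" where
  "seg \<equiv> bsegment h"

definition W :: "(real \<Rightarrow>\<^sub>C 'b) set" where
  "W = {x. \<forall>s\<in>{0..a}. seg x s \<in> U}"

lemma WD: "x \<in> W \<Longrightarrow> s \<in> {0..a} \<Longrightarrow> seg x s \<in> U"
  by (simp add: W_def)

lemma clamp_a: "clamp 0 a (t::real) \<in> {0..a}"
  using clamp_0_le[of a t] a by simp

section \<open>Uniformity of the derivatives along the segments of one function\<close>

lemma compact_segs: "compact (seg x ` {0..a})"
  using h by (intro compact_continuous_image continuous_on_bsegment) auto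

text \<open>The radius \<open>d\<close> is a Lebesgue number for a cover of the compact set of
  segments by balls on which \<open>D\<close> differs from its value at the centre by at most
  \<open>e / 2\<close>. Both \<open>z\<close> and \<open>seg x s\<close> lie in one such ball and
  are compared through its centre.\<close>

lemma uniform_near:
  assumes x: "x \<in> W" and j: "j \<le> k" and e: "e > 0"
  obtains d where "d > 0" "\<And>s z. s \<in> {0..a} \<Longrightarrow> z \<in> ball (seg x s) d \<Longrightarrow>
     z \<in> U \<and> multilinear_bound UNIV j (\<lambda>vs. D z vs - D (seg x s) vs) e"
proof -
  have "\<exists>d>0. \<forall>w. dist w z < d \<longrightarrow> w \<in> U \<and> multilinear_bound UNIV j (\<lambda>vs. D w vs - D z vs) (e / 2)"
    if "z \<in> seg x ` {0..a}" for z
  proof -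
    have "z \<in> U" using that WD[OF x] by auto
    from jetD(5)[OF jet this j half_gt_zero[OF e]] show ?thesis unfolding eventually_nhds_metric .
  qed
  then have "\<forall>z\<in>seg x ` {0..a}. \<exists>d>0. \<forall>w. dist w z < d \<longrightarrow> w \<in> U \<and> multilinear_bound UNIV j (\<lambda>vs. D w vs - D z vs) (e / 2)"
    by blast
  from bchoice[OF this] obtain \<delta> where \<delta>': "\<forall>z\<in>seg x ` {0..a}. \<delta> z > 0 \<and>
    (\<forall>w. dist w z < \<delta> z \<longrightarrow> w \<in> U \<and> multilinear_bound UNIV j (\<lambda>vs. D w vs - D z vs) (e / 2))" ..
  then have \<delta>: "\<And>z. z \<in> seg x ` {0..a} \<Longrightarrow> \<delta> z > 0"
    "\<And>z w. z \<in> seg x ` {0..a} \<Longrightarrow> dist w z < \<delta> z \<Longrightarrow>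
       w \<in> U \<and> multilinear_bound UNIV j (\<lambda>vs. D w vs - D z vs) (e / 2)" by blast+
  let ?B = "(\<lambda>z. ball z (\<delta> z)) ` seg x ` {0..a}"
  have "seg x ` {0..a} \<subseteq> \<Union> ?B"
  proof
    fix z assume z: "z \<in> seg x ` {0..a}"
    then have "z \<in> ball z (\<delta> z)" using \<delta>(1) by simp
    with z show "z \<in> \<Union> ?B" by blast
  qed
  then obtain d where d: "d > 0" "\<And>z. z \<in> seg x ` {0..a} \<Longrightarrow> \<exists>G\<in>?B. ball z d \<subseteq> G"
    by (rule Heine_Borel_lemma[OF compact_segs]) auto
  have "z \<in> U \<and> multilinear_bound UNIV j (\<lambda>vs. D z vs - D (seg x s) vs) e"
    if s: "s \<in> {0..a}" and z: "z \<in> ball (seg x s) d" for s z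
  proof -
    obtain y where y: "y \<in> seg x ` {0..a}" "ball (seg x s) d \<subseteq> ball y (\<delta> y)" using d(2)[of "seg x s"] s by blast
    have "seg x s \<in> ball (seg x s) d" using d(1) by simp
    then have "z \<in> ball y (\<delta> y)" "seg x s \<in> ball y (\<delta> y)" using y(2) z by blast+
    then have 1: "z \<in> U" "multilinear_bound UNIV j (\<lambda>vs. D z vs - D y vs) (e / 2)"
      and 2: "multilinear_bound UNIV j (\<lambda>vs. D (seg x s) vs - D y vs) (e / 2)"
      using \<delta>(2)[OF y(1)] by (auto simp: dist_commute)
    have "multilinear_bound UNIV j (\<lambda>vs. (D z vs - D y vs) + - (D (seg x s) vs - D y vs)) (e / 2 + e / 2)"
      by (intro multilinear_bound_add multilinear_bound_minus 1 2)
    then show ?thesis using 1(1) by simp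
  qed
  with d(1) show thesis by (rule that)
qed

text \<open>Finitely many balls of radius \<open>d\<close> cover the segments, and for a segment in
  such a ball the derivative differs by at most 1 from that at the centre.\<close>

lemma uniform_bound:
  assumes x: "x \<in> W" and j: "j \<le> k"
  obtains c where "c > 0" "\<And>s. s \<in> {0..a} \<Longrightarrow> multilinear_bound UNIV j (D (seg x s)) c"
proof -
  obtain d where d: "d > 0" "\<And>s z. s \<in> {0..a} \<Longrightarrow> z \<in> ball (seg x s) d \<Longrightarrow>
     z \<in> U \<and> multilinear_bound UNIV j (\<lambda>vs. D z vs - D (seg x s) vs) 1"
    by (rule uniform_near[OF x j zero_less_one]) blast
  have "\<forall>z\<in>seg x ` {0..a}. \<exists>c>0. multilinear_bound UNIV j (D z) c"
    using jetD(3)[OF jet _ j] WD[OF x] by auto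
  from bchoice[OF this] obtain c where c: "\<And>z. z \<in> seg x ` {0..a} \<Longrightarrow> c z > 0"
    "\<And>z. z \<in> seg x ` {0..a} \<Longrightarrow> multilinear_bound UNIV j (D z) (c z)" by blast
  obtain K where K: "K \<subseteq> seg x ` {0..a}" "finite K" "seg x ` {0..a} \<subseteq> (\<Union>z\<in>K. ball z d)"
    by (rule compactE_image[OF compact_segs, of "seg x ` {0..a}" "\<lambda>z. ball z d" x]) (use d(1) in auto)
  have cpos: "c z > 0" if "z \<in> K" for z using c(1) K(1) that by blast
  have "multilinear_bound UNIV j (D (seg x s)) (1 + (\<Sum>z\<in>K. c z))" if s: "s \<in> {0..a}" for s
  proof -
    obtain z where z: "z \<in> K" "seg x s \<in> ball z d" using K(3) s by blast
    then obtain s' where s': "s' \<in> {0..a}" "z = seg x s'" using K(1) by blast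
    have "multilinear_bound UNIV j (\<lambda>vs. (D (seg x s) vs - D z vs) + D z vs) (1 + c z)"
      using d(2)[OF s'(1), of "seg x s"] z s' by (intro multilinear_bound_add c) auto
    moreover have "c z \<le> (\<Sum>z\<in>K. c z)"
      using z(1) K(2) by (intro member_le_sum) (auto intro: less_imp_le cpos)
    ultimately show ?thesis by (auto elim: multilinear_bound_mono)
  qed
  moreover have "1 + (\<Sum>z\<in>K. c z) > 0"
    by (intro add_pos_nonneg sum_nonneg) (auto intro: less_imp_le cpos)
  ultimately show thesis using that by blast
qed

lemma dist_seg_le: "dist (seg w s) (seg x s) \<le> dist w x"
  using norm_bsegment_le[of h "w - x" s] by (simp add: dist_norm bsegment_diff)

lemma open_W: "open W"
  unfolding open_dist
proof
  fix x assume x: "x \<in> W"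
  obtain d where d: "d > 0" "\<And>s z. s \<in> {0..a} \<Longrightarrow> z \<in> ball (seg x s) d \<Longrightarrow>
     z \<in> U \<and> multilinear_bound UNIV 0 (\<lambda>vs. D z vs - D (seg x s) vs) 1"
    by (rule uniform_near[OF x le0 zero_less_one]) blast
  have "w \<in> W" if "dist w x < d" for w
    unfolding W_def using d(2)[of _ "seg w _"] le_less_trans[OF dist_seg_le that] by (auto simp: dist_commute)
  then show "\<exists>e>0. \<forall>y. dist y x < e \<longrightarrow> y \<in> W" using d(1) by blast
qed

text \<open>The derivatives of the substitution operator \<open>x \<mapsto> (s \<mapsto> f (x\<^sub>s))\<close>, where \<open>f u = D u []\<close>.\<close>

definition subst_deriv :: "(real \<Rightarrow>\<^sub>C 'b) \<Rightarrow> (real \<Rightarrow>\<^sub>C 'b) list \<Rightarrow> real \<Rightarrow>\<^sub>C 'b" where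
  "subst_deriv x ys = Bcontfun (ext_cont (\<lambda>s. D (seg x s) (map (\<lambda>y. seg y s) ys)) 0 a)"

text \<open>Without continuity in \<open>s\<close>, the \<open>Bcontfun\<close> in the definition
  would have no known value. Continuity holds because segments depend continuously on time and
  \<open>D\<close> is continuous in operator norm.\<close>

lemma apply_subst_deriv:
  assumes x: "x \<in> W" and len: "length ys \<le> k"
  shows "apply_bcontfun (subst_deriv x ys) t = D (seg x (clamp 0 a t)) (map (\<lambda>y. seg y (clamp 0 a t)) ys)"
  unfolding subst_deriv_def
proof (rule apply_Bcontfun_ext_cont)
  have cont: "(seg y \<longlongrightarrow> seg y s) (at s within {0..a})" if "s \<in> {0..a}" for y s
    using continuous_on_bsegment[of h a y] h that by (simp add: continuous_on_def)
  show "continuous_on {0..a} (\<lambda>s. D (seg x s) (map (\<lambda>y. seg y s) ys))"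
    unfolding continuous_on_def
  proof
    fix s assume s: "s \<in> {0..a}"
    have xs: "seg x s \<in> U" using WD[OF x s] .
    obtain c where c: "c > 0" "multilinear_bound UNIV (length ys) (D (seg x s)) c"
      using jetD(3)[OF jet xs len] by blast
    show "((\<lambda>s. D (seg x s) (map (\<lambda>y. seg y s) ys)) \<longlongrightarrow> D (seg x s) (map (\<lambda>y. seg y s) ys)) (at s within {0..a})"
    proof (rule tendsto_multilin[OF jetD(2)[OF jet xs len] c(2)])
      show "\<forall>\<^sub>F s' in at s within {0..a}. multilinear_bound UNIV (length ys) (\<lambda>vs. D (seg x s') vs - D (seg x s) vs) e"
        if "e > 0" for e
        using eventually_compose_filterlim[OF jetD(5)[OF jet xs len that] cont[OF s, of x]]
        by eventually_elim simp
    qed (use c cont[OF s] in auto)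
  qed
qed

lemma prod_list_norm_seg_le: "(\<Prod>v\<leftarrow>map (\<lambda>y. seg y s) ys. norm v) \<le> (\<Prod>v\<leftarrow>ys. norm v)"
  by (induction ys) (auto intro!: mult_mono norm_bsegment_le prod_list_norm_nonneg[of "map (\<lambda>y. seg y s) _", simplified])

text \<open>Pointwise in time this is the mean value estimate for \<open>D\<close>. Since the radius
  \<open>d\<close> from \<open>uniform_near\<close> does not depend on \<open>s\<close>, the
  remainder is small in the supremum norm.\<close>

lemma subst_deriv_has_derivative:
  assumes x: "x \<in> W" and len: "length ys < k"
  shows "((\<lambda>w. subst_deriv w ys) has_derivative (\<lambda>v. subst_deriv x (v # ys))) (at x)"
  unfolding has_derivative_within_alt2
proof (intro conjI allI impI)
  let ?P = "\<Prod>v\<leftarrow>ys. norm v"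
  have P: "?P \<ge> 0" by (rule prod_list_norm_nonneg)
  have len': "Suc (length ys) \<le> k" using len by simp
  show "bounded_linear (\<lambda>v. subst_deriv x (v # ys))"
  proof
    have lin: "linear (\<lambda>v. D (seg x s) (v # map (\<lambda>y. seg y s) ys))" if "s \<in> {0..a}" for s
      using jetD(2)[OF jet WD[OF x that] len'] by (intro multilin_linear_Cons) auto
    note app = apply_subst_deriv[OF x, of "_ # ys", simplified, OF len']
    fix v w c
    show "subst_deriv x ((v + w) # ys) = subst_deriv x (v # ys) + subst_deriv x (w # ys)"
      by (rule bcontfun_eqI)
        (simp add: app linear_add[OF lin[OF clamp_a], symmetric] bsegment_add)
    show "subst_deriv x ((c *\<^sub>R v) # ys) = c *\<^sub>R subst_deriv x (v # ys)"
      by (rule bcontfun_eqI)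
        (simp add: app linear_scale[OF lin[OF clamp_a], symmetric] bsegment_scaleR)
    obtain c where c: "c > 0" "\<And>s. s \<in> {0..a} \<Longrightarrow> multilinear_bound UNIV (Suc (length ys)) (D (seg x s)) c"
      by (rule uniform_bound[OF x len']) blast
    have "norm (subst_deriv x (v # ys)) \<le> norm v * (c * ?P)" for v
    proof (rule norm_bound)
      fix t
      let ?s = "clamp 0 a t"
      have "norm (subst_deriv x (v # ys) t) \<le> c * (\<Prod>v\<leftarrow>map (\<lambda>y. seg y ?s) (v # ys). norm v)"
        using multilinear_boundD[OF c(2)[OF clamp_a[of t]], of "map (\<lambda>y. seg y ?s) (v # ys)"] by (simp add: app)
      also have "\<dots> \<le> c * (\<Prod>v\<leftarrow>v # ys. norm v)"
        using c(1) by (intro mult_left_mono prod_list_norm_seg_le) auto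
      finally show "norm (subst_deriv x (v # ys) t) \<le> norm v * (c * ?P)" by (simp add: mult_ac)
    qed
    then show "\<exists>K. \<forall>v. norm (subst_deriv x (v # ys)) \<le> norm v * K" by blast
  qed
  fix e :: real assume e: "e > 0"
  have e': "e / (?P + 1) > 0" using e P by simp
  obtain d where d: "d > 0" "\<And>s z. s \<in> {0..a} \<Longrightarrow> z \<in> ball (seg x s) d \<Longrightarrow>
     z \<in> U \<and> multilinear_bound UNIV (Suc (length ys)) (\<lambda>vs. D z vs - D (seg x s) vs) (e / (?P + 1))"
    by (rule uniform_near[OF x len' e']) blast
  have "\<forall>\<^sub>F w in at x. w \<in> W" using open_W x by (rule eventually_at_in_open')
  moreover have "\<forall>\<^sub>F w in at x. w \<in> ball x d" using d(1) by (intro eventually_at_in_open') auto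
  ultimately show "\<forall>\<^sub>F w in at x. norm (subst_deriv w ys - subst_deriv x ys - subst_deriv x ((w - x) # ys)) \<le> e * norm (w - x)"
  proof eventually_elim
    case (elim w)
    show ?case
    proof (rule norm_bound)
      fix t
      define s where "s = clamp 0 a t"
      have s: "s \<in> {0..a}" unfolding s_def by (rule clamp_a)
      let ?ys = "map (\<lambda>y. seg y s) ys"
      have "norm (D (seg w s) ?ys - D (seg x s) ?ys - D (seg x s) ((seg w s - seg x s) # ?ys)) \<le>
          e / (?P + 1) * norm (seg w s - seg x s) * (\<Prod>v\<leftarrow>?ys. norm v)"
      proof (rule mean_value_remainder[where S = "ball (seg x s) d"])
        show "seg w s \<in> ball (seg x s) d"
          using le_less_trans[OF dist_seg_le[of w s x], of d] elim(2) by (simp add: dist_commute)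
        show "((\<lambda>w. D w ?ys) has_derivative (\<lambda>v. D z (v # ?ys))) (at z)" if "z \<in> ball (seg x s) d" for z
          using d(2)[OF s that] len by (intro jetD(4)[OF jet]) auto
        show "multilinear_bound UNIV (Suc (length ys)) (\<lambda>vs. D z vs - D (seg x s) vs) (e / (?P + 1))"
          if "z \<in> ball (seg x s) d" for z
          using d(2)[OF s that] by blast
      qed (use d(1) e' in auto)
      also have "\<dots> \<le> e / (?P + 1) * norm (w - x) * ?P"
        using e' prod_list_norm_seg_le[of s ys] norm_bsegment_le[of h "w - x" s] prod_list_norm_nonneg[of ?ys]
        by (intro mult_mono) (auto simp: bsegment_diff less_imp_le[OF e])
      also have "\<dots> = e * norm (w - x) * (?P / (?P + 1))" by simp
      also have "\<dots> \<le> e * norm (w - x) * 1"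
        using e P by (intro mult_left_mono) (auto simp: divide_le_eq_1 add_nonneg_pos)
      finally show "norm ((subst_deriv w ys - subst_deriv x ys - subst_deriv x ((w - x) # ys)) t) \<le> e * norm (w - x)"
        using len by (simp add: apply_subst_deriv x elim(1) s_def bsegment_diff)
    qed
  qed
qed

lemma subst_deriv_bounded:
  assumes x: "x \<in> W" and j: "j \<le> k"
  obtains c where "\<And>ys. ys \<in> unit_lists j \<Longrightarrow> norm (subst_deriv x ys) \<le> c"
proof -
  obtain c where c: "c > 0" "\<And>s. s \<in> {0..a} \<Longrightarrow> multilinear_bound UNIV j (D (seg x s)) c"
    by (rule uniform_bound[OF x j]) blast
  have "norm (subst_deriv x ys) \<le> c" if ys: "ys \<in> unit_lists j" for ys
  proof (rule norm_bound)
    fix t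
    let ?s = "clamp 0 a t"
    have len: "length ys = j" using ys by (simp add: unit_lists_def)
    have "norm (subst_deriv x ys t) \<le> c * (\<Prod>v\<leftarrow>map (\<lambda>y. seg y ?s) ys. norm v)"
      using multilinear_boundD[OF c(2)[OF clamp_a[of t]], of "map (\<lambda>y. seg y ?s) ys"] len j
      by (simp add: apply_subst_deriv x)
    also have "\<dots> \<le> c * 1"
      using order_trans[OF prod_list_norm_seg_le prod_list_norm_le[of ys 1]] ys c(1)
      by (intro mult_left_mono) (auto simp: unit_lists_def)
    finally show "norm (subst_deriv x ys t) \<le> c" by simp
  qed
  then show thesis by (rule that)
qed

lemma subst_deriv_uniform_limit:
  assumes x: "x \<in> W" and j: "j \<le> k"
  shows "uniform_limit (unit_lists j) subst_deriv (subst_deriv x) (at x)"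
proof (rule uniform_limitI)
  fix e :: real assume e: "e > 0"
  obtain d where d: "d > 0" "\<And>s z. s \<in> {0..a} \<Longrightarrow> z \<in> ball (seg x s) d \<Longrightarrow>
     z \<in> U \<and> multilinear_bound UNIV j (\<lambda>vs. D z vs - D (seg x s) vs) (e / 2)"
    by (rule uniform_near[OF x j half_gt_zero[OF e]]) blast
  have "\<forall>\<^sub>F w in at x. w \<in> W" using open_W x by (rule eventually_at_in_open')
  moreover have "\<forall>\<^sub>F w in at x. w \<in> ball x d" using d(1) by (intro eventually_at_in_open') auto
  ultimately show "\<forall>\<^sub>F w in at x. \<forall>ys\<in>unit_lists j. dist (subst_deriv w ys) (subst_deriv x ys) < e"
  proof eventually_elim
    case (elim w)
    show ?case
    proof
      fix ys :: "(real \<Rightarrow>\<^sub>C 'b) list" assume ys: "ys \<in> unit_lists j"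
      then have len: "length ys = j" by (simp add: unit_lists_def)
      have "norm (subst_deriv w ys - subst_deriv x ys) \<le> e / 2"
      proof (rule norm_bound)
        fix t
        define s where "s = clamp 0 a t"
        have s: "s \<in> {0..a}" unfolding s_def by (rule clamp_a)
        let ?ys = "map (\<lambda>y. seg y s) ys"
        have "seg w s \<in> ball (seg x s) d"
          using le_less_trans[OF dist_seg_le[of w s x], of d] elim(2) by (simp add: dist_commute)
        then have "norm (D (seg w s) ?ys - D (seg x s) ?ys) \<le> e / 2 * (\<Prod>v\<leftarrow>?ys. norm v)"
          using d(2)[OF s] len by (intro multilinear_boundD[where M = "\<lambda>vs. D (seg w s) vs - D (seg x s) vs"]) auto
        also have "\<dots> \<le> e / 2 * 1"
          using order_trans[OF prod_list_norm_seg_le prod_list_norm_le[of ys 1]] ys e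
          by (intro mult_left_mono) (auto simp: unit_lists_def)
        finally show "norm ((subst_deriv w ys - subst_deriv x ys) t) \<le> e / 2"
          using len j by (simp add: apply_subst_deriv x elim(1) s_def)
      qed
      then show "dist (subst_deriv w ys) (subst_deriv x ys) < e" using e by (simp add: dist_norm)
    qed
  qed
qed

section \<open>The map G and its derivatives\<close>

definition G_deriv :: "(real \<Rightarrow>\<^sub>C 'b) \<Rightarrow> (real \<Rightarrow>\<^sub>C 'b) list \<Rightarrow> real \<Rightarrow>\<^sub>C 'b" where
  "G_deriv x vs = (if vs = [] then x else if length vs = 1 then hd vs else 0) - volterra a (subst_deriv x vs)"

text \<open>No constancy outside \<open>{-h..a}\<close> is imposed on \<open>x\<close>: the Volterra
  term is constant before 0 and after \<open>a\<close>, so a solution of \<open>G x = u\<close> with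
  \<open>u\<close> in \<open>delay_space h\<close> has this property anyway. Hence \<open>G\<close>
  can be studied on an open subset of the full space.\<close>

definition G :: "(real \<Rightarrow>\<^sub>C 'b) \<Rightarrow> real \<Rightarrow>\<^sub>C 'b" where
  "G x = x - volterra a (subst_deriv x [])"

lemma jet_G: "jet k W G_deriv"
proof (rule jetI[OF open_W])
  have V: "bounded_linear (volterra a :: (real \<Rightarrow>\<^sub>C 'b) \<Rightarrow> _)" using a by (intro bounded_linear_volterra) simp
  interpret V: bounded_linear "volterra a :: (real \<Rightarrow>\<^sub>C 'b) \<Rightarrow> _" by (rule V)
  obtain B where B: "B > 0" "\<And>q :: real \<Rightarrow>\<^sub>C 'b. norm (volterra a q) \<le> norm q * B" using V.pos_bounded by blast
  define J :: "(real \<Rightarrow>\<^sub>C 'b) \<Rightarrow> (real \<Rightarrow>\<^sub>C 'b) list \<Rightarrow> real \<Rightarrow>\<^sub>C 'b"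
    where "J x vs = (if vs = [] then x else if length vs = 1 then hd vs else 0)" for x vs
  have G_deriv: "G_deriv x vs = J x vs - volterra a (subst_deriv x vs)" for x vs
    by (simp add: G_deriv_def J_def)
  fix x assume x: "x \<in> W"
  show "((\<lambda>w. G_deriv w vs) has_derivative (\<lambda>v. G_deriv x (v # vs))) (at x)" if "length vs < k" for vs
    unfolding G_deriv
  proof (rule has_derivative_diff)
    show "((\<lambda>w. J w vs) has_derivative (\<lambda>v. J x (v # vs))) (at x)"
      by (cases vs) (auto simp: J_def)
    show "((\<lambda>w. volterra a (subst_deriv w vs)) has_derivative (\<lambda>v. volterra a (subst_deriv x (v # vs)))) (at x)"
      by (rule V.has_derivative[OF subst_deriv_has_derivative[OF x that]])
  qed
  fix j assume j: "j \<le> k"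
  show "\<exists>c. \<forall>vs\<in>unit_lists j. norm (G_deriv x vs) \<le> c"
  proof -
    obtain c where c: "\<And>ys. ys \<in> unit_lists j \<Longrightarrow> norm (subst_deriv x ys) \<le> c"
      by (rule subst_deriv_bounded[OF x j]) blast
    have "norm (G_deriv x vs) \<le> (norm x + 1) + c * B" if vs: "vs \<in> unit_lists j" for vs
    proof -
      have "norm (J x vs) \<le> norm x + 1"
        using vs by (cases vs) (auto simp: J_def unit_lists_def add_increasing)
      moreover have "norm (volterra a (subst_deriv x vs)) \<le> c * B"
        using order_trans[OF B(2) mult_right_mono[OF c[OF vs]]] B(1) by simp
      ultimately show ?thesis
        unfolding G_deriv using norm_triangle_ineq4[of "J x vs" "volterra a (subst_deriv x vs)"] by simp
    qed
    then show ?thesis by blast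
  qed
  show "uniform_limit (unit_lists j) G_deriv (G_deriv x) (at x)"
    unfolding G_deriv[abs_def]
  proof (rule uniform_limit_minus)
    show "uniform_limit (unit_lists j) J (J x) (at x)"
    proof (rule uniform_limitI)
      fix e :: real assume e: "e > 0"
      then have "\<forall>\<^sub>F w in at x. w \<in> ball x e" by (intro eventually_at_in_open') auto
      then show "\<forall>\<^sub>F w in at x. \<forall>vs\<in>unit_lists j. dist (J w vs) (J x vs) < e"
        by eventually_elim (use e in \<open>auto simp: J_def dist_commute\<close>)
    qed
    show "uniform_limit (unit_lists j) (\<lambda>x vs. volterra a (subst_deriv x vs)) (\<lambda>vs. volterra a (subst_deriv x vs)) (at x)"
      by (rule V.uniform_limit[OF subst_deriv_uniform_limit[OF x j]])
  qed
qed

text \<open>The segment of \<open>v\<close> at time \<open>s\<close> involves no time after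
  \<open>s\<close>, and the weight is nondecreasing, so a weighted bound on \<open>v\<close> bounds
  \<open>seg v s\<close> by the weight at \<open>s\<close>. The Volterra operator then gains the
  factor 1/2, without any smallness of \<open>a\<close> or \<open>c\<close>.\<close>

lemma volterra_halves:
  assumes c: "0 < c" and m: "0 \<le> m" and q: "\<And>s. s \<in> {0..a} \<Longrightarrow> norm (apply_bcontfun q s) \<le> c * norm (seg v s)"
    and v: "\<And>r. norm (apply_bcontfun v r) \<le> m * exp (2 * c * clamp 0 a r)"
  shows "norm (volterra a q t) \<le> m / 2 * exp (2 * c * clamp 0 a t)"
proof (rule norm_volterra_weighted)
  fix s assume s: "s \<in> {0..a}"
  have "norm (seg v s) \<le> m * exp (2 * c * s)"
  proof (rule norm_bound)
    fix r
    have "clamp 0 a (s + clamp (- h) 0 r) \<le> s" using s h by (auto simp: clamp_real)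
    then have "m * exp (2 * c * clamp 0 a (s + clamp (- h) 0 r)) \<le> m * exp (2 * c * s)"
      using c m by (intro mult_left_mono) auto
    then show "norm (seg v s r) \<le> m * exp (2 * c * s)" using v[of "s + clamp (- h) 0 r"] by simp
  qed
  then show "norm (apply_bcontfun q s) \<le> c * (m * exp (2 * c * s))"
    using q[OF s] c by (meson less_imp_le mult_left_mono order_trans)
qed (use a c m in auto)

lemma norm_le_of_weighted:
  assumes "0 < c" "0 \<le> m" "\<And>r. norm (apply_bcontfun v r) \<le> m * exp (2 * c * clamp 0 a r)"
  shows "norm v \<le> m * exp (2 * c * a)"
proof (rule norm_bound)
  fix r
  have "m * exp (2 * c * clamp 0 a r) \<le> m * exp (2 * c * a)"
    using clamp_0_le(2)[of a r] a assms by (intro mult_left_mono) auto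
  then show "norm (apply_bcontfun v r) \<le> m * exp (2 * c * a)" using assms(3)[of r] by simp
qed

lemma norm_weighted_start:
  assumes "0 < c"
  shows "norm (apply_bcontfun v r) \<le> norm v * exp (2 * c * clamp 0 a r)"
proof -
  have "norm v * 1 \<le> norm v * exp (2 * c * clamp 0 a r)"
    using clamp_0_le(1)[of a r] a assms by (intro mult_left_mono) auto
  then show ?thesis using norm_bounded[of v r] by simp
qed

text \<open>The derivative of \<open>G\<close> is the identity minus \<open>K\<close>, and
  \<open>c\<close> bounds the first derivative of \<open>f\<close> along the segments of
  \<open>x\<close>. The powers of \<open>K\<close> decay geometrically in the weighted norm; passing
  back to the supremum norm costs the factor \<open>exp (2 * c * a)\<close>, the same for all
  powers.\<close>

lemma G_deriv_invertible:
  assumes x: "x \<in> W"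
  shows "\<exists>A. bounded_linear A \<and> (\<forall>v. A (G_deriv x [v]) = v) \<and> (\<forall>v. G_deriv x [A v] = v)"
proof -
  obtain c where c: "c > 0" "\<And>s. s \<in> {0..a} \<Longrightarrow> multilinear_bound UNIV 1 (D (seg x s)) c"
    by (rule uniform_bound[OF x k]) blast
  define K where "K v = volterra a (subst_deriv x [v])" for v
  have "bounded_linear (\<lambda>v. subst_deriv x [v])"
    using subst_deriv_has_derivative[OF x, of "[]"] k has_derivative_bounded_linear by force
  then have blK: "bounded_linear K"
    unfolding K_def using a by (intro bounded_linear_compose[OF bounded_linear_volterra]) auto
  have step: "norm (subst_deriv x [v] s) \<le> c * norm (seg v s)" if s: "s \<in> {0..a}" for v s
    using multilinear_boundD[OF c(2)[OF s], of "[seg v s]"] k s a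
    by (simp add: apply_subst_deriv[OF x] clamp_real)
  have "norm ((K ^^ n) v r) \<le> (norm v * (1 / 2) ^ n) * exp (2 * c * clamp 0 a r)" for n v r
  proof (induction n arbitrary: r)
    case 0
    then show ?case using norm_weighted_start[OF c(1)] by simp
  next
    case (Suc n)
    have "norm (K ((K ^^ n) v) r) \<le> (norm v * (1 / 2) ^ n) / 2 * exp (2 * c * clamp 0 a r)"
      unfolding K_def[of "(K ^^ n) v"] using c(1) step Suc.IH by (intro volterra_halves) auto
    then show ?case by simp
  qed
  then have "norm ((K ^^ n) v) \<le> exp (2 * c * a) * (1 / 2) ^ n * norm v" for n v
    using norm_le_of_weighted[OF c(1), of "norm v * (1 / 2) ^ n" "(K ^^ n) v"] by (simp add: mult_ac)
  from neumann_series_inverse[OF blK this] show ?thesis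
    by (simp add: G_deriv_def K_def)
qed

text \<open>If \<open>G x = G y\<close>, then \<open>v = x - y\<close> equals
  \<open>volterra a q\<close>, where \<open>q\<close> is the difference of the right-hand sides. A
  bound \<open>L * norm (seg v s)\<close> on \<open>q s\<close> makes every weighted bound on
  \<open>v\<close> improve by 1/2, so \<open>v = 0\<close>. The set \<open>W\<close> need not be
  convex, so the mean value estimate is used only where \<open>seg y s\<close> is within
  \<open>d\<close> of \<open>seg x s\<close>, with the constant \<open>c + 1\<close>. Elsewhere
  \<open>norm (seg v s)\<close> is at least \<open>d\<close>, and \<open>norm q / d\<close> is a
  sufficient constant.\<close>

lemma inj_on_G: "inj_on G W"
proof (rule inj_onI)
  fix x y assume x: "x \<in> W" and y: "y \<in> W" and eq: "G x = G y"
  obtain c where c: "c > 0" "\<And>s. s \<in> {0..a} \<Longrightarrow> multilinear_bound UNIV 1 (D (seg x s)) c"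
    by (rule uniform_bound[OF x k]) blast
  obtain d where d: "d > 0" "\<And>s z. s \<in> {0..a} \<Longrightarrow> z \<in> ball (seg x s) d \<Longrightarrow>
     z \<in> U \<and> multilinear_bound UNIV 1 (\<lambda>vs. D z vs - D (seg x s) vs) 1"
    by (rule uniform_near[OF x k zero_less_one]) blast
  define q where "q = subst_deriv x [] - subst_deriv y []"
  define v where "v = x - y"
  define L where "L = c + 1 + norm q / d"
  have L: "L > 0" using c(1) d(1) by (simp add: L_def add_pos_nonneg)
  have q: "norm (q s) \<le> L * norm (seg v s)" if s: "s \<in> {0..a}" for s
  proof (cases "seg y s \<in> ball (seg x s) d")
    case True
    have qs: "q s = D (seg x s) [] - D (seg y s) []"
      using s a by (simp add: q_def apply_subst_deriv x y clamp_real)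
    have "norm (D (seg y s) [] - D (seg x s) [] - D (seg x s) [seg y s - seg x s]) \<le> 1 * norm (seg y s - seg x s) * (\<Prod>v\<leftarrow>[]. norm (v :: real \<Rightarrow>\<^sub>C 'b))"
    proof (rule mean_value_remainder[where S = "ball (seg x s) d"])
      show "((\<lambda>w. D w []) has_derivative (\<lambda>v. D z [v])) (at z)" if "z \<in> ball (seg x s) d" for z
        using d(2)[OF s that] k by (intro jetD(4)[OF jet]) auto
      show "multilinear_bound UNIV (Suc 0) (\<lambda>vs. D z vs - D (seg x s) vs) 1" if "z \<in> ball (seg x s) d" for z
        using d(2)[OF s that] by simp
    qed (use d(1) True in auto)
    moreover have "norm (D (seg x s) [seg y s - seg x s]) \<le> c * norm (seg y s - seg x s)"
      using multilinear_boundD[OF c(2)[OF s], of "[seg y s - seg x s]"] by simp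
    ultimately have "norm (D (seg y s) [] - D (seg x s) []) \<le> (c + 1) * norm (seg y s - seg x s)"
      using norm_triangle_ineq2[of "D (seg y s) [] - D (seg x s) []" "D (seg x s) [seg y s - seg x s]"]
      by (simp add: algebra_simps)
    also have "\<dots> \<le> L * norm (seg y s - seg x s)"
      using d(1) by (intro mult_right_mono) (auto simp: L_def)
    finally show ?thesis by (simp add: qs v_def bsegment_diff norm_minus_commute)
  next
    case False
    then have "d \<le> norm (seg v s)" by (simp add: v_def bsegment_diff dist_norm)
    have "norm (q s) \<le> norm q" by (rule norm_bounded)
    also have "\<dots> = norm q / d * d" using d(1) by simp
    also have "\<dots> \<le> norm q / d * norm (seg v s)"
      using \<open>d \<le> norm (seg v s)\<close> d(1) by (intro mult_left_mono) auto
    also have "\<dots> \<le> L * norm (seg v s)" using c(1) by (intro mult_right_mono) (auto simp: L_def)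
    finally show ?thesis .
  qed
  have "bounded_linear (volterra a :: (real \<Rightarrow>\<^sub>C 'b) \<Rightarrow> _)" using a by (intro bounded_linear_volterra) simp
  then have v: "v = volterra a q"
    using eq by (simp add: v_def q_def G_def bounded_linear.linear linear_diff algebra_simps)
  have "norm (v r) \<le> (norm v * (1 / 2) ^ n) * exp (2 * L * clamp 0 a r)" for n r
  proof (induction n arbitrary: r)
    case 0
    then show ?case using norm_weighted_start[OF L] by simp
  next
    case (Suc n)
    have "norm (volterra a q r) \<le> (norm v * (1 / 2) ^ n) / 2 * exp (2 * L * clamp 0 a r)"
      using L q Suc.IH by (intro volterra_halves) auto
    then show ?case unfolding v[symmetric] by simp
  qed
  then have "norm v \<le> (norm v * exp (2 * L * a)) * (1 / 2) ^ n" for n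
    using norm_le_of_weighted[OF L, of "norm v * (1 / 2) ^ n" v] by (simp add: mult_ac)
  moreover have "(\<lambda>n. (norm v * exp (2 * L * a)) * (1 / 2) ^ n) \<longlonglongrightarrow> (norm v * exp (2 * L * a)) * 0"
    by (intro tendsto_mult tendsto_const LIMSEQ_realpow_zero) auto
  ultimately have "norm v \<le> 0" using LIMSEQ_le_const[of _ 0 "norm v"] by simp
  then show "x = y" by (simp add: v_def)
qed

theorem Ck_on_inverse_G: "Ck_on UNIV k (G ` W) (inv_into W G)"
  by (rule Ck_on_inverse[OF jet_G k _ inj_on_G G_deriv_invertible]) (auto simp: G_deriv_def G_def)

end

section \<open>Solutions of the delay equation\<close>

lemma Ck_on_cong:
  assumes "Ck_on X k V g" "\<And>u. u \<in> V \<Longrightarrow> g u = g' u"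
  shows "Ck_on X k V g'"
proof -
  have "(\<forall>u\<in>V. D u [] = g u) \<longleftrightarrow> (\<forall>u\<in>V. D u [] = g' u)" for D :: "'a \<Rightarrow> 'a list \<Rightarrow> 'b"
    using assms(2) by auto
  then show ?thesis using assms(1) unfolding Ck_on_def by simp
qed

lemma segment_cong:
  assumes "0 \<le> h" "\<And>r. r \<in> {s - h..s} \<Longrightarrow> x r = y r"
  shows "segment h x s = segment h y s"
proof -
  have "x (s + clamp (- h) 0 r) = y (s + clamp (- h) 0 r)" for r
    using assms(1) by (intro assms(2)) (auto simp: clamp_real)
  then show ?thesis by (simp add: segment_def ext_cont_def)
qed

lemma bsegment_in_delay_space: "0 \<le> h \<Longrightarrow> bsegment h x s \<in> delay_space h"
  unfolding bsegment_def by (rule segment_apply(1)) auto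

lemma bsegment_0: "u \<in> delay_space h \<Longrightarrow> bsegment h u 0 = u"
  by (rule bcontfun_eqI) (simp add: delay_space_iff)

text \<open>Each \<open>{..<s}\<close> with \<open>s > t\<close> is a neighbourhood of
  \<open>t\<close>. This suits a maximal solution, which is pieced together from solutions that each
  reach some time beyond \<open>t\<close>.\<close>

lemma continuous_on_locally_left:
  fixes A :: "real set" and g :: "real \<Rightarrow> 'b::topological_space"
  assumes "\<And>t. t \<in> A \<Longrightarrow> \<exists>s>t. continuous_on (A \<inter> {..<s}) g"
  shows "continuous_on A g"
  unfolding continuous_on_eq_continuous_within
proof
  fix t assume t: "t \<in> A"
  then obtain s where s: "t < s" "continuous_on (A \<inter> {..<s}) g" using assms by blast
  then have "continuous (at t within A \<inter> {..<s}) g" using t by (simp add: continuous_on_eq_continuous_within)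
  moreover have "at t within A \<inter> {..<s} = at t within A"
    by (rule at_within_nhd[of t "{..<s}"]) (use s in auto)
  ultimately show "continuous (at t within A) g" by simp
qed

locale delay_equation =
  fixes h :: real and k :: nat and U :: "(real \<Rightarrow>\<^sub>C 'b::euclidean_space) set"
    and f :: "(real \<Rightarrow>\<^sub>C 'b) \<Rightarrow> 'b" and D :: "(real \<Rightarrow>\<^sub>C 'b) \<Rightarrow> (real \<Rightarrow>\<^sub>C 'b) list \<Rightarrow> 'b"
  assumes h: "0 < h" and U: "U \<subseteq> delay_space h" and k: "1 \<le> k"
    and jet: "jet k ((\<lambda>u. bsegment h u 0) -` U) D"
    and D_Nil: "bsegment h u 0 \<in> U \<Longrightarrow> D u [] = f (bsegment h u 0)"
begin

abbreviation W :: "real \<Rightarrow> (real \<Rightarrow>\<^sub>C 'b) set" where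
  "W a \<equiv> delay_jet.W h a ((\<lambda>u. bsegment h u 0) -` U)"

abbreviation G :: "real \<Rightarrow> (real \<Rightarrow>\<^sub>C 'b) \<Rightarrow> real \<Rightarrow>\<^sub>C 'b" where
  "G a \<equiv> delay_jet.G h a D"

lemma delay_jet: "0 < a \<Longrightarrow> delay_jet h a k ((\<lambda>u. bsegment h u 0) -` U) D"
  using h k jet by unfold_locales

lemma bsegment_bsegment: "bsegment h (bsegment h x s) 0 = bsegment h x s"
  using h by (intro bsegment_0 bsegment_in_delay_space) simp

lemma W_iff: "0 < a \<Longrightarrow> x \<in> W a \<longleftrightarrow> (\<forall>s\<in>{0..a}. bsegment h x s \<in> U)"
  by (simp add: delay_jet.W_def[OF delay_jet] bsegment_bsegment)

section \<open>Solutions on a bounded interval as preimages under G\<close>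

definition rhs :: "real \<Rightarrow> (real \<Rightarrow>\<^sub>C 'b) \<Rightarrow> real \<Rightarrow>\<^sub>C 'b" where
  "rhs a x = delay_jet.subst_deriv h a D x []"

lemma apply_rhs:
  assumes "0 < a" "x \<in> W a" "s \<in> {0..a}"
  shows "apply_bcontfun (rhs a x) s = f (bsegment h x s)"
proof -
  interpret J: delay_jet h a k "(\<lambda>u. bsegment h u 0) -` U" D by (rule delay_jet[OF assms(1)])
  have "bsegment h x s \<in> U" using assms by (simp add: W_iff)
  then show ?thesis
    using J.apply_subst_deriv[OF assms(2), of "[]" s] assms D_Nil[of "bsegment h x s"]
    by (simp add: rhs_def clamp_real bsegment_bsegment)
qed

lemma apply_G:
  assumes "0 < a"
  shows "apply_bcontfun (G a x) t = x t - integral {0..clamp 0 a t} (apply_bcontfun (rhs a x))"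
  by (simp add: delay_jet.G_def[OF delay_jet[OF assms]] rhs_def apply_volterra)

text \<open>Integrating the equation gives \<open>G a x = u\<close>. Because \<open>a\<close> lies
  strictly below \<open>T\<close>, the solution is continuous on the closed interval up to
  \<open>a\<close> and its segments there lie in \<open>U\<close>.\<close>

lemma solution_imp_G:
  assumes sol: "delay_solution h U f u T y" and a: "0 < a" "ereal a < T"
  defines "x \<equiv> Bcontfun (ext_cont y (- h) a)"
  shows "x \<in> W a" "G a x = u"
    and "s \<in> {0..a} \<Longrightarrow> bsegment h x s = segment h y s"
    and "t \<in> {-h..a} \<Longrightarrow> apply_bcontfun x t = y t"
proof -
  have le: "ereal s < T" if "s \<le> a" for s using that a(2) by (meson ereal_less_eq(3) le_less_trans)
  have cont: "continuous_on {-h..a} y"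
    using sol unfolding delay_solution_def by (auto intro: le elim!: continuous_on_subset)
  have app: "apply_bcontfun x t = y (clamp (-h) a t)" for t
    unfolding x_def by (rule apply_Bcontfun_ext_cont[OF cont])
  have xy: "apply_bcontfun x t = y t" if "t \<in> {-h..a}" for t
    using that h a(1) by (simp add: app clamp_real)
  then show "t \<in> {-h..a} \<Longrightarrow> apply_bcontfun x t = y t" .
  have seg: "bsegment h x s = segment h y s" if "s \<in> {0..a}" for s
    unfolding bsegment_def by (rule segment_cong) (use h that xy in auto)
  then show "s \<in> {0..a} \<Longrightarrow> bsegment h x s = segment h y s" .
  show xW: "x \<in> W a"
    unfolding W_iff[OF a(1)] using sol seg le by (auto simp: delay_solution_def)
  show "G a x = u"
  proof (rule bcontfun_eqI)
    fix t
    define \<tau> where "\<tau> = clamp 0 a t"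
    have \<tau>: "0 \<le> \<tau>" "\<tau> \<le> a" using clamp_0_le[of a t] a(1) by (auto simp: \<tau>_def)
    have int: "((\<lambda>s. f (segment h y s)) has_integral y \<tau> - y 0) {0..\<tau>}"
    proof (rule fundamental_theorem_of_calculus_interior[OF \<tau>(1)])
      show "continuous_on {0..\<tau>} y" by (rule continuous_on_subset[OF cont]) (use h \<tau> in auto)
      show "(y has_vector_derivative f (segment h y s)) (at s)" if "s \<in> {0<..<\<tau>}" for s
        using sol that \<tau> le[of s] by (auto simp: delay_solution_def)
    qed
    have rhs: "apply_bcontfun (rhs a x) s = f (segment h y s)" if "s \<in> {0..\<tau>}" for s
      using apply_rhs[OF a(1) xW, of s] seg[of s] that \<tau> by simp
    have "(apply_bcontfun (rhs a x) has_integral y \<tau> - y 0) {0..\<tau>}"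
      by (rule has_integral_eq[OF rhs[symmetric] int])
    then have G: "apply_bcontfun (G a x) t = x t - (y \<tau> - y 0)"
      unfolding apply_G[OF a(1)] \<tau>_def[symmetric] by (simp add: integral_unique)
    have "u = segment h y 0" using sol by (simp add: delay_solution_def)
    also have "apply_bcontfun \<dots> t = y (0 + clamp (-h) 0 t)"
      by (rule apply_segment) (rule continuous_on_subset[OF cont], use a in auto)
    finally have ut: "apply_bcontfun u t = y (clamp (-h) 0 t)" by simp
    \<comment> \<open>For \<open>t \<le> 0\<close>, \<open>\<tau>\<close> is 0 and both sides are
      values of the initial function; for \<open>t \<ge> 0\<close>, \<open>x t\<close> is
      \<open>y \<tau>\<close> and \<open>u t\<close> is \<open>y 0\<close>.\<close>
    show "apply_bcontfun (G a x) t = apply_bcontfun u t"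
      unfolding G ut app \<tau>_def using h a(1) by (auto simp: clamp_real max_def min_def)
  qed
qed

text \<open>\<open>rhs a x\<close> is continuous, so the integral equation can be differentiated.
  The solution is claimed only for times below \<open>a\<close>, because \<open>x\<close> is
  constant beyond \<open>a\<close> and the equation at \<open>a\<close> would ask for a two-sided
  derivative.\<close>

lemma G_imp_solution:
  assumes a: "0 < a" and u: "u \<in> delay_space h" and x: "x \<in> W a" and G: "G a x = u"
  shows "delay_solution h U f u (ereal a) (apply_bcontfun x)"
proof -
  have xt: "x t = u t + integral {0..clamp 0 a t} (apply_bcontfun (rhs a x))" for t
    using apply_G[OF a, of x t] G by simp
  have u0: "u t = u 0" if "0 \<le> t" for t
    using u[unfolded delay_space_iff, rule_format, of t] that h by (simp add: clamp_real)
  have seg0: "segment h (apply_bcontfun x) 0 = u"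
  proof (rule bcontfun_eqI)
    fix r
    have "clamp 0 a (clamp (-h) 0 r) = 0" using h a by (auto simp: clamp_real)
    then show "segment h (apply_bcontfun x) 0 r = u r"
      using u by (simp add: bsegment_def[symmetric] xt delay_space_iff)
  qed
  have rhs: "apply_bcontfun (rhs a x) s = f (segment h (apply_bcontfun x) s)" if "s \<in> {0..a}" for s
    using apply_rhs[OF a x that] by (simp add: bsegment_def)
  have der: "(apply_bcontfun x has_vector_derivative f (segment h (apply_bcontfun x) t)) (at t within {0..a})"
    if t: "t \<in> {0..a}" for t
  proof -
    have "((\<lambda>t. u 0 + integral {0..t} (apply_bcontfun (rhs a x))) has_vector_derivative (0 + rhs a x t)) (at t within {0..a})"
      by (intro has_vector_derivative_add has_vector_derivative_const integral_has_vector_derivative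
          continuous_on_apply_bcontfun t)
    then have "(apply_bcontfun x has_vector_derivative (0 + rhs a x t)) (at t within {0..a})"
    proof (rule has_vector_derivative_transform[OF t, rotated])
      show "x s = u 0 + integral {0..s} (apply_bcontfun (rhs a x))" if "s \<in> {0..a}" for s
        using xt[of s] u0[of s] that a by (simp add: clamp_real)
    qed
    then show ?thesis using rhs[OF t] by simp
  qed
  have der_at: "(apply_bcontfun x has_vector_derivative f (segment h (apply_bcontfun x) t)) (at t)"
    if "0 < t" "t < a" for t
    using der[of t] that at_within_Icc_at[of 0 t a] by simp
  show ?thesis
    unfolding delay_solution_def
  proof (intro conjI allI impI)
    show "segment h (apply_bcontfun x) t \<in> U" if "0 \<le> t \<and> ereal t < ereal a" for t
    proof -
      have "bsegment h x t \<in> U" using x that by (simp add: W_iff[OF a])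
      then show ?thesis by (simp add: bsegment_def)
    qed
    show "(apply_bcontfun x has_vector_derivative f u) (at_right 0)"
      using der[of 0] a seg0 at_within_Icc_at_right[OF a] by simp
    have "continuous_on {t. 0 < t \<and> ereal t < ereal a} (\<lambda>t. vector_derivative (apply_bcontfun x) (at t))
        = continuous_on {t. 0 < t \<and> ereal t < ereal a} (apply_bcontfun (rhs a x))"
      using der_at rhs by (intro continuous_on_cong) (auto simp: vector_derivative_at)
    then show "continuous_on {t. 0 < t \<and> ereal t < ereal a} (\<lambda>t. vector_derivative (apply_bcontfun x) (at t))"
      by simp
  qed (use a seg0 der_at in auto)
qed

section \<open>Uniqueness of solutions and existence of a maximal one\<close>

lemma between_ereal:
  assumes "ereal t < T" "0 < T"
  obtains a where "t < a" "0 < a" "ereal a < T"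
proof -
  have "ereal (max t 0) < T" using assms by (simp add: max_def zero_ereal_def)
  then obtain a where "ereal (max t 0) < ereal a" "ereal a < T" using ereal_dense2 by blast
  then show thesis by (intro that[of a]) auto
qed

text \<open>Cut off at a time \<open>a\<close> between \<open>t\<close> and both existence times,
  the two solutions have the same image \<open>u\<close> under the injective map
  \<open>G a\<close>.\<close>

lemma solution_unique:
  assumes y: "delay_solution h U f u S y" and z: "delay_solution h U f u T z"
    and t: "- h \<le> t" "ereal t < S" "ereal t < T"
  shows "y t = z t"
proof -
  have "ereal t < min S T" "0 < min S T" using y z t by (auto simp: delay_solution_def)
  then obtain a where a: "t < a" "0 < a" "ereal a < min S T" by (rule between_ereal)
  interpret J: delay_jet h a k "(\<lambda>u. bsegment h u 0) -` U" D by (rule delay_jet[OF a(2)])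
  have lt: "ereal a < S" "ereal a < T" using a(3) by auto
  note Y = solution_imp_G[OF y a(2) lt(1)] and Z = solution_imp_G[OF z a(2) lt(2)]
  have "Bcontfun (ext_cont y (- h) a) = Bcontfun (ext_cont z (- h) a)"
    using J.inj_on_G Y(1,2) Z(1,2) by (auto dest: inj_onD)
  then show ?thesis using Y(4)[of t] Z(4)[of t] t(1) a(1) by simp
qed

text \<open>The maximal existence time is the supremum of all existence times. Solutions agree where
  both are defined, so choosing any of their values gives one function. Each \<open>t < T\<close>
  lies below the end of some solution, from which the requirements at \<open>t\<close> are
  inherited.\<close>

lemma maximal_solution_exists:
  assumes "delay_solution h U f u T0 y0"
  shows "\<exists>T x. maximal_delay_solution h U f u T x"
proof -
  define T where "T = Sup {S. \<exists>y. delay_solution h U f u S y}"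
  have ex: "\<exists>y S. delay_solution h U f u S y \<and> ereal t < S" if "ereal t < T" for t
    using that unfolding T_def less_Sup_iff by blast
  define x where "x t = (SOME v. \<exists>y S. delay_solution h U f u S y \<and> ereal t < S \<and> v = y t)" for t
  have x: "x t = y t" if y: "delay_solution h U f u S y" and t: "- h \<le> t" "ereal t < S" for y S t
  proof -
    have "\<exists>v. \<exists>y S. delay_solution h U f u S y \<and> ereal t < S \<and> v = y t" using y t by blast
    from someI_ex[OF this] obtain y' S' where "delay_solution h U f u S' y'" "ereal t < S'" "x t = y' t"
      unfolding x_def by blast
    then show ?thesis using solution_unique[OF _ y t(1)] t(2) by simp
  qed
  have ST: "S \<le> T" if "delay_solution h U f u S y" for S y
    unfolding T_def using that by (intro Sup_upper) blast
  have Tpos: "0 < T" using assms ST[OF assms] by (auto simp: delay_solution_def intro: less_le_trans)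
  have seg: "segment h x t = segment h y t"
    if y: "delay_solution h U f u S y" and t: "0 \<le> t" "ereal t < S" for y S t
  proof (rule segment_cong)
    fix r assume "r \<in> {t - h..t}"
    moreover from this have "ereal r < S" using t(2) by (simp add: le_less_trans[of "ereal r" "ereal t"])
    ultimately show "x r = y r" using t(1) by (intro x[OF y]) auto
  qed (use h in simp)
  have der: "(x has_vector_derivative f (segment h x t)) (at t)" if t: "0 < t" "ereal t < T" for t
  proof -
    obtain y S where y: "delay_solution h U f u S y" "ereal t < S" using ex[OF t(2)] by blast
    obtain s where s: "t < s" "ereal s < S" by (rule between_ereal[OF y(2)]) (use y in \<open>auto simp: delay_solution_def\<close>)
    have "(y has_vector_derivative f (segment h x t)) (at t)"
      using y t seg[OF y(1)] by (auto simp: delay_solution_def)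
    then show ?thesis
    proof (rule has_vector_derivative_transform_within_open[of _ _ _ "{0<..<s}"])
      fix r assume "r \<in> {0<..<s}"
      then have "ereal r < S" using s(2) by (simp add: less_trans[of "ereal r" "ereal s"])
      then show "y r = x r" using x[OF y(1), of r] h \<open>r \<in> {0<..<s}\<close> by simp
    qed (use t s in auto)
  qed
  have "delay_solution h U f u T x"
    unfolding delay_solution_def
  proof (intro conjI allI impI)
    show "continuous_on {t. - h \<le> t \<and> ereal t < T} x"
    proof (rule continuous_on_locally_left)
      fix t assume t: "t \<in> {t. - h \<le> t \<and> ereal t < T}"
      then obtain y S where y: "delay_solution h U f u S y" "ereal t < S" using ex by blast
      obtain s where s: "t < s" "ereal s < S" by (rule between_ereal[OF y(2)]) (use y in \<open>auto simp: delay_solution_def\<close>)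
      have lt: "ereal r < S" if "r < s" for r using that s(2) by (simp add: less_trans[of "ereal r" "ereal s"])
      have "continuous_on ({t. - h \<le> t \<and> ereal t < T} \<inter> {..<s}) y"
        using y(1) lt by (auto simp: delay_solution_def elim!: continuous_on_subset)
      then have "continuous_on ({t. - h \<le> t \<and> ereal t < T} \<inter> {..<s}) x"
        by (rule continuous_on_eq) (use x[OF y(1)] lt in auto)
      then show "\<exists>s>t. continuous_on ({t. - h \<le> t \<and> ereal t < T} \<inter> {..<s}) x" using s(1) by blast
    qed
    obtain y S where y: "delay_solution h U f u S y" "0 < S" using assms by (auto simp: delay_solution_def)
    then have y0: "ereal 0 < S" by (simp add: zero_ereal_def)
    show seg0: "segment h x 0 = u"
      using seg[OF y(1) _ y0] y(1) by (simp add: delay_solution_def)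
    show "segment h x t \<in> U" if t: "0 \<le> t \<and> ereal t < T" for t
    proof -
      obtain y S where y: "delay_solution h U f u S y" "ereal t < S" using ex t by blast
      then show ?thesis using seg[OF y(1) _ y(2)] t by (auto simp: delay_solution_def)
    qed
    show "(x has_vector_derivative f u) (at_right 0)"
    proof -
      obtain s where s: "0 < s" "ereal s < S" by (rule between_ereal[OF y0 y(2)])
      \<comment> \<open>The point 0 is added to the right-hand neighbourhood because the
        transformation lemma wants the base point in the set.\<close>
      have "(y has_vector_derivative f u) (at 0 within {0..})"
        using y(1) by (simp add: delay_solution_def at_within_Ici_at_right)
      then have "(x has_vector_derivative f u) (at 0 within {0..})"
      proof (rule has_vector_derivative_transform_within[OF _ s(1)])
        fix r :: real assume "r \<in> {0..}" "dist r 0 < s"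
        then have "ereal r < S" using s(2) by (simp add: less_trans[of "ereal r" "ereal s"])
        then show "y r = x r" using x[OF y(1), of r] h \<open>r \<in> {0..}\<close> by simp
      qed simp
      then show ?thesis by (simp add: at_within_Ici_at_right)
    qed
    show "continuous_on {t. 0 < t \<and> ereal t < T} (\<lambda>t. vector_derivative x (at t))"
    proof (rule continuous_on_locally_left)
      fix t assume t: "t \<in> {t. 0 < t \<and> ereal t < T}"
      then obtain y S where y: "delay_solution h U f u S y" "ereal t < S" using ex by blast
      obtain s where s: "t < s" "ereal s < S" by (rule between_ereal[OF y(2)]) (use y in \<open>auto simp: delay_solution_def\<close>)
      have lt: "ereal r < S" if "r < s" for r using that s(2) by (simp add: less_trans[of "ereal r" "ereal s"])
      have "continuous_on ({t. 0 < t \<and> ereal t < T} \<inter> {..<s}) (\<lambda>t. vector_derivative y (at t))"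
        using y(1) lt by (auto simp: delay_solution_def elim!: continuous_on_subset)
      then have "continuous_on ({t. 0 < t \<and> ereal t < T} \<inter> {..<s}) (\<lambda>t. vector_derivative x (at t))"
      proof (rule continuous_on_eq)
        fix r assume r: "r \<in> {t. 0 < t \<and> ereal t < T} \<inter> {..<s}"
        then have "vector_derivative y (at r) = f (segment h y r)"
          using y(1) lt by (intro vector_derivative_at) (auto simp: delay_solution_def)
        moreover have "vector_derivative x (at r) = f (segment h x r)"
          using r by (intro vector_derivative_at der) auto
        ultimately show "vector_derivative y (at r) = vector_derivative x (at r)"
          using seg[OF y(1), of r] r lt by simp
      qed
      then show "\<exists>s>t. continuous_on ({t. 0 < t \<and> ereal t < T} \<inter> {..<s}) (\<lambda>t. vector_derivative x (at t))"
        using s(1) by blast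
    qed
  qed (use Tpos der in auto)
  then have "maximal_delay_solution h U f u T x"
    unfolding maximal_delay_solution_def using ST x by metis
  then show ?thesis by blast
qed

section \<open>The time-t map in terms of the inverse of G\<close>

lemma semiflow_eq_bsegment:
  assumes t: "0 < t" and a: "t < a" and u: "u \<in> delay_space h" and x: "x \<in> W a" "G a x = u"
  shows "(t, u) \<in> semiflow_domain h U f" "semiflow h U f t u = bsegment h x t"
proof -
  have a0: "0 < a" using t a by simp
  have sol: "delay_solution h U f u (ereal a) (apply_bcontfun x)" by (rule G_imp_solution[OF a0 u x])
  obtain T y where y: "maximal_delay_solution h U f u T y" using maximal_solution_exists[OF sol] by blast
  have aT: "ereal a \<le> T" and eq: "\<And>s. - h \<le> s \<Longrightarrow> s < a \<Longrightarrow> x s = y s"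
    using y sol unfolding maximal_delay_solution_def by auto
  have tT: "ereal t < T" using a aT by (simp add: less_le_trans[of "ereal t" "ereal a"])
  have "u \<in> U" using sol a0 unfolding delay_solution_def by (metis ereal_less(2) order_refl zero_ereal_def)
  then show "(t, u) \<in> semiflow_domain h U f"
    unfolding semiflow_domain_def using t y tT by auto
  have "semiflow h U f t u = segment h y t"
    using h t tT y by (intro semiflow_eq_segment) auto
  also have "\<dots> = bsegment h x t"
    unfolding bsegment_def by (rule segment_cong) (use h t a eq in auto)
  finally show "semiflow h U f t u = bsegment h x t" .
qed

lemma semiflow_domain_imp:
  assumes "(t, u) \<in> semiflow_domain h U f" "0 < t"
  obtains a where "t < a" "u \<in> G a ` W a"
proof -
  obtain T y where y: "maximal_delay_solution h U f u T y" "ereal t < T"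
    using assms(1) unfolding semiflow_domain_def by blast
  then have sol: "delay_solution h U f u T y" by (simp add: maximal_delay_solution_def)
  obtain a where a: "t < a" "0 < a" "ereal a < T"
    by (rule between_ereal[OF y(2)]) (use sol in \<open>auto simp: delay_solution_def\<close>)
  have "u \<in> G a ` W a" using solution_imp_G(1,2)[OF sol a(2,3)] by blast
  with a(1) show thesis by (rule that)
qed

lemma semiflow_domain_subset: "{u. (t, u) \<in> semiflow_domain h U f} \<subseteq> U"
  by (auto simp: semiflow_domain_def)

text \<open>For \<open>a > t\<close>, on initial values in the image of \<open>W a\<close> under
  \<open>G a\<close>, the time-\<open>t\<close> map is the inverse of \<open>G a\<close> followed by
  taking the segment at \<open>t\<close>. No single \<open>a\<close> need serve for all initial
  values, since their existence times may come arbitrarily close to \<open>t\<close>. The pieces are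
  glued on the full space, after composition with the projection, and the result is then restricted
  to \<open>delay_space h\<close>, where the projection is the identity.\<close>

lemma Ck_on_semiflow:
  assumes t: "0 < t"
  shows "Ck_on (delay_space h) k {u. (t, u) \<in> semiflow_domain h U f} (semiflow h U f t)"
proof -
  let ?P = "\<lambda>u :: real \<Rightarrow>\<^sub>C 'b. bsegment h u 0"
  let ?V = "{u. (t, u) \<in> semiflow_domain h U f}"
  have P: "?P u \<in> delay_space h" for u using h by (intro bsegment_in_delay_space) simp
  have "Ck_on UNIV k (?P -` ?V) (\<lambda>u. semiflow h U f t (?P u))"
  proof (rule Ck_on_UNIV_locally)
    fix u assume "u \<in> ?P -` ?V"
    then have "(t, ?P u) \<in> semiflow_domain h U f" by simp
    then obtain a where a: "t < a" "?P u \<in> G a ` W a" using semiflow_domain_imp t by blast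
    interpret J: delay_jet h a k "?P -` U" D by (rule delay_jet) (use t a in simp)
    have flow: "(t, ?P v) \<in> semiflow_domain h U f"
        "semiflow h U f t (?P v) = bsegment h (inv_into (W a) (G a) (?P v)) t"
      if "?P v \<in> G a ` W a" for v
      using semiflow_eq_bsegment[OF t a(1) P inv_into_into[OF that] f_inv_into_f[OF that]] by auto
    have "Ck_on UNIV k (?P -` (G a ` W a)) (\<lambda>v. bsegment h (inv_into (W a) (G a) (?P v)) t)"
      by (rule Ck_on_compose_bounded_linear[OF J.Ck_on_inverse_G bounded_linear_bsegment _ bounded_linear_bsegment]) simp
    then have "Ck_on UNIV k (?P -` (G a ` W a)) (\<lambda>v. semiflow h U f t (?P v))"
      by (rule Ck_on_cong) (use flow(2) in simp)
    then show "\<exists>V. u \<in> V \<and> V \<subseteq> ?P -` ?V \<and> Ck_on UNIV k V (\<lambda>u. semiflow h U f t (?P u))"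
      using a(2) flow(1) by (intro exI[of _ "?P -` (G a ` W a)"]) auto
  qed
  then have "Ck_on (delay_space h) k (?P -` ?V \<inter> delay_space h) (\<lambda>u. semiflow h U f t (?P u))"
    by (rule Ck_on_restrict)
  moreover have "?P -` ?V \<inter> delay_space h = ?V"
    using semiflow_domain_subset[of t] U by (auto simp: bsegment_0)
  ultimately have "Ck_on (delay_space h) k ?V (\<lambda>u. semiflow h U f t (?P u))" by simp
  then show ?thesis
    by (rule Ck_on_cong) (use semiflow_domain_subset[of t] U in \<open>auto simp: bsegment_0\<close>)
qed

end

theorem proposition35:
  fixes h t :: real and k :: nat
    and U :: "(real \<Rightarrow>\<^sub>C (real^'n)) set"
    and f :: "(real \<Rightarrow>\<^sub>C (real^'n)) \<Rightarrow> real^'n"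
  assumes "h > 0"
    and "openin (top_of_set (delay_space h)) U"
    and "k \<ge> 1"
    and "Ck_on (delay_space h) k U f"
    and "t > 0"
  shows "Ck_on (delay_space h) k {u. (t, u) \<in> semiflow_domain h U f} (semiflow h U f t)"
proof -
  let ?P = "\<lambda>u :: real \<Rightarrow>\<^sub>C (real^'n). bsegment h u 0"
  \<comment> \<open>The projection moves the hypothesis on \<open>f\<close> to an open set of the
    full space, where jets are available.\<close>
  have "Ck_on UNIV k (?P -` U) (\<lambda>u. f (?P u))"
    by (rule Ck_on_compose_bounded_linear[OF assms(4) bounded_linear_bsegment _ bounded_linear_ident])
      (use assms(1) in \<open>auto intro: bsegment_in_delay_space\<close>)
  then obtain D where D: "jet k (?P -` U) D" "\<And>u. u \<in> ?P -` U \<Longrightarrow> D u [] = f (?P u)"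
    by (rule Ck_on_UNIV_imp_jet) blast
  interpret delay_equation h k U f D
    using assms D openin_imp_subset[OF assms(2)] by unfold_locales auto
  show ?thesis by (rule Ck_on_semiflow[OF assms(5)])
qed

end
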